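(* Let $\mathcal{W}\subset\mathbb{R}^d$ be a closed, bounded set such that for every $\xi\in\mathcal{W}$ there exist $\eta=\eta(\xi)\in\mathbb{R}^d$ and $a=a(\xi)>0$ with $B_{ta}(w+t\eta)\subset\mathcal{W}^o$ for all $w\in\mathcal{W}\cap B_a(\xi)$ and all $t\in(0,1]$. Let $\alpha:\mathcal{W}\to\mathbb{R}$, $\vartheta:\mathcal{W}\to\mathbb{R}^d$, $\sigma:\mathcal{W}\to\mathbb{R}^{d\times k}$, $g:\mathcal{W}\to\mathbb{R}$ and $\mathcal{H}:\mathcal{W}\times\mathbb{R}^d\to\mathbb{R}$ satisfy, for some $C\in[1,\infty)$, $\alpha_0>0$ and a function $\omega:\mathbb{R}_+\to\mathbb{R}_+$ with $\omega(0+)=0$: $|\alpha(x)-\alpha(y)|+|\vartheta(x)-\vartheta(y)|+|\sigma(x)-\sigma(y)|\le C|x-y|$ for $x,y\in\mathcal{W}$; $\alpha(x)\ge\alpha_0$ for $x\in\mathcal{W}$; $|g(x)-g(y)|+|\mathcal{H}(x,q)-\mathcal{H}(y,q)|\le\omega(|x-y|)$ for $x,y\in\mathcal{W}$, $q\in\mathbb{R}^d$; $|\mathcal{H}(x,q_1)-\mathcal{H}(x,q_2)|\le C|q_1-q_2|$ for $x\in\mathcal{W}$, $q_1,q_2\in\mathbb{R}^d$; $q\mapsto\mathcal{H}(x,q)$ is convex for every $x\in\mathcal{W}$; and there exist $\gamma>0$ and $\psi_0\in C^2(\mathcal{W})$ with $\mathcal{H}(x,D\psi_0(x))\le-\gamma$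 for all $x\in\mathcal{W}^o$. Let $\check v$ be a viscosity subsolution of $F(x,\psi,D\psi,D^2\psi)\vee\mathcal{H}(x,D\psi)=0$ on $\mathcal{W}^o$ and let $v$ be a viscosity supersolution of the same equation on $\mathcal{W}$. Then $\check v\le v$ on $\mathcal{W}$.
   Context: $\mathcal{W}^o$ is the interior of $\mathcal{W}$, $B_r(x)$ the open Euclidean ball, $|\cdot|$ the Euclidean/operator norm, $\Gamma=\sigma\sigma'$, $\mathcal{S}(d)$ the symmetric $d\times d$ matrices, and $F(x,r,q,A)=\alpha(x)r-\vartheta(x)\cdot q-\frac12\mathrm{trace}(\Gamma(x)A)-g(x)$ for $(x,r,q,A)\in\mathcal{W}\times\mathbb{R}\times\mathbb{R}^d\times\mathcal{S}(d)$. For $S\subset\mathcal{W}$, $\psi$ is a viscosity supersolution [subsolution] of $F(x,\psi,D\psi,D^2\psi)\vee\mathcal{H}(x,D\psi)=0$ on $S$ if $\psi$ is a continuous real-valued function on $\overline{S}$ and for every $w\in S$ and every $\varphi\in C^2(S)$ such that $\psi-\varphi$ has a global minimum [maximum] on $S$ at $w$, one has $F(w,\psi(w),D\varphi(w),D^2\varphi(w))\vee\mathcal{H}(w,D\varphi(w))\ge0$ [$\le0$]. *)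

theory Defs
  imports "HOL-Analysis.Analysis"
begin

definition grad :: "(real^'d \<Rightarrow> real) \<Rightarrow> real^'d \<Rightarrow> real^'d" where
  "grad \<phi> x = (\<chi> i. frechet_derivative \<phi> (at x) (axis i 1))"

definition hess :: "(real^'d \<Rightarrow> real) \<Rightarrow> real^'d \<Rightarrow> real^'d^'d" where
  "hess \<phi> x = jacobian (grad \<phi>) (at x)"

definition C2_on :: "(real^'d) set \<Rightarrow> (real^'d \<Rightarrow> real) \<Rightarrow> bool" where
  "C2_on S \<phi> \<longleftrightarrow> (\<exists>U. open U \<and> S \<subseteq> U \<and>
      (\<forall>x\<in>U. \<phi> differentiable (at x)) \<and>
      (\<forall>x\<in>U. grad \<phi> differentiable (at x)) \<and>
      continuous_on U (hess \<phi>))"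

definition opnorm :: "real^'k^'d \<Rightarrow> real" where
  "opnorm M = onorm (\<lambda>v. M *v v)"

definition Fop :: "(real^'d \<Rightarrow> real) \<Rightarrow> (real^'d \<Rightarrow> real^'d) \<Rightarrow> (real^'d \<Rightarrow> real^'k^'d)
     \<Rightarrow> (real^'d \<Rightarrow> real) \<Rightarrow> real^'d \<Rightarrow> real \<Rightarrow> real^'d \<Rightarrow> real^'d^'d \<Rightarrow> real" where
  "Fop \<alpha> \<theta> \<sigma> g x r q A =
     \<alpha> x * r - \<theta> x \<bullet> q - (1/2) * trace ((\<sigma> x ** transpose (\<sigma> x)) ** A) - g x"

definition visc_super ::
  "(real^'d \<Rightarrow> real) \<Rightarrow> (real^'d \<Rightarrow> real^'d) \<Rightarrow> (real^'d \<Rightarrow> real^'k^'d) \<Rightarrow> (real^'d \<Rightarrow> real)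
   \<Rightarrow> (real^'d \<Rightarrow> real^'d \<Rightarrow> real) \<Rightarrow> (real^'d) set \<Rightarrow> (real^'d \<Rightarrow> real) \<Rightarrow> bool" where
  "visc_super \<alpha> \<theta> \<sigma> g H S \<psi> \<longleftrightarrow> continuous_on (closure S) \<psi> \<and>
     (\<forall>w\<in>S. \<forall>\<phi>. C2_on S \<phi> \<and> (\<forall>x\<in>S. \<psi> x - \<phi> x \<ge> \<psi> w - \<phi> w) \<longrightarrow>
        max (Fop \<alpha> \<theta> \<sigma> g w (\<psi> w) (grad \<phi> w) (hess \<phi> w)) (H w (grad \<phi> w)) \<ge> 0)"

definition visc_sub ::
  "(real^'d \<Rightarrow> real) \<Rightarrow> (real^'d \<Rightarrow> real^'d) \<Rightarrow> (real^'d \<Rightarrow> real^'k^'d) \<Rightarrow> (real^'d \<Rightarrow> real)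
   \<Rightarrow> (real^'d \<Rightarrow> real^'d \<Rightarrow> real) \<Rightarrow> (real^'d) set \<Rightarrow> (real^'d \<Rightarrow> real) \<Rightarrow> bool" where
  "visc_sub \<alpha> \<theta> \<sigma> g H S \<psi> \<longleftrightarrow> continuous_on (closure S) \<psi> \<and>
     (\<forall>w\<in>S. \<forall>\<phi>. C2_on S \<phi> \<and> (\<forall>x\<in>S. \<psi> x - \<phi> x \<le> \<psi> w - \<phi> w) \<longrightarrow>
        max (Fop \<alpha> \<theta> \<sigma> g w (\<psi> w) (grad \<phi> w) (hess \<phi> w)) (H w (grad \<phi> w)) \<le> 0)"

end

theory Submission
  imports Defs
begin

text \<open>
  The subsolution is first made strict by mixing in a little of \<open>\<psi>\<^sub>0\<close> (minus a constant), using the convexity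
  of \<open>H\<close>. The variables are then doubled with the penalty
  \<open>n\<^sup>2 |x - y - e / n|\<^sup>2 + \<nu> |y - z\<^sub>0|\<^sup>2\<close>, where \<open>e\<close> points along the interior cone at \<open>z\<^sub>0\<close>,
  so that the maximising \<open>x\<close> is an interior point, where the subsolution may be tested. Strictness makes
  \<open>H\<close> negative on the supersolution side as well, and only the linear operator \<open>F\<close> has to be compared.

  Instead of the Crandall--Ishii lemma, which rests on theorems of Alexandrov and Jensen, the following
  argument is used. The sup-convolutions at the maximum are semiconvex, hence touching Hessians are
  bounded below, and a slightly enlarged constant diffusion absorbs the variable one. For constant
  coefficients, a viscosity subsolution lies below the heat flow of any smooth majorant, by the
  elementary maximum principle. Trigonometric polynomials are dense and have explicit heat flows; comparing
  the sum of two such flows with the flow of a quadratic, again by the maximum principle, gives the required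
  inequality to first order in time.
\<close>

section \<open>Functions with prescribed gradient and Hessian\<close>

text \<open>The subsolution may be tested only in the interior, whereas unshifted doubling could put
  \<open>x0\<close> on the boundary. With \<open>e = \<delta> \<eta>\<close>, the point
  \<open>y0 + e / n\<close> is the centre of a cone ball of radius \<open>\<delta> a / n\<close>,
  and the penalty bound \<open>n |x0 - y0 - e / n| \<le> sqrt \<epsilon>\<close> keeps
  \<open>x0\<close> inside that ball. The term in \<open>\<nu>\<close> keeps \<open>y0\<close> where
  the cone at \<open>z0\<close> applies. The price of the shift is that the diffusion error, n^2
  times the squared difference of \<sigma>, does not vanish as n grows: it is of size |e|^2 +
  \<epsilon>, so \<open>e\<close> itself must be small. The penalty gradients may grow with n, so
  the negative gap of \<open>H\<close> is carried from \<open>x0\<close> to \<open>y0\<close> by a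
  modulus that is uniform in the gradient.

  The second-order estimate is a coupling argument: both heat flows are driven by the same noise, so
  \<mu> |x - y|^2 grows only at the rate \<mu> times the sum of |s1 j - s2 j|^2. Flow and
  subsolution are compared at the origin for small t; the error of the initial approximation is
  chosen after t and is negligible even after division by t.\<close>

definition C2_with ::
  "(real^'d) set \<Rightarrow> (real^'d \<Rightarrow> real) \<Rightarrow> (real^'d \<Rightarrow> real^'d) \<Rightarrow> (real^'d \<Rightarrow> real^'d^'d) \<Rightarrow> bool" where
  "C2_with U f G Q \<longleftrightarrow>
     (\<forall>x\<in>U. (f has_derivative (\<lambda>v. G x \<bullet> v)) (at x) \<and> (G has_derivative (\<lambda>v. Q x *v v)) (at x)) \<and>
     continuous_on U Q"

lemma grad_eqI:
  assumes "(f has_derivative (\<lambda>v. g \<bullet> v)) (at x)"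
  shows "grad f x = g"
proof -
  have "frechet_derivative f (at x) = (\<lambda>v. g \<bullet> v)"
    using frechet_derivative_at[OF assms] by simp
  then show ?thesis
    by (simp add: grad_def vec_eq_iff inner_axis)
qed

lemma hess_eqI:
  assumes "(grad f has_derivative (\<lambda>v. A *v v)) (at x)"
  shows "hess f x = A"
  unfolding hess_def jacobian_def frechet_derivative_at[OF assms, symmetric]
  by (simp add: matrix_of_matrix_vector_mul)

lemma C2_with_grad:
  assumes "C2_with U f G Q" "x \<in> U"
  shows "grad f x = G x"
  using assms by (auto simp: C2_with_def intro: grad_eqI)

lemma C2_with_grad_has_derivative:
  assumes "C2_with U f G Q" "open U" "x \<in> U"
  shows "(grad f has_derivative (\<lambda>v. Q x *v v)) (at x)"
proof (rule has_derivative_transform_within_open)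
  show "(G has_derivative (\<lambda>v. Q x *v v)) (at x)"
    using assms by (auto simp: C2_with_def)
  show "\<And>y. y \<in> U \<Longrightarrow> G y = grad f y"
    using C2_with_grad[OF assms(1)] by simp
qed (use assms in auto)

lemma C2_with_hess:
  assumes "C2_with U f G Q" "open U" "x \<in> U"
  shows "hess f x = Q x"
  by (rule hess_eqI) (rule C2_with_grad_has_derivative[OF assms])

text \<open>\<open>C2_with\<close> carries its derivatives as explicit functions, so that sums,
  multiples and translates follow by rules. This lemma and \<open>C2_on_imp_C2_with\<close> are the
  passage to and from \<open>grad\<close> and \<open>hess\<close>.\<close>

lemma C2_with_imp_C2_on:
  assumes "C2_with U f G Q" "open U" "S \<subseteq> U"
  shows "C2_on S f"
proof -
  have "continuous_on U (hess f)"
    using assms(1) C2_with_hess[OF assms(1,2)]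
    by (auto simp: C2_with_def cong: continuous_on_cong)
  moreover have "f differentiable (at x)" "grad f differentiable (at x)" if "x \<in> U" for x
    using assms(1) that C2_with_grad_has_derivative[OF assms(1,2) that]
    unfolding C2_with_def differentiable_def by blast+
  ultimately show ?thesis
    unfolding C2_on_def using assms(2,3) by blast
qed

lemma has_derivative_grad:
  assumes "f differentiable (at x)"
  shows "(f has_derivative (\<lambda>v. grad f x \<bullet> v)) (at x)"
proof -
  have d: "(f has_derivative frechet_derivative f (at x)) (at x)"
    using assms frechet_derivative_works by blast
  interpret linear "frechet_derivative f (at x)"
    using d has_derivative_linear by blast
  have "frechet_derivative f (at x) v = grad f x \<bullet> v" for v
  proof -
    have "frechet_derivative f (at x) v = frechet_derivative f (at x) (\<Sum>i\<in>UNIV. (v $ i) *\<^sub>R axis i 1)"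
      using basis_expansion[of v] by (simp add: scalar_mult_eq_scaleR)
    also have "\<dots> = (\<Sum>i\<in>UNIV. v $ i * frechet_derivative f (at x) (axis i 1))"
      by (simp add: sum scale)
    also have "\<dots> = grad f x \<bullet> v"
      by (simp add: grad_def inner_vec_def mult.commute)
    finally show ?thesis .
  qed
  then show ?thesis using d by (metis (no_types, lifting) ext)
qed

lemma C2_on_imp_C2_with:
  assumes "C2_on S f"
  obtains U where "open U" "S \<subseteq> U" "C2_with U f (grad f) (hess f)"
proof -
  obtain U where U: "open U" "S \<subseteq> U" "\<And>x. x \<in> U \<Longrightarrow> f differentiable (at x)"
      "\<And>x. x \<in> U \<Longrightarrow> grad f differentiable (at x)" "continuous_on U (hess f)"
    using assms unfolding C2_on_def by blast
  have "(grad f has_derivative (\<lambda>v. hess f x *v v)) (at x)" if "x \<in> U" for x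
    using U(4)[OF that] unfolding hess_def by (simp add: jacobian_works)
  then have "C2_with U f (grad f) (hess f)"
    unfolding C2_with_def using U has_derivative_grad by blast
  then show ?thesis using U that by blast
qed

lemma C2_with_subset: "C2_with U f G Q \<Longrightarrow> V \<subseteq> U \<Longrightarrow> C2_with V f G Q"
  by (auto simp: C2_with_def intro: continuous_on_subset)

lemma C2_with_add:
  assumes "C2_with U f G Q" "C2_with U f' G' Q'"
  shows "C2_with U (\<lambda>x. f x + f' x) (\<lambda>x. G x + G' x) (\<lambda>x. Q x + Q' x)"
  unfolding C2_with_def
proof (intro conjI ballI)
  fix x assume "x \<in> U"
  then have "(f has_derivative (\<lambda>v. G x \<bullet> v)) (at x)" "(f' has_derivative (\<lambda>v. G' x \<bullet> v)) (at x)"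
    "(G has_derivative (\<lambda>v. Q x *v v)) (at x)" "(G' has_derivative (\<lambda>v. Q' x *v v)) (at x)"
    using assms by (simp_all add: C2_with_def)
  then show "((\<lambda>x. f x + f' x) has_derivative (\<lambda>v. (G x + G' x) \<bullet> v)) (at x)"
    and "((\<lambda>x. G x + G' x) has_derivative (\<lambda>v. (Q x + Q' x) *v v)) (at x)"
    unfolding inner_add_left matrix_vector_mult_add_rdistrib
    by (simp_all add: has_derivative_add)
next
  show "continuous_on U (\<lambda>x. Q x + Q' x)"
    using assms by (auto simp: C2_with_def intro!: continuous_intros)
qed

lemma scaleR_matrix_vector: "(c *\<^sub>R A) *v v = c *\<^sub>R (A *v (v::real^'n))"
  by (simp add: scaleR_matrix_vector_assoc)

lemma C2_with_cmult:
  assumes "C2_with U f G Q"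
  shows "C2_with U (\<lambda>x. c * f x) (\<lambda>x. c *\<^sub>R G x) (\<lambda>x. c *\<^sub>R Q x)"
  using assms unfolding C2_with_def
  by (auto simp: scaleR_matrix_vector intro!: derivative_eq_intros continuous_intros)

lemma C2_with_translate:
  assumes "C2_with UNIV f G Q"
  shows "C2_with UNIV (\<lambda>x. f (x + c)) (\<lambda>x. G (x + c)) (\<lambda>x. Q (x + c))"
proof -
  have t: "((\<lambda>x. x + c) has_derivative (\<lambda>v. v)) (at x)" for x :: "real^'a"
    by (auto intro!: derivative_eq_intros)
  have "(f has_derivative (\<lambda>v. G (x + c) \<bullet> v)) (at (x + c))"
    and "(G has_derivative (\<lambda>v. Q (x + c) *v v)) (at (x + c))" for x
    using assms by (simp_all add: C2_with_def)
  from this[THEN diff_chain_at[OF t]]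
  have "((\<lambda>x. f (x + c)) has_derivative (\<lambda>v. G (x + c) \<bullet> v)) (at x)"
    and "((\<lambda>x. G (x + c)) has_derivative (\<lambda>v. Q (x + c) *v v)) (at x)" for x
    by (simp_all only: comp_def)
  moreover have "continuous_on UNIV (\<lambda>x. Q (x + c))"
  proof (rule continuous_on_compose2[of UNIV Q])
    show "continuous_on UNIV Q" using assms by (simp add: C2_with_def)
  qed (auto intro!: continuous_intros)
  ultimately show ?thesis by (simp add: C2_with_def)
qed

section \<open>Affine, quadratic, quartic and cosine building blocks\<close>

lemma C2_with_const: "C2_with U (\<lambda>x. c) (\<lambda>x. 0) (\<lambda>x. 0)"
  by (simp add: C2_with_def)

lemma C2_with_linear: "C2_with U (\<lambda>x. p \<bullet> x) (\<lambda>x. p) (\<lambda>x. 0)"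
proof -
  have "((\<lambda>x. p \<bullet> x) has_derivative (\<lambda>v. p \<bullet> v)) (at x)" for x
    by (rule bounded_linear_imp_has_derivative[OF bounded_linear_inner_right])
  then show ?thesis by (auto simp: C2_with_def)
qed

lemma C2_with_square: "C2_with U (\<lambda>x. x \<bullet> x) (\<lambda>x. 2 *\<^sub>R x) (\<lambda>x. 2 *\<^sub>R mat 1)"
proof -
  have "((\<lambda>x. x \<bullet> x) has_derivative (\<lambda>v. 2 *\<^sub>R x \<bullet> v)) (at x)" for x :: "real^'a"
    by (auto simp: inner_commute intro!: derivative_eq_intros)
  moreover have "((\<lambda>x. 2 *\<^sub>R x) has_derivative (\<lambda>v. 2 *\<^sub>R v)) (at x)" for x :: "real^'a"
    by (auto intro!: derivative_eq_intros)
  ultimately show ?thesis by (simp add: C2_with_def scaleR_matrix_vector)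
qed

definition outer :: "real^'d \<Rightarrow> real^'d \<Rightarrow> real^'d^'d" where
  "outer a b = (\<chi> i j. a $ i * b $ j)"

lemma outer_mult: "outer a b *v v = (b \<bullet> v) *\<^sub>R a"
  by (simp add: outer_def vec_eq_iff matrix_vector_mult_def inner_vec_def sum_distrib_right sum_distrib_left mult_ac)

text \<open>Value, gradient and Hessian all vanish at the origin: a multiple centred at a contact
  point can make a local maximum global without changing the jet there.\<close>

lemma C2_with_quartic:
  "C2_with U (\<lambda>x. (x \<bullet> x)\<^sup>2) (\<lambda>x. (4 * (x \<bullet> x)) *\<^sub>R x) (\<lambda>x. (4 * (x \<bullet> x)) *\<^sub>R mat 1 + 8 *\<^sub>R outer x x)"
  unfolding C2_with_def
proof (intro conjI ballI)
  fix x :: "real^'a"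
  show "((\<lambda>x. (x \<bullet> x)\<^sup>2) has_derivative (\<lambda>v. (4 * (x \<bullet> x)) *\<^sub>R x \<bullet> v)) (at x)"
    by (auto simp: inner_commute power2_eq_square algebra_simps intro!: derivative_eq_intros)
  show "((\<lambda>x. (4 * (x \<bullet> x)) *\<^sub>R x) has_derivative
      (\<lambda>v. ((4 * (x \<bullet> x)) *\<^sub>R mat 1 + 8 *\<^sub>R outer x x) *v v)) (at x)"
    by (auto simp: scaleR_matrix_vector outer_mult matrix_vector_mult_add_rdistrib inner_commute
        algebra_simps intro!: derivative_eq_intros)
next
  show "continuous_on U (\<lambda>x. (4 * (x \<bullet> x)) *\<^sub>R mat 1 + 8 *\<^sub>R outer x x)"
    unfolding outer_def by (intro continuous_intros)
qed

text \<open>The Hessian is the function itself times a constant matrix, so a cosine is an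
  eigenfunction of every constant-coefficient second-order operator.\<close>

lemma C2_with_cos:
  "C2_with U (\<lambda>x. cos (k \<bullet> x + b)) (\<lambda>x. (- sin (k \<bullet> x + b)) *\<^sub>R k) (\<lambda>x. (- cos (k \<bullet> x + b)) *\<^sub>R outer k k)"
  unfolding C2_with_def
proof (intro conjI ballI)
  fix x
  show "((\<lambda>x. cos (k \<bullet> x + b)) has_derivative (\<lambda>v. (- sin (k \<bullet> x + b)) *\<^sub>R k \<bullet> v)) (at x)"
    by (auto intro!: derivative_eq_intros)
  show "((\<lambda>x. (- sin (k \<bullet> x + b)) *\<^sub>R k) has_derivative
      (\<lambda>v. ((- cos (k \<bullet> x + b)) *\<^sub>R outer k k) *v v)) (at x)"
    unfolding scaleR_matrix_vector outer_mult
    by (auto simp: algebra_simps intro!: derivative_eq_intros)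
qed (intro continuous_intros)

lemma C2_with_continuous: "C2_with U f G Q \<Longrightarrow> continuous_on U f"
  unfolding C2_with_def by (metis has_derivative_at_withinI has_derivative_continuous continuous_on_eq_continuous_within)

section \<open>First- and second-order conditions at a local maximum\<close>

lemma C2_with_line:
  assumes "C2_with UNIV f G Q"
  shows "((\<lambda>r. f (x + r *\<^sub>R v)) has_real_derivative G (x + r *\<^sub>R v) \<bullet> v) (at r)"
    and "((\<lambda>r. G (x + r *\<^sub>R v) \<bullet> v) has_real_derivative (Q x *v v) \<bullet> v) (at 0)"
proof -
  have l: "((\<lambda>r. x + r *\<^sub>R v) has_derivative (\<lambda>t. t *\<^sub>R v)) (at r)" for r
    by (auto intro!: derivative_eq_intros)
  have "(f has_derivative (\<lambda>w. G (x + r *\<^sub>R v) \<bullet> w)) (at (x + r *\<^sub>R v))"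
    using assms by (simp add: C2_with_def)
  from diff_chain_at[OF l this]
  show "((\<lambda>r. f (x + r *\<^sub>R v)) has_real_derivative G (x + r *\<^sub>R v) \<bullet> v) (at r)"
    by (simp add: has_field_derivative_def comp_def mult_commute_abs)
  have "(G has_derivative (\<lambda>w. Q x *v w)) (at (x + 0 *\<^sub>R v))"
    using assms by (simp add: C2_with_def)
  from diff_chain_at[OF l this]
  have "((\<lambda>r. G (x + r *\<^sub>R v)) has_derivative (\<lambda>t. Q x *v (t *\<^sub>R v))) (at 0)"
    by (simp add: comp_def)
  from has_derivative_inner_left[OF this, of v]
  show "((\<lambda>r. G (x + r *\<^sub>R v) \<bullet> v) has_real_derivative (Q x *v v) \<bullet> v) (at 0)"
    by (simp add: has_field_derivative_def matrix_vector_mult_scaleR mult_commute_abs)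
qed

text \<open>If \<open>D > 0\<close>, then \<open>f'\<close>, which vanishes at the maximum, is
  positive just to the right of 0, and \<open>f\<close> would increase beyond its maximum.\<close>

lemma second_derivative_nonpos_at_max:
  fixes f f' :: "real \<Rightarrow> real"
  assumes d1: "\<And>r. \<bar>r\<bar> < e \<Longrightarrow> (f has_real_derivative f' r) (at r)"
    and d2: "(f' has_real_derivative D) (at 0)"
    and e: "e > 0" and m: "\<And>r. \<bar>r\<bar> < e \<Longrightarrow> f r \<le> f 0"
  shows "D \<le> 0"
proof (rule ccontr)
  assume "\<not> D \<le> 0"
  then have D: "D > 0" by simp
  have f0: "f' 0 = 0"
    by (rule DERIV_local_max[OF d1[of 0] e]) (use e m in auto)
  obtain d where d: "d > 0" "\<And>h. h > 0 \<Longrightarrow> h < d \<Longrightarrow> f' h > 0"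
    using DERIV_pos_inc_right[OF d2 D] f0 by auto
  define h where "h = min d e / 2"
  have h: "0 < h" "h < d" "h < e" using d(1) e by (auto simp: h_def min_def)
  have "f 0 < f h"
  proof (rule DERIV_pos_imp_increasing_open[where f = f])
    show "\<exists>y. (f has_real_derivative y) (at x) \<and> 0 < y" if "0 < x" "x < h" for x
      using d1[of x] d(2)[of x] that h by auto
    show "continuous_on {0..h} f"
      using d1 h by (intro DERIV_continuous_on[where D = f']) (auto intro: has_field_derivative_at_within)
  qed (use h in auto)
  then show False using m[of h] h by auto
qed

lemma C2_with_local_max:
  assumes "C2_with UNIV f G Q" "e > 0" "\<And>x. norm (x - w) < e \<Longrightarrow> f x \<le> f w"
  shows "(Q w *v v) \<bullet> v \<le> 0" and "G w = 0"
proof -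
  show "(Q w *v v) \<bullet> v \<le> 0"
  proof (rule second_derivative_nonpos_at_max)
    show "((\<lambda>r. f (w + r *\<^sub>R v)) has_real_derivative G (w + r *\<^sub>R v) \<bullet> v) (at r)" for r
      by (rule C2_with_line[OF assms(1)])
    show "((\<lambda>r. G (w + r *\<^sub>R v) \<bullet> v) has_real_derivative (Q w *v v) \<bullet> v) (at 0)"
      by (rule C2_with_line[OF assms(1)])
    show "0 < e / (norm v + 1)" using assms(2) by (simp add: add_nonneg_pos)
    show "f (w + r *\<^sub>R v) \<le> f (w + 0 *\<^sub>R v)" if "\<bar>r\<bar> < e / (norm v + 1)" for r
    proof -
      have "\<bar>r\<bar> * norm v \<le> \<bar>r\<bar> * (norm v + 1)" by (simp add: mult_left_mono)
      also have "\<dots> < e"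
        using that by (simp add: pos_less_divide_eq add_nonneg_pos)
      finally show ?thesis using assms(3)[of "w + r *\<^sub>R v"] by simp
    qed
  qed
  have "(\<lambda>v. G w \<bullet> v) = (\<lambda>v. 0)"
  proof (rule differential_zero_maxmin[of w "ball w e" f])
    show "(f has_derivative (\<lambda>v. G w \<bullet> v)) (at w)"
      using assms(1) by (simp add: C2_with_def)
  qed (use assms(2,3) in \<open>auto simp: dist_norm norm_minus_commute\<close>)
  then show "G w = 0" by (metis inner_eq_zero_iff)
qed

section \<open>Heat flows of trigonometric polynomials\<close>

text \<open>At a positive maximum the backward difference quotients in time give
  \<open>D \<ge> 0\<close>, also when it is reached at the final time, while every \<open>D2\<close>
  is nonpositive; this contradicts the strict inequality. Space derivatives are required only along
  the lines \<open>s j\<close>, so the lemma applies to pairs of points without a calculus of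
  Hessians on the product space.\<close>

lemma max_principle:
  fixes \<Psi> :: "real \<Rightarrow> 'a::euclidean_space \<Rightarrow> real" and s :: "'j::finite \<Rightarrow> 'a"
  assumes cont: "continuous_on UNIV (\<lambda>(t, x). \<Psi> t x)"
    and coercive: "\<And>t x. 0 \<le> t \<Longrightarrow> t \<le> T \<Longrightarrow> norm x \<ge> R \<Longrightarrow> \<Psi> t x \<le> 0"
    and init: "\<And>x. \<Psi> 0 x \<le> 0"
    and dt: "\<And>t x. ((\<lambda>t. \<Psi> t x) has_real_derivative D t x) (at t)"
    and d1: "\<And>t x j r. ((\<lambda>r. \<Psi> t (x + r *\<^sub>R s j)) has_real_derivative D1 t x j r) (at r)"
    and d2: "\<And>t x j. (D1 t x j has_real_derivative D2 t x j) (at 0)"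
    and ineq: "\<And>t x. 0 < t \<Longrightarrow> t \<le> T \<Longrightarrow> D t x < (\<Sum>j\<in>UNIV. D2 t x j) / 2"
    and t: "0 \<le> t" "t \<le> T"
  shows "\<Psi> t x \<le> 0"
proof (rule ccontr)
  assume "\<not> \<Psi> t x \<le> 0"
  then have pos: "\<Psi> t x > 0" by simp
  then have x: "norm x < R" using coercive[of t x] t by force
  have "compact ({0..T} \<times> cball (0::'a) R)" by (intro compact_Times) auto
  moreover have "(t, x) \<in> {0..T} \<times> cball 0 R" using t x by auto
  ultimately obtain z where z: "z \<in> {0..T} \<times> cball 0 R"
      "\<And>y. y \<in> {0..T} \<times> cball 0 R \<Longrightarrow> (\<lambda>(t, x). \<Psi> t x) y \<le> (\<lambda>(t, x). \<Psi> t x) z"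
    using continuous_attains_sup[of "{0..T} \<times> cball 0 R" "\<lambda>(t, x). \<Psi> t x"]
      continuous_on_subset[OF cont] by blast
  obtain t0 x0 where tx: "z = (t0, x0)" by (cases z)
  have t0: "0 \<le> t0" "t0 \<le> T" using z(1) tx by auto
  have zmax: "\<Psi> t' x' \<le> \<Psi> t0 x0" if "0 \<le> t'" "t' \<le> T" "norm x' \<le> R" for t' x'
    using z(2)[of "(t', x')"] tx that by auto
  have p0: "\<Psi> t0 x0 > 0" using zmax[of t x] t x pos by auto
  have t0p: "0 < t0" using p0 init[of x0] t0 by (cases "t0 = 0") auto
  \<comment> \<open>Coercivity turns the maximum over the ball into one over the whole space, so a
    maximiser on the sphere needs no separate case.\<close>
  have zmax': "\<Psi> t0 x' \<le> \<Psi> t0 x0" for x'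
    using zmax[of t0 x'] coercive[of t0 x'] t0 p0 by (cases "norm x' \<le> R") auto
  have x0R: "norm x0 \<le> R" using z(1) tx by auto
  have "D t0 x0 \<ge> 0"
  proof (rule ccontr)
    assume "\<not> D t0 x0 \<ge> 0"
    then obtain d where d: "d > 0" "\<And>h. h > 0 \<Longrightarrow> h < d \<Longrightarrow> \<Psi> t0 x0 < \<Psi> (t0 - h) x0"
      using DERIV_neg_dec_left[OF dt[of x0 t0]] by auto
    define h where "h = min d t0 / 2"
    have "0 < h" "h < d" "h < t0" using d(1) t0p by (auto simp: h_def min_def)
    with d(2)[of h] zmax[of "t0 - h" x0] t0 x0R show False by auto
  qed
  moreover have "D2 t0 x0 j \<le> 0" for j
    by (rule second_derivative_nonpos_at_max[OF d1[of t0 x0 j] d2[of t0 x0 j], of 1])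
      (auto simp: zmax')
  then have "(\<Sum>j\<in>UNIV. D2 t0 x0 j) \<le> 0" by (simp add: sum_nonpos)
  ultimately show False using ineq[OF t0p t0(2), of x0] by auto
qed

text \<open>The vectors \<open>s j\<close> play the role of the columns of \<open>\<sigma>\<close>, which turns \<open>diff_op\<close> into the
  operator \<open>Q \<mapsto> trace (\<Gamma> Q) / 2\<close>.\<close>

definition diff_op :: "('j::finite \<Rightarrow> real^'d) \<Rightarrow> real^'d^'d \<Rightarrow> real" where
  "diff_op s Q = (\<Sum>j\<in>UNIV. (Q *v s j) \<bullet> s j) / 2"

text \<open>Time runs over all reals, which makes the time derivative two-sided even at 0. Bounds on
  flows are claimed only for nonnegative times.\<close>

definition evolution ::
  "(real \<Rightarrow> real^'d \<Rightarrow> real) \<Rightarrow> (real \<Rightarrow> real^'d \<Rightarrow> real^'d) \<Rightarrow> (real \<Rightarrow> real^'d \<Rightarrow> real^'d^'d)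
   \<Rightarrow> (real \<Rightarrow> real^'d \<Rightarrow> real) \<Rightarrow> bool" where
  "evolution h G Q D \<longleftrightarrow>
     (\<forall>t. C2_with UNIV (h t) (G t) (Q t)) \<and>
     (\<forall>t x. ((\<lambda>t. h t x) has_real_derivative D t x) (at t)) \<and>
     continuous_on UNIV (\<lambda>(t, x). h t x)"

lemma diff_op_add: "diff_op s (A + B) = diff_op s A + diff_op s B"
  by (simp add: diff_op_def matrix_vector_mult_add_rdistrib inner_add_left sum.distrib add_divide_distrib)

lemma diff_op_scaleR: "diff_op s (c *\<^sub>R A) = c * diff_op s A"
  by (simp add: diff_op_def scaleR_matrix_vector sum_distrib_left)

lemma diff_op_mat: "diff_op s (mat 1) = (\<Sum>j\<in>UNIV. (norm (s j))\<^sup>2) / 2"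
  by (simp add: diff_op_def power2_norm_eq_inner)

lemma evolution_add:
  assumes "evolution h G Q D" "evolution h' G' Q' D'"
  shows "evolution (\<lambda>t x. h t x + h' t x) (\<lambda>t x. G t x + G' t x) (\<lambda>t x. Q t x + Q' t x)
           (\<lambda>t x. D t x + D' t x)"
  using assms unfolding evolution_def
  by (auto intro!: C2_with_add DERIV_add continuous_on_add simp: case_prod_unfold)

lemma evolution_cmult:
  assumes "evolution h G Q D"
  shows "evolution (\<lambda>t x. c * h t x) (\<lambda>t x. c *\<^sub>R G t x) (\<lambda>t x. c *\<^sub>R Q t x) (\<lambda>t x. c * D t x)"
  using assms unfolding evolution_def
  by (auto intro!: C2_with_cmult DERIV_cmult continuous_on_mult_left simp: case_prod_unfold)

text \<open>The phase \<open>b\<close> brings in the sines, and the product formula for cosines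
  makes the class an algebra, as Stone-Weierstrass requires.\<close>

inductive trig_poly :: "(real^'d \<Rightarrow> real) \<Rightarrow> bool" where
  cos: "trig_poly (\<lambda>x. cos (k \<bullet> x + b))"
| add: "trig_poly f \<Longrightarrow> trig_poly g \<Longrightarrow> trig_poly (\<lambda>x. f x + g x)"
| cmult: "trig_poly f \<Longrightarrow> trig_poly (\<lambda>x. c * f x)"

lemma trig_poly_const: "trig_poly (\<lambda>x::real^'d. c)"
  using trig_poly.cmult[OF trig_poly.cos[of 0 0], of c] by simp

lemma trig_poly_sin_component: "trig_poly (\<lambda>x::real^'d. sin (x $ i))"
proof -
  have "cos (axis i 1 \<bullet> x + - (pi / 2)) = sin (x $ i)" for x :: "real^'d"
    by (simp add: inner_axis' cos_diff)
  then show ?thesis using trig_poly.cos[of "axis i 1" "- (pi / 2)"] by simp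
qed

lemma trig_poly_mult:
  assumes "trig_poly f" "trig_poly g"
  shows "trig_poly (\<lambda>x. f x * g x)"
  using assms
proof (induction f)
  case (cos k b)
  show ?case using \<open>trig_poly g\<close>
  proof (induction g)
    case (cos k' b')
    have e: "cos (k \<bullet> x + b) * cos (k' \<bullet> x + b') =
       (1/2) * cos ((k - k') \<bullet> x + (b - b')) + (1/2) * cos ((k + k') \<bullet> x + (b + b'))" for x
      unfolding cos_times_cos by (simp add: algebra_simps)
    show ?case unfolding e by (intro trig_poly.add trig_poly.cmult trig_poly.cos)
  next
    case (add f g)
    then show ?case unfolding distrib_left by (intro trig_poly.add)
  next
    case (cmult f c)
    then show ?case unfolding mult.left_commute[of _ c] by (intro trig_poly.cmult)
  qed
next
  case (add f g')
  then show ?case unfolding distrib_right by (intro trig_poly.add)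
next
  case (cmult f c)
  then show ?case unfolding mult.assoc by (intro trig_poly.cmult)
qed

lemma trig_poly_continuous: "trig_poly f \<Longrightarrow> continuous_on S f"
  by (induction rule: trig_poly.induct) (auto intro!: continuous_intros)

text \<open>A cosine of frequency \<open>k\<close> is multiplied by \<open>exp (- l * t)\<close>
  with \<open>l = diff_op s (outer k k)\<close>. Since \<open>l\<close> is a sum of squares, the
  flow stays bounded for positive times; sums and multiples follow by linearity.\<close>

lemma trig_poly_heat_flow:
  fixes s :: "'j::finite \<Rightarrow> real^'d"
  assumes "trig_poly f"
  shows "\<exists>h G Q D B. evolution h G Q D \<and> h 0 = f \<and> (\<forall>t x. D t x = diff_op s (Q t x)) \<and>
           (\<forall>t\<ge>0. \<forall>x. \<bar>h t x\<bar> \<le> B)"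
  using assms
proof (induction f)
  case (cos k b)
  define l where "l = diff_op s (outer k k)"
  have l: "l \<ge> 0"
    unfolding l_def diff_op_def outer_mult by (auto intro!: sum_nonneg)
  define h where "h = (\<lambda>t x. exp (- l * t) * cos (k \<bullet> x + b))"
  have "evolution h (\<lambda>t x. exp (- l * t) *\<^sub>R ((- sin (k \<bullet> x + b)) *\<^sub>R k))
      (\<lambda>t x. exp (- l * t) *\<^sub>R ((- cos (k \<bullet> x + b)) *\<^sub>R outer k k))
      (\<lambda>t x. - l * h t x)"
    unfolding evolution_def h_def
  proof (intro conjI allI)
    show "C2_with UNIV (\<lambda>x. exp (- l * t) * cos (k \<bullet> x + b))
        (\<lambda>x. exp (- l * t) *\<^sub>R ((- sin (k \<bullet> x + b)) *\<^sub>R k))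
        (\<lambda>x. exp (- l * t) *\<^sub>R ((- cos (k \<bullet> x + b)) *\<^sub>R outer k k))" for t
      by (intro C2_with_cmult C2_with_cos)
  qed (auto intro!: derivative_eq_intros continuous_intros simp: case_prod_unfold)
  moreover have "h 0 = (\<lambda>x. cos (k \<bullet> x + b))" by (simp add: h_def)
  moreover have "- l * h t x = diff_op s (exp (- l * t) *\<^sub>R ((- cos (k \<bullet> x + b)) *\<^sub>R outer k k))" for t x
    unfolding diff_op_scaleR h_def l_def by simp
  moreover have "\<bar>h t x\<bar> \<le> 1" if "t \<ge> 0" for t x
    using l that unfolding h_def abs_mult
    by (intro mult_le_one) auto
  ultimately show ?case by blast
next
  case (add f g)
  then obtain h G Q D B h' G' Q' D' B' where
    1: "evolution h G Q D" "h 0 = f" "\<forall>t x. D t x = diff_op s (Q t x)" "\<forall>t\<ge>0. \<forall>x. \<bar>h t x\<bar> \<le> B" and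
    2: "evolution h' G' Q' D'" "h' 0 = g" "\<forall>t x. D' t x = diff_op s (Q' t x)" "\<forall>t\<ge>0. \<forall>x. \<bar>h' t x\<bar> \<le> B'"
    by metis
  have bd: "\<bar>h t x + h' t x\<bar> \<le> B + B'" if "t \<ge> 0" for t x
    using 1(4) 2(4) that abs_triangle_ineq[of "h t x" "h' t x"] by (smt (verit))
  show ?case
    by (rule exI, rule exI, rule exI, rule exI, rule exI[of _ "B + B'"], intro conjI, rule evolution_add[OF 1(1) 2(1)]) (use 1(2,3) 2(2,3) bd in \<open>auto simp: diff_op_add\<close>)
next
  case (cmult f c)
  then obtain h G Q D B where
    1: "evolution h G Q D" "h 0 = f" "\<forall>t x. D t x = diff_op s (Q t x)" "\<forall>t\<ge>0. \<forall>x. \<bar>h t x\<bar> \<le> B"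
    by metis
  have bd: "\<bar>c * h t x\<bar> \<le> \<bar>c\<bar> * B" if "t \<ge> 0" for t x
    using 1(4) that by (simp add: abs_mult mult_left_mono)
  show ?case
    by (rule exI, rule exI, rule exI, rule exI, rule exI[of _ "\<bar>c\<bar> * B"], intro conjI, rule evolution_cmult[OF 1(1)]) (use 1(2,3) bd in \<open>auto simp: diff_op_scaleR\<close>)
qed

text \<open>The componentwise triangle wave: space is reflected periodically onto the cube of side
  \<pi> about the origin. It fixes the cube and leaves every function of the
  \<open>sin (x $ i)\<close> unchanged.\<close>

definition fold_box :: "real^'d \<Rightarrow> real^'d" where
  "fold_box x = (\<chi> i. arcsin (sin (x $ i)))"

lemma sin_fold_box: "sin (fold_box x $ i) = sin (x $ i)"
  by (simp add: fold_box_def)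

definition half_pi_box :: "(real^'d) set" where
  "half_pi_box = {x. \<forall>i. - (pi / 2) \<le> x $ i \<and> x $ i \<le> pi / 2}"

lemma fold_box_in: "fold_box x \<in> half_pi_box"
  unfolding half_pi_box_def fold_box_def mem_Collect_eq vec_lambda_beta
  by (meson arcsin_bounded sin_ge_minus_one sin_le_one)

lemma fold_box_id: "x \<in> half_pi_box \<Longrightarrow> fold_box x = x"
  unfolding half_pi_box_def mem_Collect_eq fold_box_def vec_eq_iff vec_lambda_beta
  by (meson arcsin_sin)

lemma fold_box_small:
  assumes "norm x \<le> 1"
  shows "fold_box x = x"
proof (rule fold_box_id)
  have "\<bar>x $ i\<bar> \<le> pi / 2" for i
    using component_le_norm_cart[of x i] assms pi_ge_two by simp
  then show "x \<in> half_pi_box"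
    unfolding half_pi_box_def mem_Collect_eq by (metis abs_le_D1 abs_le_D2 minus_le_iff)
qed

lemma compact_half_pi_box: "compact (half_pi_box :: (real^'d) set)"
proof -
  have "(half_pi_box :: (real^'d) set) = cbox (\<chi> i. - (pi / 2)) (\<chi> i. pi / 2)"
    unfolding half_pi_box_def set_eq_iff mem_box_cart mem_Collect_eq vec_lambda_beta by blast
  then show ?thesis using compact_cbox by metis
qed

text \<open>Folding keeps the approximation uniform on the whole space, not just on a box.\<close>

lemma trig_poly_dense:
  fixes f :: "real^'d \<Rightarrow> real"
  assumes f: "continuous_on UNIV f" and e: "e > 0"
  obtains g where "trig_poly g" "\<And>x. \<bar>g x - f (fold_box x)\<bar> < e"
proof -
  \<comment> \<open>Invariance under folding is built into the approximating algebra, so an error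
    bound on the cube holds everywhere. The coordinate sines belong to it and separate points, sine
    being injective on the half-period.\<close>
  let ?P = "\<lambda>g::real^'d \<Rightarrow> real. trig_poly g \<and> (\<forall>x. g (fold_box x) = g x)"
  have "\<exists>g. ?P g \<and> (\<forall>x\<in>half_pi_box. \<bar>f x - g x\<bar> < e)"
  proof (rule Stone_Weierstrass_HOL)
    show "compact (half_pi_box :: (real^'d) set)" by (rule compact_half_pi_box)
    show "?P (\<lambda>x. c)" for c by (simp add: trig_poly_const)
    show "?P g \<Longrightarrow> continuous_on half_pi_box g" for g using trig_poly_continuous by blast
    show "?P f \<and> ?P g \<Longrightarrow> ?P (\<lambda>x. f x + g x)" for f g using trig_poly.add by auto
    show "?P f \<and> ?P g \<Longrightarrow> ?P (\<lambda>x. f x * g x)" for f g using trig_poly_mult by auto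
    show "continuous_on half_pi_box f" using f continuous_on_subset by blast
    fix x y :: "real^'d"
    assume xy: "x \<in> half_pi_box \<and> y \<in> half_pi_box \<and> x \<noteq> y"
    then obtain i where i: "x $ i \<noteq> y $ i" by (auto simp: vec_eq_iff)
    have "sin (x $ i) \<noteq> sin (y $ i)"
    proof
      assume "sin (x $ i) = sin (y $ i)"
      then have "fold_box x $ i = fold_box y $ i" by (simp add: fold_box_def)
      then show False using xy i by (simp add: fold_box_id)
    qed
    then show "\<exists>f. ?P f \<and> f x \<noteq> f y"
      by (intro exI[of _ "\<lambda>x. sin (x $ i)"]) (simp add: trig_poly_sin_component sin_fold_box)
  qed (rule e)
  then obtain g where g: "?P g" "\<And>x. x \<in> half_pi_box \<Longrightarrow> \<bar>f x - g x\<bar> < e" by blast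
  have "\<bar>g x - f (fold_box x)\<bar> < e" for x
    using g(2)[OF fold_box_in[of x]] g(1) by (simp add: abs_minus_commute)
  then show ?thesis using g(1) that by blast
qed

section \<open>Maximum principle for a pair of evolutions\<close>

text \<open>The trace of the diffusion matrix, equivalently the rate at which the heat flow raises
  |x|^2.\<close>

definition energy :: "('j::finite \<Rightarrow> real^'d) \<Rightarrow> real" where
  "energy s = (\<Sum>j\<in>UNIV. (norm (s j))\<^sup>2)"

lemma energy_nonneg: "energy s \<ge> 0"
  by (simp add: energy_def sum_nonneg)

text \<open>The barrier grows quartically in space, yet is only \<open>O(t\<^sup>2)\<close> at the origin.\<close>

definition barrier :: "('j::finite \<Rightarrow> real^'d) \<Rightarrow> real \<Rightarrow> real^'d \<Rightarrow> real" where
  "barrier s t x = (x \<bullet> x)\<^sup>2 + ((6 * energy s * t) * (x \<bullet> x) + 3 * (energy s)\<^sup>2 * t\<^sup>2)"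

lemma barrier_zero: "barrier s t 0 = 3 * (energy s)\<^sup>2 * t\<^sup>2"
  by (simp add: barrier_def)

lemma barrier_init: "barrier s 0 x = norm x ^ 4"
  by (simp add: barrier_def flip: power2_norm_eq_inner)

lemma barrier_ge: "t \<ge> 0 \<Longrightarrow> norm x ^ 4 \<le> barrier s t x"
  using energy_nonneg[of s] by (simp add: barrier_def flip: power2_norm_eq_inner)

lemma diff_op_outer_le: "diff_op s (outer x x) \<le> (norm x)\<^sup>2 * energy s / 2"
proof -
  have "(\<Sum>j\<in>UNIV. (outer x x *v s j) \<bullet> s j) \<le> (\<Sum>j\<in>UNIV. (norm x)\<^sup>2 * (norm (s j))\<^sup>2)"
  proof (rule sum_mono)
    fix j
    have "(x \<bullet> s j)\<^sup>2 \<le> (norm x * norm (s j))\<^sup>2"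
      using Cauchy_Schwarz_ineq2[of x "s j"] by (simp add: abs_le_square_iff[symmetric])
    then show "(outer x x *v s j) \<bullet> s j \<le> (norm x)\<^sup>2 * (norm (s j))\<^sup>2"
      by (simp add: outer_mult power2_eq_square algebra_simps)
  qed
  then show ?thesis by (simp add: diff_op_def energy_def sum_distrib_left)
qed

text \<open>With m the energy, the quartic contributes at most 2m|x|^2 + 4m|x|^2 to
  \<open>diff_op\<close>, and the term 6mt|x|^2 contributes 6m^2 t. The time derivative is exactly
  this bound, which is where the 6 and the 3 in \<open>barrier\<close> come from.\<close>

lemma barrier_evolution:
  obtains G Q D where "evolution (barrier s) G Q D" "\<And>t x. t \<ge> 0 \<Longrightarrow> diff_op s (Q t x) \<le> D t x"
proof -
  let ?m = "energy s"
  define G where "G = (\<lambda>t x::real^'a. (4 * (x \<bullet> x)) *\<^sub>R x + ((6 * ?m * t) *\<^sub>R (2 *\<^sub>R x) + 0))"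
  define Q where "Q = (\<lambda>t x::real^'a. ((4 * (x \<bullet> x)) *\<^sub>R mat 1 + 8 *\<^sub>R outer x x) + ((6 * ?m * t) *\<^sub>R (2 *\<^sub>R mat 1) + 0))"
  define D where "D = (\<lambda>t x::real^'a. 6 * ?m * (x \<bullet> x) + 6 * ?m\<^sup>2 * t)"
  have "evolution (barrier s) G Q D"
    unfolding evolution_def
  proof (intro conjI allI)
    show "C2_with UNIV (barrier s t) (G t) (Q t)" for t
      unfolding barrier_def G_def Q_def
      by (intro C2_with_add C2_with_cmult C2_with_quartic C2_with_square C2_with_const)
    show "((\<lambda>t. barrier s t x) has_real_derivative D t x) (at t)" for t x
      unfolding barrier_def D_def by (auto intro!: derivative_eq_intros)
    show "continuous_on UNIV (\<lambda>(t, x). barrier s t x)"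
      unfolding barrier_def case_prod_unfold by (intro continuous_intros)
  qed
  moreover have "diff_op s (Q t x) \<le> D t x" for t x
  proof -
    have z: "diff_op s 0 = 0" by (simp add: diff_op_def)
    have "diff_op s (Q t x) = 4 * (x \<bullet> x) * (?m / 2) + 8 * diff_op s (outer x x) + 6 * ?m * t * (2 * (?m / 2))"
      by (simp only: Q_def diff_op_add diff_op_scaleR diff_op_mat z energy_def[symmetric])
    also have "\<dots> \<le> D t x"
      using diff_op_outer_le[of s x, unfolded power2_norm_eq_inner]
      by (simp add: D_def power2_eq_square algebra_simps)
    finally show ?thesis .
  qed
  ultimately show ?thesis using that by blast
qed

lemma square_line:
  fixes u w :: "'a::real_inner"
  shows "((\<lambda>r. (u + r *\<^sub>R w) \<bullet> (u + r *\<^sub>R w)) has_real_derivative 2 * ((u + r *\<^sub>R w) \<bullet> w)) (at r)"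
    and "((\<lambda>r. 2 * ((u + r *\<^sub>R w) \<bullet> w)) has_real_derivative 2 * (w \<bullet> w)) (at 0)"
proof -
  have e: "(u + r *\<^sub>R w) \<bullet> (u + r *\<^sub>R w) = u \<bullet> u + r * (2 * (u \<bullet> w)) + r\<^sup>2 * (w \<bullet> w)" for r
    by (simp add: algebra_simps inner_commute power2_eq_square)
  have e': "2 * ((u + r *\<^sub>R w) \<bullet> w) = 2 * (u \<bullet> w) + r * (2 * (w \<bullet> w))" for r
    by (simp add: algebra_simps)
  show "((\<lambda>r. (u + r *\<^sub>R w) \<bullet> (u + r *\<^sub>R w)) has_real_derivative 2 * ((u + r *\<^sub>R w) \<bullet> w)) (at r)"
    unfolding e e' by (auto intro!: derivative_eq_intros)
  show "((\<lambda>r. 2 * ((u + r *\<^sub>R w) \<bullet> w)) has_real_derivative 2 * (w \<bullet> w)) (at 0)"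
    unfolding e' by (auto intro!: derivative_eq_intros)
qed

text \<open>The maximum principle is applied in the product space along the common directions
  \<open>(s1 j, s2 j)\<close>. This couples the two diffusions: the quadratic in x - y sees only the
  differences \<open>s1 j - s2 j\<close>, which is the information that a matrix inequality for the
  two Hessians would otherwise supply.\<close>

lemma evolution_pair_le:
  fixes s1 s2 :: "'j::finite \<Rightarrow> real^'d"
  assumes k1: "evolution k1 G1 Q1 D1" "\<And>t x. t \<ge> 0 \<Longrightarrow> D1 t x \<le> diff_op s1 (Q1 t x)"
    and k2: "evolution k2 G2 Q2 D2" "\<And>t x. t \<ge> 0 \<Longrightarrow> D2 t x \<le> diff_op s2 (Q2 t x)"
    and K: "K > 0"
    and g1: "\<And>t x. t \<ge> 0 \<Longrightarrow> k1 t x \<le> B1 - K * norm x ^ 4"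
    and g2: "\<And>t x. t \<ge> 0 \<Longrightarrow> k2 t x \<le> B2 - K * norm x ^ 4"
    and nn: "\<mu> \<ge> 0" "\<nu> \<ge> 0"
    and init: "\<And>x y. k1 0 x + k2 0 y \<le> c + \<mu> * (norm (x - y))\<^sup>2 + \<nu> * (norm y)\<^sup>2"
    and t: "t \<ge> 0"
  shows "k1 t x + k2 t y \<le> c + \<mu> * (norm (x - y))\<^sup>2 + \<nu> * (norm y)\<^sup>2
           + (\<mu> * energy (\<lambda>j. s1 j - s2 j) + \<nu> * energy s2) * t"
proof (rule field_le_epsilon)
  fix e :: real assume e: "e > 0"
  define l where "l = \<mu> * energy (\<lambda>j. s1 j - s2 j) + \<nu> * energy s2"
  have l: "l \<ge> 0" using nn by (auto simp: l_def intro!: add_nonneg_nonneg mult_nonneg_nonneg energy_nonneg)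
  \<comment> \<open>The extra rate \<open>d\<close> makes the differential inequality strict; its
    total cost up to time \<open>t\<close> is at most \<open>e\<close>.\<close>
  define d where "d = e / (t + 1)"
  have d: "d > 0" "d * t \<le> e" using e t by (auto simp: d_def field_simps)
  define \<Psi> where "\<Psi> = (\<lambda>t (z :: (real^'d) \<times> (real^'d)). k1 t (fst z) + k2 t (snd z) - c
      - \<mu> * ((fst z - snd z) \<bullet> (fst z - snd z)) - \<nu> * (snd z \<bullet> snd z) - (l + d) * t)"
  \<comment> \<open>If the pair has norm at least \<open>R\<close>, one component has norm at least
    \<open>A + 1\<close>. Its fourth power then exceeds \<open>A\<close>, so the quartic decay beats
    all constants.\<close>
  define A where "A = (\<bar>B1\<bar> + \<bar>B2\<bar> + \<bar>c\<bar>) / K"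
  define R where "R = 2 * (A + 1)"
  have "\<Psi> t (x, y) \<le> 0"
  proof (rule max_principle[where \<Psi> = \<Psi> and t = t and x = "(x, y)" and T = t and R = R and s = "\<lambda>j. (s1 j, s2 j)"
        and D = "\<lambda>t z. D1 t (fst z) + D2 t (snd z) - (l + d)"
        and ?D1.0 = "\<lambda>t z j r. G1 t (fst z + r *\<^sub>R s1 j) \<bullet> s1 j + G2 t (snd z + r *\<^sub>R s2 j) \<bullet> s2 j
           - \<mu> * (2 * (((fst z - snd z) + r *\<^sub>R (s1 j - s2 j)) \<bullet> (s1 j - s2 j)))
           - \<nu> * (2 * ((snd z + r *\<^sub>R s2 j) \<bullet> s2 j))"
        and ?D2.0 = "\<lambda>t z j. (Q1 t (fst z) *v s1 j) \<bullet> s1 j + (Q2 t (snd z) *v s2 j) \<bullet> s2 j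
           - \<mu> * (2 * ((s1 j - s2 j) \<bullet> (s1 j - s2 j))) - \<nu> * (2 * (s2 j \<bullet> s2 j))"])
    have c1: "continuous_on UNIV (\<lambda>p. k1 (fst p) (snd p))" and c2: "continuous_on UNIV (\<lambda>p. k2 (fst p) (snd p))"
      using k1(1) k2(1) by (auto simp: evolution_def case_prod_unfold)
    have "continuous_on UNIV (\<lambda>p::real \<times> (real^'d) \<times> (real^'d). k1 (fst p) (fst (snd p)))"
      using continuous_on_compose2[OF c1, of UNIV "\<lambda>p::real \<times> (real^'d) \<times> (real^'d). (fst p, fst (snd p))"]
      by (simp add: continuous_on_Pair continuous_on_fst continuous_on_snd continuous_on_id)
    moreover have "continuous_on UNIV (\<lambda>p::real \<times> (real^'d) \<times> (real^'d). k2 (fst p) (snd (snd p)))"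
      using continuous_on_compose2[OF c2, of UNIV "\<lambda>p::real \<times> (real^'d) \<times> (real^'d). (fst p, snd (snd p))"]
      by (simp add: continuous_on_Pair continuous_on_fst continuous_on_snd continuous_on_id)
    ultimately show "continuous_on UNIV (\<lambda>(t, z). \<Psi> t z)"
      unfolding \<Psi>_def case_prod_unfold by (intro continuous_intros)
  next
    fix t' z assume t': "0 \<le> t'" "t' \<le> t" and z: "R \<le> norm (z :: (real^'d) \<times> (real^'d))"
    have "norm z \<le> norm (fst z) + norm (snd z)"
      using norm_Pair_le[of "fst z" "snd z"] by simp
    then have "R / 2 \<le> norm (fst z) \<or> R / 2 \<le> norm (snd z)" using z by linarith
    moreover have "\<bar>B1\<bar> + \<bar>B2\<bar> + \<bar>c\<bar> \<le> K * norm w ^ 4" if "R / 2 \<le> norm w" for w :: "real^'d"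
    proof -
      have "0 \<le> A" using K by (simp add: A_def)
      moreover have Aw: "A + 1 \<le> norm w" using that by (simp add: R_def)
      ultimately have "1 \<le> norm w" by simp
      then have "norm w ^ 1 \<le> norm w ^ 4" by (intro power_increasing) auto
      with Aw have "A \<le> norm w ^ 4" by simp
      then show ?thesis using K by (simp add: A_def field_simps)
    qed
    ultimately have "\<bar>B1\<bar> + \<bar>B2\<bar> + \<bar>c\<bar> \<le> K * norm (fst z) ^ 4 + K * norm (snd z) ^ 4"
      using K by (smt (verit) mult_nonneg_nonneg norm_ge_zero zero_le_power)
    moreover have "0 \<le> \<mu> * ((fst z - snd z) \<bullet> (fst z - snd z))" "0 \<le> \<nu> * (snd z \<bullet> snd z)"
      "0 \<le> (l + d) * t'" using nn l d t' by auto
    ultimately show "\<Psi> t' z \<le> 0"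
      using g1[OF t'(1), of "fst z"] g2[OF t'(1), of "snd z"] unfolding \<Psi>_def by linarith
  next
    show "\<Psi> 0 z \<le> 0" for z
      using init[of "fst z" "snd z"] by (simp add: \<Psi>_def power2_norm_eq_inner)
  next
    show "((\<lambda>t. \<Psi> t z) has_real_derivative D1 t (fst z) + D2 t (snd z) - (l + d)) (at t)" for t z
      using k1(1) k2(1) unfolding \<Psi>_def evolution_def
      by (auto intro!: derivative_eq_intros)
  next
    fix t z j r
    have C: "C2_with UNIV (k1 t) (G1 t) (Q1 t)" "C2_with UNIV (k2 t) (G2 t) (Q2 t)"
      using k1(1) k2(1) by (auto simp: evolution_def)
    have e: "\<Psi> t (z + r *\<^sub>R (s1 j, s2 j)) = k1 t (fst z + r *\<^sub>R s1 j) + k2 t (snd z + r *\<^sub>R s2 j) - c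
        - \<mu> * (((fst z - snd z) + r *\<^sub>R (s1 j - s2 j)) \<bullet> ((fst z - snd z) + r *\<^sub>R (s1 j - s2 j)))
        - \<nu> * ((snd z + r *\<^sub>R s2 j) \<bullet> (snd z + r *\<^sub>R s2 j)) - (l + d) * t" for r
    proof -
      have "fst z + r *\<^sub>R s1 j - (snd z + r *\<^sub>R s2 j) = (fst z - snd z) + r *\<^sub>R (s1 j - s2 j)"
        by (simp add: algebra_simps)
      then show ?thesis unfolding \<Psi>_def fst_add snd_add fst_scaleR snd_scaleR fst_conv snd_conv by presburger
    qed
    show "((\<lambda>r. \<Psi> t (z + r *\<^sub>R (s1 j, s2 j))) has_real_derivative
        G1 t (fst z + r *\<^sub>R s1 j) \<bullet> s1 j + G2 t (snd z + r *\<^sub>R s2 j) \<bullet> s2 j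
           - \<mu> * (2 * (((fst z - snd z) + r *\<^sub>R (s1 j - s2 j)) \<bullet> (s1 j - s2 j)))
           - \<nu> * (2 * ((snd z + r *\<^sub>R s2 j) \<bullet> s2 j))) (at r)"
      unfolding e
      by (rule DERIV_cong, (rule DERIV_diff DERIV_add DERIV_const DERIV_cmult C2_with_line(1)[OF C(1)]
          C2_with_line(1)[OF C(2)] square_line(1))+, simp)
    show "((\<lambda>r. G1 t (fst z + r *\<^sub>R s1 j) \<bullet> s1 j + G2 t (snd z + r *\<^sub>R s2 j) \<bullet> s2 j
           - \<mu> * (2 * (((fst z - snd z) + r *\<^sub>R (s1 j - s2 j)) \<bullet> (s1 j - s2 j)))
           - \<nu> * (2 * ((snd z + r *\<^sub>R s2 j) \<bullet> s2 j))) has_real_derivative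
        (Q1 t (fst z) *v s1 j) \<bullet> s1 j + (Q2 t (snd z) *v s2 j) \<bullet> s2 j
           - \<mu> * (2 * ((s1 j - s2 j) \<bullet> (s1 j - s2 j))) - \<nu> * (2 * (s2 j \<bullet> s2 j))) (at 0)"
      by (intro DERIV_diff DERIV_add DERIV_cmult C2_with_line(2)[OF C(1)]
          C2_with_line(2)[OF C(2)] square_line(2))
  next
    fix t' z assume t': "0 < t'" "t' \<le> t"
    have "(\<Sum>j\<in>UNIV. (Q1 t' (fst z) *v s1 j) \<bullet> s1 j + (Q2 t' (snd z) *v s2 j) \<bullet> s2 j
           - \<mu> * (2 * ((s1 j - s2 j) \<bullet> (s1 j - s2 j))) - \<nu> * (2 * (s2 j \<bullet> s2 j))) / 2
      = diff_op s1 (Q1 t' (fst z)) + diff_op s2 (Q2 t' (snd z)) - l"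
      by (simp add: diff_op_def l_def energy_def power2_norm_eq_inner sum.distrib sum_subtractf
          sum_distrib_left field_simps)
    then show "D1 t' (fst z) + D2 t' (snd z) - (l + d) <
      (\<Sum>j\<in>UNIV. (Q1 t' (fst z) *v s1 j) \<bullet> s1 j + (Q2 t' (snd z) *v s2 j) \<bullet> s2 j
           - \<mu> * (2 * ((s1 j - s2 j) \<bullet> (s1 j - s2 j))) - \<nu> * (2 * (s2 j \<bullet> s2 j))) / 2"
      using k1(2)[of t' "fst z"] k2(2)[of t' "snd z"] t' d by simp
  qed (use t in auto)
  then show "k1 t x + k2 t y \<le> c + \<mu> * (norm (x - y))\<^sup>2 + \<nu> * (norm y)\<^sup>2
           + (\<mu> * energy (\<lambda>j. s1 j - s2 j) + \<nu> * energy s2) * t + e"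
    using d(2) unfolding l_def[symmetric] by (simp add: \<Psi>_def power2_norm_eq_inner algebra_simps)
qed

section \<open>Viscosity subsolutions with constant coefficients\<close>

lemma evolution_zero: "evolution (\<lambda>t x. 0) (\<lambda>t x. 0) (\<lambda>t x. 0) (\<lambda>t x. 0)"
  by (simp add: evolution_def C2_with_const)

text \<open>Subtracting \<open>K\<close> times the barrier from each bounded flow supplies the
  quartic decay needed for the pair estimate. In return the initial inequality may fail by a
  quartic, so in effect it matters only near the origin.\<close>

lemma heat_flow_pair_le:
  fixes s1 s2 :: "'j::finite \<Rightarrow> real^'d"
  assumes h1: "evolution h1 G1 Q1 D1" "\<And>t x. D1 t x = diff_op s1 (Q1 t x)"
      "\<And>t x. t \<ge> 0 \<Longrightarrow> \<bar>h1 t x\<bar> \<le> B1"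
    and h2: "evolution h2 G2 Q2 D2" "\<And>t x. D2 t x = diff_op s2 (Q2 t x)"
      "\<And>t x. t \<ge> 0 \<Longrightarrow> \<bar>h2 t x\<bar> \<le> B2"
    and K: "K > 0" and nn: "\<mu> \<ge> 0" "\<nu> \<ge> 0"
    and init: "\<And>x y. h1 0 x + h2 0 y \<le> c + \<mu> * (norm (x - y))\<^sup>2 + \<nu> * (norm y)\<^sup>2
                 + K * (norm x ^ 4 + norm y ^ 4)"
    and t: "t \<ge> 0"
  shows "h1 t x + h2 t y \<le> c + \<mu> * (norm (x - y))\<^sup>2 + \<nu> * (norm y)\<^sup>2
           + (\<mu> * energy (\<lambda>j. s1 j - s2 j) + \<nu> * energy s2) * t
           + K * (barrier s1 t x + barrier s2 t y)"
proof -
  have *: "\<exists>G' Q' D'. evolution (\<lambda>t x. h t x + (- K) * barrier s t x) G' Q' D' \<and>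
      (\<forall>t x. t \<ge> 0 \<longrightarrow> D' t x \<le> diff_op s (Q' t x)) \<and>
      (\<forall>t x. t \<ge> 0 \<longrightarrow> h t x + (- K) * barrier s t x \<le> B - K * norm x ^ 4)"
    if h: "evolution h G Q D" "\<And>t x. D t x = diff_op s (Q t x)" "\<And>t x. t \<ge> 0 \<Longrightarrow> \<bar>h t x\<bar> \<le> B"
    for h G Q D B and s :: "'j \<Rightarrow> real^'d"
  proof -
    obtain Gb Qb Db where b: "evolution (barrier s) Gb Qb Db" "\<And>t x. t \<ge> 0 \<Longrightarrow> diff_op s (Qb t x) \<le> Db t x"
      using barrier_evolution[of s] by blast
    have "h t x + (- K) * barrier s t x \<le> B - K * norm x ^ 4" if "t \<ge> 0" for t x
    proof -
      have "K * norm x ^ 4 \<le> K * barrier s t x" using barrier_ge[OF that, of x s] K by simp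
      then show ?thesis using h(3)[OF that, of x] by linarith
    qed
    moreover have "D t x + (- K) * Db t x \<le> diff_op s (Q t x + (- K) *\<^sub>R Qb t x)" if "t \<ge> 0" for t x
      using mult_left_mono[OF b(2)[OF that, of x], of K] K h(2)[of t x]
      by (simp add: diff_op_add diff_op_scaleR[of s "- K"] del: scaleR_minus_left)
    ultimately show ?thesis
      using evolution_add[OF h(1) evolution_cmult[OF b(1), of "- K"]] by blast
  qed
  obtain G1' Q1' D1' where 1: "evolution (\<lambda>t x. h1 t x + (- K) * barrier s1 t x) G1' Q1' D1'"
      "\<And>t x. t \<ge> 0 \<Longrightarrow> D1' t x \<le> diff_op s1 (Q1' t x)"
      "\<And>t x. t \<ge> 0 \<Longrightarrow> h1 t x + (- K) * barrier s1 t x \<le> B1 - K * norm x ^ 4"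
    using *[OF h1] by blast
  obtain G2' Q2' D2' where 2: "evolution (\<lambda>t x. h2 t x + (- K) * barrier s2 t x) G2' Q2' D2'"
      "\<And>t x. t \<ge> 0 \<Longrightarrow> D2' t x \<le> diff_op s2 (Q2' t x)"
      "\<And>t x. t \<ge> 0 \<Longrightarrow> h2 t x + (- K) * barrier s2 t x \<le> B2 - K * norm x ^ 4"
    using *[OF h2] by blast
  have "h1 0 x + (- K) * barrier s1 0 x + (h2 0 y + (- K) * barrier s2 0 y)
      \<le> c + \<mu> * (norm (x - y))\<^sup>2 + \<nu> * (norm y)\<^sup>2" for x y
    using init[of x y] by (simp add: barrier_init algebra_simps)
  from evolution_pair_le[OF 1(1,2) 2(1,2) K 1(3) 2(3) nn this t]
  show ?thesis by (simp add: algebra_simps)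
qed

text \<open>The pair estimate with the zero flow as partner and no quadratic part; the weight
  \<open>K\<close> of the barriers is then made arbitrarily small.\<close>

lemma heat_flow_le:
  fixes s :: "'j::finite \<Rightarrow> real^'d"
  assumes h: "evolution h G Q D" "\<And>t x. D t x = diff_op s (Q t x)"
      "\<And>t x. t \<ge> 0 \<Longrightarrow> \<bar>h t x\<bar> \<le> B"
    and init: "\<And>x. h 0 x \<le> c" and t: "t \<ge> 0"
  shows "h t x \<le> c"
proof (rule field_le_epsilon)
  fix e :: real assume e: "e > 0"
  define b where "b = barrier s t x + barrier s t 0"
  have "0 \<le> barrier s t y" for y
    using barrier_ge[OF t, of y s] by (meson norm_ge_zero order_trans zero_le_power)
  then have b: "b \<ge> 0" by (simp add: b_def)
  define K where "K = e / (b + 1)"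
  have K: "K > 0" "K * b \<le> e" using e b by (auto simp: K_def field_simps)
  have z: "0 = diff_op s 0" by (simp add: diff_op_def)
  have "h t x + 0 \<le> c + 0 * (norm (x - 0))\<^sup>2 + 0 * (norm (0::real^'d))\<^sup>2
      + (0 * energy (\<lambda>j. s j - s j) + 0 * energy s) * t + K * (barrier s t x + barrier s t 0)"
    by (rule heat_flow_pair_le[OF h evolution_zero z _ K(1), where ?B2.0 = 0])
      (use init t K(1) in \<open>auto intro: order_trans[OF init]\<close>)
  then show "h t x \<le> c + e" using K(2) by (simp add: b_def)
qed

text \<open>The viscosity form of \<open>a \<le> diff_op s (D^2 U)\<close>. Terms of order zero and
  one have been frozen into the constant \<open>a\<close>.\<close>

definition ball_subsol :: "real \<Rightarrow> ('j::finite \<Rightarrow> real^'d) \<Rightarrow> real \<Rightarrow> (real^'d \<Rightarrow> real) \<Rightarrow> bool" where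
  "ball_subsol R s a U \<longleftrightarrow>
     (\<forall>w\<in>ball 0 R. \<forall>\<phi> G Q. C2_with UNIV \<phi> G Q \<and> (\<forall>x\<in>ball 0 R. U x - \<phi> x \<le> U w - \<phi> w)
        \<longrightarrow> a \<le> diff_op s (Q w))"

text \<open>At a positive maximum of \<open>U x + b * t - f t x\<close>, the time slice
  \<open>f t0\<close> touches \<open>U\<close> from above at \<open>w\<close>, whence
  \<open>a \<le> diff_op s (Q t0 w) \<le> D t0 w \<le> b\<close>, a contradiction. Only a slice
  serves as test function, so no parabolic notion of viscosity solution is involved.\<close>

lemma ball_subsol_le_evolution:
  fixes U :: "real^'d \<Rightarrow> real"
  assumes U: "continuous_on UNIV U" and sub: "ball_subsol R s a U"
    and e: "evolution f G Q D" "\<And>t x. t \<ge> 0 \<Longrightarrow> diff_op s (Q t x) \<le> D t x"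
    and b: "b < a"
    and init: "\<And>x. norm x \<le> R \<Longrightarrow> U x \<le> f 0 x"
    and bdry: "\<And>t x. 0 \<le> t \<Longrightarrow> t \<le> T \<Longrightarrow> norm x = R \<Longrightarrow> U x + b * t \<le> f t x"
    and t: "0 \<le> t" "t \<le> T" and x: "norm x \<le> R"
  shows "U x + b * t \<le> f t x"
proof (rule ccontr)
  assume "\<not> U x + b * t \<le> f t x"
  then have pos: "U x + b * t - f t x > 0" by simp
  define \<Psi> where "\<Psi> = (\<lambda>(t, x). U x + b * t - f t x)"
  have "continuous_on UNIV (\<lambda>p::real \<times> (real^'d). U (snd p))"
    by (rule continuous_on_compose2[OF U]) (auto intro!: continuous_intros)
  moreover have "continuous_on UNIV (\<lambda>p. f (fst p) (snd p))"
    using e(1) by (simp add: evolution_def case_prod_unfold)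
  ultimately have cont: "continuous_on UNIV \<Psi>"
    unfolding \<Psi>_def case_prod_unfold by (intro continuous_intros)
  have "compact ({0..T} \<times> cball (0::real^'d) R)" by (intro compact_Times) auto
  moreover have "(t, x) \<in> {0..T} \<times> cball 0 R" using t x by auto
  ultimately obtain z where z: "z \<in> {0..T} \<times> cball 0 R"
      "\<And>y. y \<in> {0..T} \<times> cball 0 R \<Longrightarrow> \<Psi> y \<le> \<Psi> z"
    using continuous_attains_sup[of "{0..T} \<times> cball 0 R" \<Psi>] continuous_on_subset[OF cont] by blast
  obtain t0 w where tw: "z = (t0, w)" by (cases z)
  have t0: "0 \<le> t0" "t0 \<le> T" and w: "norm w \<le> R" using z(1) tw by auto
  have zmax: "U x' + b * t' - f t' x' \<le> U w + b * t0 - f t0 w"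
    if "0 \<le> t'" "t' \<le> T" "norm x' \<le> R" for t' x'
    using z(2)[of "(t', x')"] tw that by (auto simp: \<Psi>_def)
  have p0: "U w + b * t0 - f t0 w > 0" using zmax[of t x] t x pos by auto
  have t0p: "0 < t0" using p0 init[OF w] t0 by (cases "t0 = 0") auto
  have wR: "norm w < R" using p0 bdry[OF t0, of w] w by (cases "norm w = R") auto
  have "a \<le> diff_op s (Q t0 w)"
  proof -
    have "C2_with UNIV (f t0) (G t0) (Q t0)" using e(1) by (simp add: evolution_def)
    moreover have "\<forall>x\<in>ball 0 R. U x - f t0 x \<le> U w - f t0 w" using zmax[of t0] t0 by auto
    ultimately show ?thesis using sub wR unfolding ball_subsol_def by auto
  qed
  moreover have "D t0 w \<le> b"
  proof (rule ccontr)
    assume "\<not> D t0 w \<le> b"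
    then have n: "b - D t0 w < 0" by simp
    have d: "((\<lambda>t. U w + b * t - f t w) has_real_derivative b - D t0 w) (at t0)"
      using e(1) by (auto simp: evolution_def intro!: derivative_eq_intros)
    obtain d where d: "d > 0" "\<And>h. h > 0 \<Longrightarrow> h < d \<Longrightarrow> U w + b * t0 - f t0 w < U w + b * (t0 - h) - f (t0 - h) w"
      using DERIV_neg_dec_left[OF d n] by auto
    define h where "h = min d t0 / 2"
    have "0 < h" "h < d" "h < t0" using d(1) t0p by (auto simp: h_def min_def)
    with d(2)[of h] zmax[of "t0 - h" w] t0 w show False by auto
  qed
  moreover have "diff_op s (Q t0 w) \<le> D t0 w" using e(2) t0 by auto
  ultimately show False using b by linarith
qed

text \<open>The majorant is the flow of an approximation of the folded \<open>U\<close>, plus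
  \<open>e\<close> and \<open>K\<close> times the barrier. On the sphere \<open>K * R ^ 4\<close>
  covers the bound \<open>M\<close> for \<open>U\<close>, the lower bound for the flow and the
  growth \<open>b * t\<close>; at the origin the barrier costs only O(t^2).\<close>

lemma ball_subsol_majorant:
  fixes s :: "'j::finite \<Rightarrow> real^'d"
  assumes U: "continuous_on UNIV U" and sub: "ball_subsol R s a U" and R: "0 < R" "R \<le> 1"
    and b: "b < a" and M: "\<And>x. \<bar>U (fold_box x)\<bar> \<le> M"
    and K: "K * R ^ 4 \<ge> 2 * M + 2" "K > 0" and T: "\<bar>b\<bar> * T \<le> 1" and e: "0 < e" "e \<le> 1"
  obtains h G Q D B where "evolution h G Q D" "\<And>t x. D t x = diff_op s (Q t x)"
    "\<And>t x. t \<ge> 0 \<Longrightarrow> \<bar>h t x\<bar> \<le> B" "\<And>x. \<bar>h 0 x - U (fold_box x)\<bar> < e"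
    "\<And>t. 0 \<le> t \<Longrightarrow> t \<le> T \<Longrightarrow> U 0 + b * t \<le> h t 0 + e + K * barrier s t 0"
proof -
  obtain g where g: "trig_poly g" "\<And>x. \<bar>g x - U (fold_box x)\<bar> < e"
    using trig_poly_dense[OF U e(1)] by blast
  obtain h G Q D B where h: "evolution h G Q D" "h 0 = g" "\<And>t x. D t x = diff_op s (Q t x)"
    "\<And>t x. t \<ge> 0 \<Longrightarrow> \<bar>h t x\<bar> \<le> B"
    using trig_poly_heat_flow[OF g(1), of s] by metis
  \<comment> \<open>The bound \<open>B\<close> of the explicit flow has no relation to
    \<open>M\<close>. The maximum principle for the negated flow gives a lower bound in terms of
    \<open>M\<close>.\<close>
  have low: "- h t x \<le> M + e" if "t \<ge> 0" for t x
  proof -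
    have "(- 1) * h t x \<le> M + e"
    proof (rule heat_flow_le[OF evolution_cmult[OF h(1), of "-1"] _ _ _ that])
      show "- 1 * D t x = diff_op s (- 1 *\<^sub>R Q t x)" for t x
        using h(3)[of t x] by (simp only: diff_op_scaleR)
      show "\<bar>- 1 * h t x\<bar> \<le> B" if "0 \<le> t" for t x using h(4)[OF that] by simp
      show "- 1 * h 0 x \<le> M + e" for x
        using g(2)[of x] M[of x] by (simp add: h(2))
    qed
    then show ?thesis by simp
  qed
  obtain Gb Qb Db where bb: "evolution (barrier s) Gb Qb Db" "\<And>t x. t \<ge> 0 \<Longrightarrow> diff_op s (Qb t x) \<le> Db t x"
    using barrier_evolution[of s] by blast
  have ev: "evolution (\<lambda>t x. h t x + (K * barrier s t x + e * 1)) (\<lambda>t x. G t x + (K *\<^sub>R Gb t x + 0))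
       (\<lambda>t x. Q t x + (K *\<^sub>R Qb t x + 0)) (\<lambda>t x. D t x + (K * Db t x + 0))"
    by (intro evolution_add evolution_cmult h(1) bb(1)) (simp add: evolution_def C2_with_const)
  have "U 0 + b * t \<le> h t 0 + (K * barrier s t 0 + e * 1)" if t: "0 \<le> t" "t \<le> T" for t
  proof (rule ball_subsol_le_evolution[OF U sub ev _ b _ _ t])
    show "diff_op s (Q t x + (K *\<^sub>R Qb t x + 0)) \<le> D t x + (K * Db t x + 0)" if "0 \<le> t" for t x
      using bb(2)[OF that, of x] K(2) h(3)[of t x] by (simp add: diff_op_add diff_op_scaleR)
    show "U x \<le> h 0 x + (K * barrier s 0 x + e * 1)" if "norm x \<le> R" for x
    proof -
      have "U x = U (fold_box x)" using that R fold_box_small[of x] by simp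
      moreover have "0 \<le> K * barrier s 0 x" using K(2) by (simp add: barrier_init)
      ultimately show ?thesis using g(2)[of x] by (simp add: h(2))
    qed
    show "U x + b * t \<le> h t x + (K * barrier s t x + e * 1)" if t: "0 \<le> t" "t \<le> T" and x: "norm x = R" for t x
    proof -
      have "U x = U (fold_box x)" using x R fold_box_small[of x] by simp
      then have "U x \<le> M" using M[of x] by simp
      moreover have "b * t \<le> 1"
      proof -
        have "b * t \<le> \<bar>b\<bar> * T" using t by (intro order_trans[OF mult_right_mono[OF abs_ge_self] mult_left_mono]) auto
        then show ?thesis using T by simp
      qed
      moreover have "K * R ^ 4 \<le> K * barrier s t x"
        using barrier_ge[OF t(1), of x s] x K(2) by simp
      ultimately show ?thesis using K(1) low[OF t(1), of x] e by simp
    qed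
    show "norm (0::real^'d) \<le> R" using R by simp
  qed
  then show ?thesis using that[OF h(1,3,4)] g(2) h(2) by (simp add: algebra_simps)
qed

text \<open>This replaces the Crandall--Ishii lemma for operators with constant coefficients.\<close>

lemma ball_subsol_sum:
  fixes U1 U2 :: "real^'d \<Rightarrow> real" and s1 s2 :: "'j::finite \<Rightarrow> real^'d"
  assumes U1: "continuous_on UNIV U1" "ball_subsol R s1 a1 U1"
    and U2: "continuous_on UNIV U2" "ball_subsol R s2 a2 U2"
    and R: "0 < R" "R \<le> 1" and nn: "\<mu> \<ge> 0" "\<nu> \<ge> 0"
    and max: "\<And>x y. U1 x + U2 y \<le> U1 0 + U2 0 + \<mu> * (norm (x - y))\<^sup>2 + \<nu> * (norm y)\<^sup>2"
  shows "a1 + a2 \<le> \<mu> * energy (\<lambda>j. s1 j - s2 j) + \<nu> * energy s2"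
proof -
  define c where "c = U1 0 + U2 0"
  define l where "l = \<mu> * energy (\<lambda>j. s1 j - s2 j) + \<nu> * energy s2"
  have bounded: "\<exists>M. \<forall>x. \<bar>U (fold_box x)\<bar> \<le> M" if "continuous_on UNIV U" for U :: "real^'d \<Rightarrow> real"
  proof -
    have "compact (U ` half_pi_box)"
      using that compact_half_pi_box by (intro compact_continuous_image) (auto intro: continuous_on_subset)
    then obtain M where "\<And>y. y \<in> U ` half_pi_box \<Longrightarrow> norm y \<le> M"
      using compact_imp_bounded bounded_iff by metis
    then show ?thesis using fold_box_in by (metis imageI real_norm_def)
  qed
  obtain M1 M2 where M1: "\<And>x. \<bar>U1 (fold_box x)\<bar> \<le> M1" and M2: "\<And>x. \<bar>U2 (fold_box x)\<bar> \<le> M2"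
    using bounded[OF U1(1)] bounded[OF U2(1)] by blast
  have Mnn: "M1 \<ge> 0" "M2 \<ge> 0" using M1[of 0] M2[of 0] by linarith+
  \<comment> \<open>Beyond radius \<open>R\<close>, where folding may change the functions, the
    quartic outweighs the bounds on both folded functions and \<open>c\<close>. The same
    \<open>K\<close> suits both majorants.\<close>
  define K where "K = (2 * M1 + 2 * M2 + 2 + \<bar>c\<bar>) / R ^ 4"
  have K: "K > 0" "K * R ^ 4 = 2 * M1 + 2 * M2 + 2 + \<bar>c\<bar>"
    using R Mnn by (auto simp: K_def)
  define L where "L = K * (3 * (energy s1)\<^sup>2) + K * (3 * (energy s2)\<^sup>2)"
  have L: "L \<ge> 0" using K by (simp add: L_def)
  define T where "T = 1 / (\<bar>a1\<bar> + \<bar>a2\<bar> + 1)"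
  have T: "T > 0" by (simp add: T_def add_nonneg_pos)
  have Ta: "\<bar>a - d\<bar> * T \<le> 1" if "\<bar>a\<bar> \<le> \<bar>a1\<bar> + \<bar>a2\<bar>" "0 < d" "d \<le> 1" for a d
  proof -
    have "\<bar>a - d\<bar> \<le> \<bar>a1\<bar> + \<bar>a2\<bar> + 1" using that by linarith
    then show ?thesis by (simp add: T_def add_nonneg_pos)
  qed
  \<comment> \<open>The majorants contribute \<open>2 * e\<close> at time \<open>t\<close>, the
    initial data another \<open>2 * e\<close>. Each barrier is paid for in its majorant and again in
    the pair estimate, both times only at order t^2.\<close>
  have main: "(a1 + a2) * t \<le> 2 * d * t + l * t + 2 * (L * t\<^sup>2) + 4 * e"
    if d: "0 < d" "d \<le> 1" and t: "0 < t" "t \<le> T" and e: "0 < e" "e \<le> 1" for d t e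
  proof -
    have b1: "a1 - d < a1" and b2: "a2 - d < a2" using d by auto
    have K1: "2 * M1 + 2 \<le> K * R ^ 4" and K2: "2 * M2 + 2 \<le> K * R ^ 4" using K(2) Mnn by auto
    have Ta1: "\<bar>a1 - d\<bar> * T \<le> 1" and Ta2: "\<bar>a2 - d\<bar> * T \<le> 1" using Ta d by auto
    obtain h1 G1 Q1 D1 B1 where h1: "evolution h1 G1 Q1 D1" "\<And>t x. D1 t x = diff_op s1 (Q1 t x)"
      "\<And>t x. t \<ge> 0 \<Longrightarrow> \<bar>h1 t x\<bar> \<le> B1" and g1: "\<And>x. \<bar>h1 0 x - U1 (fold_box x)\<bar> < e"
      and u1: "\<And>t. 0 \<le> t \<Longrightarrow> t \<le> T \<Longrightarrow> U1 0 + (a1 - d) * t \<le> h1 t 0 + e + K * barrier s1 t 0"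
      using ball_subsol_majorant[OF U1 R b1 M1 K1 K(1) Ta1 e] by blast
    obtain h2 G2 Q2 D2 B2 where h2: "evolution h2 G2 Q2 D2" "\<And>t x. D2 t x = diff_op s2 (Q2 t x)"
      "\<And>t x. t \<ge> 0 \<Longrightarrow> \<bar>h2 t x\<bar> \<le> B2" and g2: "\<And>x. \<bar>h2 0 x - U2 (fold_box x)\<bar> < e"
      and u2: "\<And>t. 0 \<le> t \<Longrightarrow> t \<le> T \<Longrightarrow> U2 0 + (a2 - d) * t \<le> h2 t 0 + e + K * barrier s2 t 0"
      using ball_subsol_majorant[OF U2 R b2 M2 K2 K(1) Ta2 e] by blast
    have "h1 0 x + h2 0 y \<le> (c + 2 * e) + \<mu> * (norm (x - y))\<^sup>2 + \<nu> * (norm y)\<^sup>2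
        + K * (norm x ^ 4 + norm y ^ 4)" for x y
    proof -
      have q: "0 \<le> \<mu> * (norm (x - y))\<^sup>2" "0 \<le> \<nu> * (norm y)\<^sup>2" using nn by auto
      have p: "0 \<le> K * norm x ^ 4" "0 \<le> K * norm y ^ 4" using K by auto
      show ?thesis
      proof (cases "norm x \<le> R \<and> norm y \<le> R")
        case True
        then have "fold_box x = x" "fold_box y = y" using R fold_box_small[of x] fold_box_small[of y] by auto
        then have "\<bar>h1 0 x - U1 x\<bar> < e" "\<bar>h2 0 y - U2 y\<bar> < e" using g1[of x] g2[of y] by simp_all
        then show ?thesis using max[of x y] p unfolding c_def distrib_left by linarith
      next
        case False
        then have "R ^ 4 \<le> norm x ^ 4 \<or> R ^ 4 \<le> norm y ^ 4"
          using R power_mono[of R _ 4] by (meson less_imp_le not_le)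
        then have "K * R ^ 4 \<le> K * norm x ^ 4 \<or> K * R ^ 4 \<le> K * norm y ^ 4"
          using K(1) by (meson less_imp_le mult_left_mono)
        then show ?thesis
          using g1[of x] g2[of y] M1[of x] M2[of y] q p K e unfolding distrib_left by linarith
      qed
    qed
    from heat_flow_pair_le[OF h1 h2 K(1) nn this less_imp_le[OF t(1)], of 0 0]
    have "h1 t 0 + h2 t 0 \<le> c + 2 * e + l * t + K * (barrier s1 t 0 + barrier s2 t 0)"
      by (simp add: l_def)
    with u1[of t] u2[of t] t
    have "c + (a1 - d) * t + (a2 - d) * t \<le> c + 4 * e + l * t + 2 * (K * (barrier s1 t 0 + barrier s2 t 0))"
      unfolding c_def distrib_left by linarith
    then show ?thesis by (simp add: barrier_zero L_def algebra_simps)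
  qed
  have "a1 + a2 \<le> l"
  proof (rule field_le_epsilon)
    fix r :: real assume r: "r > 0"
    define d where "d = min 1 (r / 8)"
    define t where "t = min T (r / (8 * (L + 1)))"
    have d: "0 < d" "d \<le> 1" "8 * d \<le> r" using r by (auto simp: d_def)
    have t: "0 < t" "t \<le> T" using r L T by (auto simp: t_def)
    have "t \<le> r / (8 * (L + 1))" by (simp add: t_def)
    then have "8 * (t * (L + 1)) \<le> r" using L by (simp add: pos_le_divide_eq algebra_simps)
    then have tL: "8 * (L * t) \<le> r" using t L by (simp add: algebra_simps)
    \<comment> \<open>Chosen after \<open>t\<close>: the approximation error remains small relative
      to \<open>t\<close> when the inequality is divided by \<open>t\<close>.\<close>
    define e where "e = min 1 (r * t / 16)"
    have e: "0 < e" "e \<le> 1" "16 * e \<le> r * t" using r t by (auto simp: e_def)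
    have "(a1 + a2) * t \<le> (2 * d + l + 2 * (L * t)) * t + 4 * e"
      using main[OF d(1,2) t e(1,2)] by (simp add: algebra_simps power2_eq_square)
    also have "\<dots> \<le> (2 * d + l + 2 * (L * t) + r / 4) * t"
      using e(3) by (simp add: algebra_simps)
    also have "\<dots> \<le> (l + r) * t"
      using d tL t by (intro mult_right_mono) auto
    finally show "a1 + a2 \<le> l + r" using t by simp
  qed
  then show ?thesis by (simp add: l_def)
qed

section \<open>Sup-convolutions\<close>

text \<open>The argument \<open>w\<close> is an offset from \<open>x0\<close>, so contact near
  \<open>x0\<close> becomes contact near the origin, where the constant-coefficient results are
  stated.\<close>

definition sup_conv :: "(real^'d) set \<Rightarrow> real \<Rightarrow> real^'d \<Rightarrow> (real^'d \<Rightarrow> real) \<Rightarrow> real^'d \<Rightarrow> real" where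
  "sup_conv W \<kappa> x0 f w = (SUP z\<in>W. f z - \<kappa> * (norm (z - x0 - w))\<^sup>2)"

context
  fixes W :: "(real^'d) set" and \<kappa> :: real and x0 :: "real^'d" and f :: "real^'d \<Rightarrow> real"
  assumes W: "compact W" and x0: "x0 \<in> W" and f: "continuous_on W f" and \<kappa>: "\<kappa> > 0"
begin

lemma sup_conv_attained:
  obtains z where "z \<in> W" "sup_conv W \<kappa> x0 f w = f z - \<kappa> * (norm (z - x0 - w))\<^sup>2"
    "\<And>x. x \<in> W \<Longrightarrow> f x - \<kappa> * (norm (x - x0 - w))\<^sup>2 \<le> sup_conv W \<kappa> x0 f w"
proof -
  have "continuous_on W (\<lambda>z. f z - \<kappa> * (norm (z - x0 - w))\<^sup>2)"
    by (intro continuous_intros f)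
  then obtain z where z: "z \<in> W"
      "\<And>x. x \<in> W \<Longrightarrow> f x - \<kappa> * (norm (x - x0 - w))\<^sup>2 \<le> f z - \<kappa> * (norm (z - x0 - w))\<^sup>2"
    using continuous_attains_sup[OF W] x0 by blast
  have "sup_conv W \<kappa> x0 f w = f z - \<kappa> * (norm (z - x0 - w))\<^sup>2"
    unfolding sup_conv_def using z by (intro cSup_eq_maximum) auto
  then show ?thesis using z that by metis
qed

lemma sup_conv_ge: "x \<in> W \<Longrightarrow> f x - \<kappa> * (norm (x - x0 - w))\<^sup>2 \<le> sup_conv W \<kappa> x0 f w"
  by (metis sup_conv_attained)

text \<open>Adding \<kappa> |w|^2 makes every competitor affine in \<open>w\<close>. The result is a
  supremum of affine functions, hence convex and continuous.\<close>

lemma sup_conv_continuous: "continuous_on UNIV (sup_conv W \<kappa> x0 f)"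
proof -
  let ?g = "\<lambda>w. sup_conv W \<kappa> x0 f w + \<kappa> * (norm w)\<^sup>2"
  have e: "f z - \<kappa> * (norm (z - x0 - w))\<^sup>2 + \<kappa> * (norm w)\<^sup>2
      = f z - \<kappa> * (norm (z - x0))\<^sup>2 + 2 * \<kappa> * ((z - x0) \<bullet> w)" for z w
    unfolding power2_norm_eq_inner by (simp add: inner_diff inner_commute algebra_simps)
  have "convex_on UNIV ?g"
  proof (rule convex_onI)
    fix t :: real and x y :: "real^'d" assume t: "0 < t" "t < 1"
    let ?w = "(1 - t) *\<^sub>R x + t *\<^sub>R y"
    obtain z where z: "z \<in> W" "sup_conv W \<kappa> x0 f ?w = f z - \<kappa> * (norm (z - x0 - ?w))\<^sup>2"
      using sup_conv_attained by metis
    define A where "A = (\<lambda>w. f z - \<kappa> * (norm (z - x0))\<^sup>2 + 2 * \<kappa> * ((z - x0) \<bullet> w))"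
    have A: "A w \<le> ?g w" for w
      using sup_conv_ge[OF z(1), of w] e[of z w] by (simp add: A_def)
    have "?g ?w = A ?w" using z(2) e[of z ?w] by (simp add: A_def)
    also have "A ?w = (1 - t) * A x + t * A y"
      by (simp add: A_def inner_add_right algebra_simps)
    also have "\<dots> \<le> (1 - t) * ?g x + t * ?g y"
      using t A[of x] A[of y] by (intro add_mono mult_left_mono) auto
    finally show "?g ?w \<le> (1 - t) * ?g x + t * ?g y" .
  qed simp
  then have "continuous_on UNIV ?g"
    by (intro convex_on_continuous) auto
  then have "continuous_on UNIV (\<lambda>w. ?g w - \<kappa> * (norm w)\<^sup>2)"
    by (rule continuous_on_diff) (intro continuous_intros)
  then show ?thesis by simp
qed

text \<open>The maximiser \<open>z\<close> for \<open>w\<close> also competes at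
  \<open>y = w + r (z - x0)\<close>, where the penalty is smaller. The quadratic upper bound at
  \<open>y\<close> limits this gain and so controls the offset of \<open>z\<close> linearly in
  \<open>w\<close>.\<close>

lemma sup_conv_maximiser_near:
  assumes quad: "\<And>w. sup_conv W \<kappa> x0 f w \<le> f x0 + b * (norm w)\<^sup>2" and b: "b \<ge> 0"
    and z: "z \<in> W" "sup_conv W \<kappa> x0 f w = f z - \<kappa> * (norm (z - x0 - w))\<^sup>2"
  shows "\<kappa> * norm (z - x0) \<le> 2 * (b + \<kappa>) * norm w"
proof -
  define q where "q = z - x0"
  define A where "A = b + \<kappa>"
  have A: "A > 0" using b \<kappa> by (simp add: A_def)
  \<comment> \<open>With this \<open>r\<close> exactly half of the term in |q|^2 on the left absorbs
    the one created by |y|^2.\<close>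
  define r where "r = \<kappa> / (2 * A)"
  define y where "y = w + r *\<^sub>R q"
  have "f x0 - \<kappa> * (norm w)\<^sup>2 \<le> f z - \<kappa> * (norm (q - w))\<^sup>2"
    using sup_conv_ge[OF x0, of w] z(2) by (simp add: q_def)
  moreover have "f z - \<kappa> * (norm (q - y))\<^sup>2 \<le> f x0 + b * (norm y)\<^sup>2"
    using sup_conv_ge[OF z(1), of y] quad[of y] by (simp add: q_def)
  ultimately have "\<kappa> * (norm (q - w))\<^sup>2 - \<kappa> * (norm (q - y))\<^sup>2 \<le> b * (norm y)\<^sup>2 + \<kappa> * (norm w)\<^sup>2"
    by linarith
  then have "2 * \<kappa> * (q \<bullet> (y - w)) \<le> A * (norm y)\<^sup>2"
    unfolding power2_norm_eq_inner A_def by (simp add: inner_diff inner_commute algebra_simps)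
  also have "A * (norm y)\<^sup>2 \<le> A * (2 * (norm w)\<^sup>2 + 2 * (norm (r *\<^sub>R q))\<^sup>2)"
  proof -
    have "0 \<le> (norm (w - r *\<^sub>R q))\<^sup>2" by simp
    then have "(norm y)\<^sup>2 \<le> 2 * (norm w)\<^sup>2 + 2 * (norm (r *\<^sub>R q))\<^sup>2"
      unfolding y_def power2_norm_eq_inner by (simp add: inner_diff inner_add inner_commute algebra_simps)
    then show ?thesis using A by simp
  qed
  finally have "2 * \<kappa> * (r * (norm q)\<^sup>2) \<le> 2 * A * (norm w)\<^sup>2 + (2 * A * r) * (r * (norm q)\<^sup>2)"
    by (simp add: y_def power_mult_distrib power2_norm_eq_inner[symmetric] algebra_simps power2_eq_square[of r])
  moreover have "2 * A * r = \<kappa>" using A by (simp add: r_def)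
  ultimately have "\<kappa> * (r * (norm q)\<^sup>2) \<le> 2 * A * (norm w)\<^sup>2" by simp
  then have "(\<kappa> * norm q)\<^sup>2 \<le> (2 * A * norm w)\<^sup>2"
    using A by (simp add: r_def field_simps power2_eq_square)
  then show ?thesis
    using A \<kappa> by (subst (asm) abs_le_square_iff[symmetric]) (simp add: q_def A_def abs_mult)
qed

text \<open>With \<open>z\<close> fixed, the paraboloid \<open>f z - \<kappa> |z - x0 - w|^2\<close>
  lies below the sup-convolution and meets it at \<open>w\<close>; \<open>\<phi>\<close> therefore
  has a paraboloid touching it from below, which fixes its gradient and bounds its Hessian from
  below. Translating \<open>\<phi>\<close> by \<open>w - z\<close> carries the same jet back to a
  test function for \<open>f\<close> at \<open>z\<close>.\<close>

lemma sup_conv_contact: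
  assumes w: "norm w < R" and \<phi>: "C2_with UNIV \<phi> G Q"
    and max: "\<And>x. norm x < R \<Longrightarrow> sup_conv W \<kappa> x0 f x - \<phi> x \<le> sup_conv W \<kappa> x0 f w - \<phi> w"
    and z: "z \<in> W" "sup_conv W \<kappa> x0 f w = f z - \<kappa> * (norm (z - x0 - w))\<^sup>2"
  shows "G w = (2 * \<kappa>) *\<^sub>R (z - x0 - w)"
    and "- 2 * \<kappa> * (norm v)\<^sup>2 \<le> (Q w *v v) \<bullet> v"
    and "\<exists>\<psi> G' Q'. C2_with UNIV \<psi> G' Q' \<and> (\<forall>x\<in>W. f x - \<psi> x \<le> f z - \<psi> z) \<and> G' z = G w \<and> Q' z = Q w"
proof -
  define q where "q = z - x0"
  have C: "C2_with UNIV (\<lambda>x. - 1 * (\<phi> x + \<kappa> * ((x + - q) \<bullet> (x + - q))))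
      (\<lambda>x. - 1 *\<^sub>R (G x + \<kappa> *\<^sub>R (2 *\<^sub>R (x + - q)))) (\<lambda>x. - 1 *\<^sub>R (Q x + \<kappa> *\<^sub>R (2 *\<^sub>R mat 1)))"
    by (intro C2_with_cmult C2_with_add \<phi> C2_with_translate[where f = "\<lambda>x. x \<bullet> x"] C2_with_square)
  have loc: "- 1 * (\<phi> x + \<kappa> * ((x + - q) \<bullet> (x + - q))) \<le> - 1 * (\<phi> w + \<kappa> * ((w + - q) \<bullet> (w + - q)))"
    if "norm (x - w) < R - norm w" for x
  proof -
    have "norm x < R" using that norm_triangle_ineq[of "x - w" w] by simp
    moreover have "norm (q - y) ^ 2 = (y + - q) \<bullet> (y + - q)" for y
      by (simp add: power2_norm_eq_inner inner_diff inner_commute)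
    ultimately show ?thesis
      using sup_conv_ge[OF z(1), of x] max[of x] z(2) by (simp add: q_def)
  qed
  have Rw: "R - norm w > 0" using w by simp
  from C2_with_local_max(2)[OF C Rw loc] show "G w = (2 * \<kappa>) *\<^sub>R (z - x0 - w)"
    by (simp add: q_def algebra_simps add_eq_0_iff)
  have "- Q w *v v = - (Q w *v v)" using scaleR_matrix_vector[of "-1" "Q w" v] by simp
  with C2_with_local_max(1)[OF C Rw loc, of v] show "- 2 * \<kappa> * (norm v)\<^sup>2 \<le> (Q w *v v) \<bullet> v"
    by (simp add: matrix_vector_mult_add_rdistrib scaleR_matrix_vector inner_add_left power2_norm_eq_inner
        matrix_vector_mult_diff_rdistrib inner_diff_left scaleR_diff_right del: scaleR_minus_left)
  define r where "r = R - norm w"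
  have r: "r > 0" using w by (simp add: r_def)
  have cont: "continuous_on W (\<lambda>x. f x - \<phi> (x + (w - z)))"
  proof -
    have "continuous_on W (\<lambda>x. \<phi> (x + (w - z)))"
      using C2_with_continuous[OF C2_with_translate[OF \<phi>]] continuous_on_subset by blast
    then show ?thesis by (intro continuous_intros f)
  qed
  obtain B where B: "\<And>x. x \<in> W \<Longrightarrow> f x - \<phi> (x + (w - z)) \<le> B"
    using continuous_attains_sup[OF W _ cont] x0 by blast
  \<comment> \<open>The translated contact holds only within distance \<open>r\<close> of
    \<open>z\<close>. Farther away this multiple of the quartic dominates, and at \<open>z\<close>
    it leaves the jet unchanged.\<close>
  define N where "N = (\<bar>B\<bar> + \<bar>f z - \<phi> w\<bar>) / r ^ 4"
  define \<psi> where "\<psi> = (\<lambda>x. \<phi> (x + (w - z)) + N * ((x + - z) \<bullet> (x + - z))\<^sup>2)"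
  define G' where "G' = (\<lambda>x. G (x + (w - z)) + N *\<^sub>R ((4 * ((x + - z) \<bullet> (x + - z))) *\<^sub>R (x + - z)))"
  define Q' where "Q' = (\<lambda>x. Q (x + (w - z)) + N *\<^sub>R ((4 * ((x + - z) \<bullet> (x + - z))) *\<^sub>R mat 1 + 8 *\<^sub>R outer (x + - z) (x + - z)))"
  have "C2_with UNIV \<psi> G' Q'"
    unfolding \<psi>_def G'_def Q'_def
    by (intro C2_with_cmult C2_with_add C2_with_translate[OF \<phi>]
        C2_with_translate[where f = "\<lambda>x. (x \<bullet> x)\<^sup>2"] C2_with_quartic)
  moreover have "f x - \<psi> x \<le> f z - \<psi> z" if x: "x \<in> W" for x
  proof (cases "norm (x - z) < r")
    case True
    define y where "y = x - z + w"
    have "norm y < R" using True norm_triangle_ineq[of "x - z" w] by (simp add: y_def r_def)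
    moreover have "x - x0 - y = z - x0 - w" by (simp add: y_def algebra_simps)
    then have "norm (x - x0 - y) = norm (z - x0 - w)" by (rule arg_cong)
    ultimately have "f x - \<phi> y \<le> f z - \<phi> w"
      using sup_conv_ge[OF x, of y] max[of y] z(2) by auto
    moreover have "0 \<le> N * ((x + - z) \<bullet> (x + - z))\<^sup>2" by (simp add: N_def)
    ultimately show ?thesis by (simp add: \<psi>_def y_def algebra_simps)
  next
    case False
    have "r ^ 4 \<le> norm (x - z) ^ 4" using False r by (intro power_mono) auto
    also have "norm (x - z) ^ 4 = ((x + - z) \<bullet> (x + - z))\<^sup>2"
      by (simp flip: power2_norm_eq_inner)
    finally have "N * r ^ 4 \<le> N * ((x + - z) \<bullet> (x + - z))\<^sup>2"
      by (intro mult_left_mono) (simp_all add: N_def)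
    moreover have "N * r ^ 4 = \<bar>B\<bar> + \<bar>f z - \<phi> w\<bar>" using r by (simp add: N_def)
    moreover have "\<psi> z = \<phi> w" by (simp add: \<psi>_def)
    ultimately show ?thesis using B[OF x] unfolding \<psi>_def by simp
  qed
  moreover have "G' z = G w" by (simp add: G'_def)
  moreover have "outer 0 0 = (0 :: real^'d^'d)" by (simp add: outer_def vec_eq_iff)
  then have "Q' z = Q w" by (simp add: Q'_def)
  ultimately show "\<exists>\<psi> G' Q'. C2_with UNIV \<psi> G' Q' \<and> (\<forall>x\<in>W. f x - \<psi> x \<le> f z - \<psi> z) \<and> G' z = G w \<and> Q' z = Q w"
    by blast
qed

end

section \<open>Freezing the coefficients\<close>

text \<open>Enlarging the noise slightly absorbs the variation of the coefficients near a point,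
  since the relevant Hessians are bounded below.\<close>

definition inflate :: "real \<Rightarrow> ('k::finite \<Rightarrow> real^'d) \<Rightarrow> 'k + 'd \<Rightarrow> real^'d" where
  "inflate \<delta> s = case_sum (\<lambda>j. sqrt (1 + \<delta>) *\<^sub>R s j) (\<lambda>i. sqrt \<delta> *\<^sub>R axis i 1)"

lemma sum_UNIV_sum: "(\<Sum>j\<in>(UNIV :: ('a::finite + 'b::finite) set). f j) = (\<Sum>i\<in>UNIV. f (Inl i)) + (\<Sum>i\<in>UNIV. f (Inr i))"
  unfolding UNIV_sum by (subst sum.union_disjoint) (auto simp: sum.reindex)

lemma diff_op_inflate:
  assumes "\<delta> \<ge> 0"
  shows "diff_op (inflate \<delta> s) Y = (1 + \<delta>) * diff_op s Y + \<delta> * (\<Sum>i\<in>UNIV. (Y *v axis i 1) \<bullet> axis i 1) / 2"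
proof -
  have sq: "sqrt \<delta> * (sqrt \<delta> * x) = \<delta> * x" "sqrt (1 + \<delta>) * (sqrt (1 + \<delta>) * x) = (1 + \<delta>) * x" for x
    using assms by (simp_all flip: mult.assoc)
  show ?thesis
    by (simp add: sq diff_op_def inflate_def sum_UNIV_sum matrix_vector_mult_scaleR add_divide_distrib
        flip: sum_distrib_left)
qed

lemma energy_inflate:
  fixes s :: "'k::finite \<Rightarrow> real^'d"
  assumes "\<delta> \<ge> 0"
  shows "energy (inflate \<delta> s) = (1 + \<delta>) * energy s + \<delta> * CARD('d)"
  using assms
  by (simp add: energy_def inflate_def sum_UNIV_sum power_mult_distrib sum_distrib_left)

text \<open>The added isotropic noise is the same for both diffusions and cancels in the difference;
  otherwise the penalty would see it with its full weight.\<close>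

lemma energy_inflate_diff:
  assumes "\<delta> \<ge> 0"
  shows "energy (\<lambda>j. inflate \<delta> s1 j - inflate \<delta> s2 j) = (1 + \<delta>) * energy (\<lambda>j. s1 j - s2 j)"
  using assms
  by (simp add: energy_def inflate_def sum_UNIV_sum power_mult_distrib sum_distrib_left
      flip: scaleR_diff_right)

text \<open>Nonnegativity is used on the vectors
  \<open>(e $ j) *\<^sub>R axis i 1 - (e $ i) *\<^sub>R axis j 1\<close> and summed over all
  \<open>i\<close>, \<open>j\<close>. This gives twice the claim directly, with no spectral
  theorem.\<close>

lemma quadratic_form_le_trace:
  fixes Y :: "real^'d^'d"
  assumes Y: "\<And>v. 0 \<le> (Y *v v) \<bullet> v"
  shows "(Y *v e) \<bullet> e \<le> (norm e)\<^sup>2 * (\<Sum>i\<in>UNIV. (Y *v axis i 1) \<bullet> axis i 1)"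
proof -
  define y where "y = (\<lambda>i j. (Y *v axis i 1) \<bullet> axis j (1::real))"
  have e: "e = (\<Sum>i\<in>UNIV. (e $ i) *\<^sub>R axis i 1)"
    using basis_expansion[of e] by (simp add: scalar_mult_eq_scaleR)
  have "Y *v e = (\<Sum>i\<in>UNIV. (e $ i) *\<^sub>R (Y *v axis i 1))"
    using arg_cong[OF e, of "(*v) Y"]
    by (simp add: linear_sum[OF matrix_vector_mul_linear] matrix_vector_mult_scaleR)
  then have "(Y *v e) \<bullet> e = (\<Sum>i\<in>UNIV. (e $ i) *\<^sub>R (Y *v axis i 1)) \<bullet> (\<Sum>j\<in>UNIV. (e $ j) *\<^sub>R axis j 1)"
    using e by simp
  also have "\<dots> = (\<Sum>i\<in>UNIV. \<Sum>j\<in>UNIV. e $ i * e $ j * y i j)"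
    by (simp add: inner_sum_left inner_sum_right y_def mult_ac sum_distrib_left) (subst sum.swap, simp add: mult.left_commute)
  finally have Ye: "(Y *v e) \<bullet> e = (\<Sum>i\<in>UNIV. \<Sum>j\<in>UNIV. e $ i * e $ j * y i j)" .
  have swap: "(\<Sum>i\<in>UNIV. \<Sum>j\<in>UNIV. e $ i * e $ j * y j i) = (Y *v e) \<bullet> e"
    unfolding Ye by (subst sum.swap) (simp add: mult_ac)
  have sq: "(\<Sum>i\<in>UNIV. (e $ i)\<^sup>2) = (norm e)\<^sup>2"
    unfolding power2_norm_eq_inner inner_vec_def by (simp add: power2_eq_square)
  have "0 \<le> (\<Sum>i\<in>UNIV. \<Sum>j\<in>UNIV. (e $ j)\<^sup>2 * y i i + (e $ i)\<^sup>2 * y j j - e $ i * e $ j * y i j - e $ i * e $ j * y j i)"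
  proof (intro sum_nonneg)
    fix i j
    have "0 \<le> (Y *v ((e $ j) *\<^sub>R axis i 1 - (e $ i) *\<^sub>R axis j 1)) \<bullet> ((e $ j) *\<^sub>R axis i 1 - (e $ i) *\<^sub>R axis j 1)"
      by (rule Y)
    then show "0 \<le> (e $ j)\<^sup>2 * y i i + (e $ i)\<^sup>2 * y j j - e $ i * e $ j * y i j - e $ i * e $ j * y j i"
      by (simp add: matrix_vector_mult_diff_distrib matrix_vector_mult_scaleR inner_diff y_def
          power2_eq_square algebra_simps)
  qed
  also have "\<dots> = (\<Sum>i\<in>UNIV. \<Sum>j\<in>UNIV. (e $ j)\<^sup>2 * y i i) + (\<Sum>i\<in>UNIV. \<Sum>j\<in>UNIV. (e $ i)\<^sup>2 * y j j)
      - (Y *v e) \<bullet> e - (Y *v e) \<bullet> e"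
    unfolding sum_subtractf sum.distrib swap Ye[symmetric] by simp
  also have "(\<Sum>i\<in>UNIV. \<Sum>j\<in>UNIV. (e $ j)\<^sup>2 * y i i) = (norm e)\<^sup>2 * (\<Sum>i\<in>UNIV. y i i)"
    by (simp add: sq flip: sum_distrib_right sum_distrib_left)
  also have "(\<Sum>i\<in>UNIV. \<Sum>j\<in>UNIV. (e $ i)\<^sup>2 * y j j) = (norm e)\<^sup>2 * (\<Sum>i\<in>UNIV. y i i)"
    by (simp add: sq flip: sum_distrib_right sum_distrib_left)
  finally show ?thesis by (simp add: y_def)
qed

text \<open>Young's inequality for the form, from its nonnegativity at
  \<open>\<delta> *\<^sub>R a - b\<close>.\<close>

lemma quadratic_form_add_le:
  fixes Y :: "real^'d^'d"
  assumes Y: "\<And>v. 0 \<le> (Y *v v) \<bullet> v" and d: "\<delta> > 0"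
  shows "(Y *v (a + b)) \<bullet> (a + b) \<le> (1 + \<delta>) * ((Y *v a) \<bullet> a) + (1 + 1 / \<delta>) * ((Y *v b) \<bullet> b)"
proof -
  have "0 \<le> (Y *v (\<delta> *\<^sub>R a - b)) \<bullet> (\<delta> *\<^sub>R a - b)" by (rule Y)
  then have "\<delta> * ((Y *v a) \<bullet> b + (Y *v b) \<bullet> a) \<le> \<delta> * (\<delta> * ((Y *v a) \<bullet> a)) + (Y *v b) \<bullet> b"
    by (simp add: matrix_vector_mult_diff_distrib matrix_vector_mult_scaleR inner_diff algebra_simps)
  then have "(Y *v a) \<bullet> b + (Y *v b) \<bullet> a \<le> \<delta> * ((Y *v a) \<bullet> a) + (Y *v b) \<bullet> b / \<delta>"
    using d by (simp add: field_simps)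
  then show ?thesis
    by (simp add: matrix_vector_right_distrib inner_add algebra_simps)
qed

text \<open>Young's inequality splits \<open>s'\<close> into \<open>s\<close> and the perturbation.
  The first part costs a factor 1 + \<delta>; the second, bounded through the trace, costs (1 +
  1/\<delta>) \<delta>^2 / 2 \<le> \<delta> times the trace, which is what the isotropic part of
  \<open>inflate\<close> provides.\<close>

lemma diff_op_le_inflate:
  fixes Y :: "real^'d^'d"
  assumes Y: "\<And>v. 0 \<le> (Y *v v) \<bullet> v" and d: "0 < \<delta>" "\<delta> \<le> 1"
    and E: "energy (\<lambda>j. s' j - s j) \<le> \<delta>\<^sup>2 / 2"
  shows "diff_op s' Y \<le> diff_op (inflate \<delta> s) Y"
proof -
  define T where "T = (\<Sum>i\<in>UNIV. (Y *v axis i 1) \<bullet> axis i (1::real))"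
  have T: "T \<ge> 0" unfolding T_def by (intro sum_nonneg Y)
  have c: "(1 + 1 / \<delta>) * energy (\<lambda>j. s' j - s j) \<le> \<delta>"
  proof -
    have "(1 + 1 / \<delta>) * energy (\<lambda>j. s' j - s j) \<le> (1 + 1 / \<delta>) * (\<delta>\<^sup>2 / 2)"
      using d E by (intro mult_left_mono) auto
    also have "\<dots> = (\<delta> * \<delta> + \<delta>) / 2" using d by (simp add: power2_eq_square field_simps)
    also have "\<dots> \<le> \<delta>" using d mult_left_le[of \<delta> \<delta>] by simp
    finally show ?thesis .
  qed
  have "2 * diff_op s' Y = (\<Sum>j\<in>UNIV. (Y *v (s j + (s' j - s j))) \<bullet> (s j + (s' j - s j)))"
    by (simp add: diff_op_def)
  also have "\<dots> \<le> (\<Sum>j\<in>UNIV. (1 + \<delta>) * ((Y *v s j) \<bullet> s j) + (1 + 1 / \<delta>) * ((norm (s' j - s j))\<^sup>2 * T))"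
  proof (rule sum_mono)
    fix j
    have "(1 + 1 / \<delta>) * ((Y *v (s' j - s j)) \<bullet> (s' j - s j)) \<le> (1 + 1 / \<delta>) * ((norm (s' j - s j))\<^sup>2 * T)"
      using quadratic_form_le_trace[OF Y] d unfolding T_def by (intro mult_left_mono) auto
    then show "(Y *v (s j + (s' j - s j))) \<bullet> (s j + (s' j - s j))
        \<le> (1 + \<delta>) * ((Y *v s j) \<bullet> s j) + (1 + 1 / \<delta>) * ((norm (s' j - s j))\<^sup>2 * T)"
      using quadratic_form_add_le[OF Y d(1), of "s j" "s' j - s j"] by linarith
  qed
  also have "\<dots> = 2 * ((1 + \<delta>) * diff_op s Y) + ((1 + 1 / \<delta>) * energy (\<lambda>j. s' j - s j)) * T"
    by (simp add: energy_def diff_op_def sum.distrib mult.assoc flip: sum_distrib_left sum_distrib_right)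
  also have "\<dots> \<le> 2 * ((1 + \<delta>) * diff_op s Y) + \<delta> * T"
    using mult_right_mono[OF c T] by simp
  also have "\<dots> = 2 * diff_op (inflate \<delta> s) Y"
    using d by (simp add: diff_op_inflate T_def)
  finally show ?thesis by simp
qed

text \<open>A viscosity inequality localised in position and gradient, with the lower-order terms
  frozen at \<open>(x0, p)\<close>. The gradient is localised as well because the sign of
  \<open>H\<close> is controlled only near a given gradient.\<close>

definition jet_cond ::
  "(real^'d) set \<Rightarrow> (real^'d \<Rightarrow> 'k::finite \<Rightarrow> real^'d) \<Rightarrow> (real^'d \<Rightarrow> real) \<Rightarrow> real^'d \<Rightarrow> real^'d \<Rightarrow> real \<Rightarrow> bool" where
  "jet_cond W s f p x0 a \<longleftrightarrow> (\<exists>\<rho>>0. \<forall>z\<in>W. \<forall>\<psi> G Q. C2_with UNIV \<psi> G Q \<and>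
      (\<forall>x\<in>W. f x - \<psi> x \<le> f z - \<psi> z) \<and> norm (z - x0) < \<rho> \<and> norm (G z - p) < \<rho>
      \<longrightarrow> a \<le> diff_op (s z) (Q z))"

text \<open>A contact of the sup-convolution near 0 yields one of \<open>f\<close> near
  \<open>x0\<close> with small gradient, so \<open>jet_cond\<close> applies. The Hessian plus
  2\<kappa> times the identity is nonnegative, so \<open>s z\<close> may be replaced by the inflated
  \<open>s x0\<close>; undoing the shift costs \<kappa> times the difference of the energies, of
  order \<delta>.\<close>

lemma sup_conv_ball_subsol:
  fixes W :: "(real^'d) set" and s :: "real^'d \<Rightarrow> 'k::finite \<Rightarrow> real^'d"
  assumes W: "compact W" and x0: "x0 \<in> W" and f: "continuous_on W f" and \<kappa>: "\<kappa> > 0"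
    and quad: "\<And>w. sup_conv W \<kappa> x0 f w \<le> f x0 + b * (norm w)\<^sup>2" and b: "b \<ge> 0"
    and jet: "jet_cond W s f 0 x0 a"
    and s: "\<And>j. continuous_on W (\<lambda>z. s z j)" and d: "0 < \<delta>" "\<delta> \<le> 1"
  obtains R0 where "R0 > 0" "\<And>R. 0 < R \<Longrightarrow> R \<le> R0 \<Longrightarrow>
    ball_subsol R (inflate \<delta> (s x0)) (a - \<kappa> * \<delta> * (energy (s x0) + CARD('d) + 1)) (sup_conv W \<kappa> x0 f)"
proof -
  obtain \<rho> where \<rho>: "\<rho> > 0" and J: "\<And>z \<psi> G Q. z \<in> W \<Longrightarrow> C2_with UNIV \<psi> G Q \<Longrightarrow>
      (\<And>x. x \<in> W \<Longrightarrow> f x - \<psi> x \<le> f z - \<psi> z) \<Longrightarrow> norm (z - x0) < \<rho> \<Longrightarrow> norm (G z) < \<rho>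
      \<Longrightarrow> a \<le> diff_op (s z) (Q z)"
    using jet unfolding jet_cond_def by fastforce
  have k1: "continuous_on W (\<lambda>z. energy (\<lambda>j. s z j - s x0 j))" and k2: "continuous_on W (\<lambda>z. energy (s z))"
    unfolding energy_def by (intro continuous_intros s)+
  have d2: "0 < \<delta>\<^sup>2 / 2" using d by simp
  obtain r1 where r1: "r1 > 0" "\<And>z. z \<in> W \<Longrightarrow> norm (z - x0) < r1 \<Longrightarrow>
      dist (energy (\<lambda>j. s z j - s x0 j)) (energy (\<lambda>j. s x0 j - s x0 j)) < \<delta>\<^sup>2 / 2"
    using k1[unfolded continuous_on_iff, rule_format, OF x0 d2]
    unfolding dist_norm[where 'a = "real^'d"] by blast
  obtain r2 where r2: "r2 > 0" "\<And>z. z \<in> W \<Longrightarrow> norm (z - x0) < r2 \<Longrightarrow> dist (energy (s z)) (energy (s x0)) < \<delta>"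
    using k2[unfolded continuous_on_iff, rule_format, OF x0 d(1)]
    unfolding dist_norm[where 'a = "real^'d"] by blast
  define r where "r = Min {\<rho>, r1, r2}"
  have r: "r > 0" "r \<le> \<rho>" "r \<le> r1" "r \<le> r2" using \<rho> r1 r2 by (auto simp: r_def)
  define c where "c = 2 * (b + \<kappa>) / \<kappa>"
  have c: "c > 0" using b \<kappa> by (simp add: c_def)
  \<comment> \<open>The maximiser is within \<open>c * norm w\<close> of \<open>x0\<close>, and the
    gradient is 2\<kappa> times \<open>z - x0 - w\<close>. This radius keeps both below
    \<open>r\<close>.\<close>
  define R0 where "R0 = r / (1 + 2 * \<kappa>) / (c + 1)"
  have R0: "R0 > 0" using r c \<kappa> by (simp add: R0_def)
  have "ball_subsol R (inflate \<delta> (s x0)) (a - \<kappa> * \<delta> * (energy (s x0) + CARD('d) + 1)) (sup_conv W \<kappa> x0 f)"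
    if R: "0 < R" "R \<le> R0" for R
    unfolding ball_subsol_def
  proof (intro ballI allI impI, elim conjE)
    fix w \<phi> G Q
    assume w: "w \<in> ball (0::real^'d) R" and \<phi>: "C2_with UNIV \<phi> G Q"
      and max: "\<forall>x\<in>ball 0 R. sup_conv W \<kappa> x0 f x - \<phi> x \<le> sup_conv W \<kappa> x0 f w - \<phi> w"
    have wR: "norm w < R" using w by simp
    have max': "\<And>x. norm x < R \<Longrightarrow> sup_conv W \<kappa> x0 f x - \<phi> x \<le> sup_conv W \<kappa> x0 f w - \<phi> w"
      using max by simp
    obtain z where z: "z \<in> W" "sup_conv W \<kappa> x0 f w = f z - \<kappa> * (norm (z - x0 - w))\<^sup>2"
      using sup_conv_attained[OF W x0 f \<kappa>] by metis
    have "norm (z - x0) \<le> c * norm w"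
      using sup_conv_maximiser_near[OF W x0 f \<kappa> quad b z] \<kappa> by (simp add: c_def field_simps)
    then have "norm (z - x0) + norm w \<le> (c + 1) * norm w" by (simp add: algebra_simps)
    also have "\<dots> < (c + 1) * R" using wR c by simp
    also have "\<dots> \<le> (c + 1) * R0" using R c by simp
    also have "\<dots> = r / (1 + 2 * \<kappa>)" using c by (simp add: R0_def)
    finally have "(norm (z - x0) + norm w) * (1 + 2 * \<kappa>) < r"
      using \<kappa> by (simp add: pos_less_divide_eq)
    then have small: "norm (z - x0) + norm w + 2 * \<kappa> * (norm (z - x0) + norm w) < r"
      by (simp add: algebra_simps)
    have nn: "0 \<le> 2 * \<kappa> * (norm (z - x0) + norm w)" using \<kappa> by simp
    have zr: "norm (z - x0) < r" using small nn norm_ge_zero[of w] by linarith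
    note contact = sup_conv_contact[OF W x0 f \<kappa> wR \<phi> max' z]
    have "norm (G w) = 2 * \<kappa> * norm (z - x0 - w)" using contact(1) \<kappa> by simp
    also have "\<dots> \<le> 2 * \<kappa> * (norm (z - x0) + norm w)"
      using \<kappa> norm_triangle_ineq4[of "z - x0" w] by simp
    finally have Gr: "norm (G w) < r" using small norm_ge_zero[of "z - x0"] norm_ge_zero[of w] by linarith
    obtain \<psi> G' Q' where \<psi>: "C2_with UNIV \<psi> G' Q'" "\<forall>x\<in>W. f x - \<psi> x \<le> f z - \<psi> z" "G' z = G w" "Q' z = Q w"
      using contact(3) by blast
    have aQ: "a \<le> diff_op (s z) (Q w)"
      using J[OF z(1) \<psi>(1)] \<psi>(2-4) zr Gr r by auto
    define Y where "Y = Q w + (2 * \<kappa>) *\<^sub>R mat 1"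
    have Y: "0 \<le> (Y *v v) \<bullet> v" for v
      using contact(2)[of v]
      by (simp add: Y_def matrix_vector_mult_add_rdistrib scaleR_matrix_vector inner_add_left power2_norm_eq_inner)
    have DY: "diff_op s' Y = diff_op s' (Q w) + \<kappa> * energy s'" for s' :: "'j::finite \<Rightarrow> real^'d"
      by (simp add: Y_def diff_op_add diff_op_scaleR diff_op_mat energy_def)
    have "diff_op (s z) Y \<le> diff_op (inflate \<delta> (s x0)) Y"
    proof (rule diff_op_le_inflate[OF Y d])
      have "energy (\<lambda>j. s x0 j - s x0 j) = 0" by (simp add: energy_def)
      moreover have "dist (energy (\<lambda>j. s z j - s x0 j)) (energy (\<lambda>j. s x0 j - s x0 j)) < \<delta>\<^sup>2 / 2"
        using r1(2)[OF z(1)] zr r by simp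
      ultimately show "energy (\<lambda>j. s z j - s x0 j) \<le> \<delta>\<^sup>2 / 2" by (simp add: dist_real_def)
    qed
    then have 1: "a + \<kappa> * energy (s z) \<le> diff_op (inflate \<delta> (s x0)) (Q w) + \<kappa> * energy (inflate \<delta> (s x0))"
      using aQ unfolding DY by linarith
    have "energy (s x0) - energy (s z) \<le> \<delta>" using r2(2)[OF z(1)] zr r by (simp add: dist_real_def abs_less_iff)
    then have "energy (inflate \<delta> (s x0)) - energy (s z) \<le> \<delta> * (energy (s x0) + CARD('d) + 1)"
      using d by (simp add: energy_inflate algebra_simps)
    from mult_left_mono[OF this, of \<kappa>] 1 \<kappa>
    show "a - \<kappa> * \<delta> * (energy (s x0) + CARD('d) + 1) \<le> diff_op (inflate \<delta> (s x0)) (Q w)"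
      by (simp add: algebra_simps)
  qed
  then show ?thesis using R0 that by blast
qed

section \<open>Doubling of variables\<close>

lemma jet_cond_shift:
  assumes "jet_cond W s f p x0 a"
  shows "jet_cond W s (\<lambda>x. f x - p \<bullet> (x - x0)) 0 x0 a"
proof -
  obtain \<rho> where \<rho>: "\<rho> > 0" and J: "\<forall>z\<in>W. \<forall>\<psi> G Q. C2_with UNIV \<psi> G Q \<and>
      (\<forall>x\<in>W. f x - \<psi> x \<le> f z - \<psi> z) \<and> norm (z - x0) < \<rho> \<and> norm (G z - p) < \<rho>
      \<longrightarrow> a \<le> diff_op (s z) (Q z)"
    using assms unfolding jet_cond_def by blast
  have "a \<le> diff_op (s z) (Q z)"
    if z: "z \<in> W" and \<psi>: "C2_with UNIV \<psi> G Q"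
      and max: "\<forall>x\<in>W. f x - p \<bullet> (x - x0) - \<psi> x \<le> f z - p \<bullet> (z - x0) - \<psi> z"
      and n: "norm (z - x0) < \<rho>" "norm (G z - 0) < \<rho>" for z \<psi> G Q
  proof -
    have "C2_with UNIV (\<lambda>x. \<psi> x + p \<bullet> x) (\<lambda>x. G x + p) (\<lambda>x. Q x + 0)"
      by (intro C2_with_add \<psi> C2_with_linear)
    moreover have "\<forall>x\<in>W. f x - (\<psi> x + p \<bullet> x) \<le> f z - (\<psi> z + p \<bullet> z)"
      using max by (auto simp: inner_diff_right)
    moreover have "norm (G z + p - p) < \<rho>" using n by simp
    ultimately show ?thesis using J z n(1) by fastforce
  qed
  then show ?thesis unfolding jet_cond_def using \<rho> by blast
qed

lemma sum_squares_split:
  fixes \<xi>1 \<xi>2 w1 w2 :: "'a::real_inner"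
  shows "(norm (\<xi>1 - \<xi>2))\<^sup>2 \<le> 2 * (norm (w1 - w2))\<^sup>2 + 4 * (norm (\<xi>1 - w1))\<^sup>2 + 4 * (norm (\<xi>2 - w2))\<^sup>2"
    and "(norm \<xi>2)\<^sup>2 \<le> 2 * (norm w2)\<^sup>2 + 2 * (norm (\<xi>2 - w2))\<^sup>2"
proof -
  have two: "(norm (a + b))\<^sup>2 \<le> 2 * (norm a)\<^sup>2 + 2 * (norm b)\<^sup>2" for a b :: 'a
  proof -
    have "0 \<le> (norm (a - b))\<^sup>2" by simp
    then show ?thesis
      unfolding power2_norm_eq_inner by (simp add: inner_diff inner_add inner_commute algebra_simps)
  qed
  show "(norm \<xi>2)\<^sup>2 \<le> 2 * (norm w2)\<^sup>2 + 2 * (norm (\<xi>2 - w2))\<^sup>2"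
    using two[of w2 "\<xi>2 - w2"] by simp
  have "(norm ((\<xi>1 - w1) + (w2 - \<xi>2)))\<^sup>2 \<le> 2 * (norm (\<xi>1 - w1))\<^sup>2 + 2 * (norm (\<xi>2 - w2))\<^sup>2"
    using two[of "\<xi>1 - w1" "w2 - \<xi>2"] by (simp add: norm_minus_commute)
  moreover have "(\<xi>1 - \<xi>2) = (w1 - w2) + ((\<xi>1 - w1) + (w2 - \<xi>2))" by simp
  then have "(norm (\<xi>1 - \<xi>2))\<^sup>2 \<le> 2 * (norm (w1 - w2))\<^sup>2 + 2 * (norm ((\<xi>1 - w1) + (w2 - \<xi>2)))\<^sup>2"
    using two by metis
  ultimately show "(norm (\<xi>1 - \<xi>2))\<^sup>2 \<le> 2 * (norm (w1 - w2))\<^sup>2 + 4 * (norm (\<xi>1 - w1))\<^sup>2 + 4 * (norm (\<xi>2 - w2))\<^sup>2"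
    by linarith
qed

text \<open>Subtracting the affine parts at the maximum leaves a purely quadratic bound on
  \<open>W\<close>. Sup-convolution extends it to all pairs of points with doubled weights and with
  equality at the origin, as \<open>ball_subsol_sum\<close> requires; finally \<delta> tends to
  0.\<close>

lemma doubling_sums:
  fixes W :: "(real^'d) set" and s :: "real^'d \<Rightarrow> 'k::finite \<Rightarrow> real^'d"
  assumes W: "compact W" and x0: "x0 \<in> W" and y0: "y0 \<in> W"
    and u: "continuous_on W u" and v: "continuous_on W v" and s: "\<And>j. continuous_on W (\<lambda>z. s z j)"
    and m: "m > 0" and \<nu>: "\<nu> \<ge> 0"
    and max: "\<And>x y. x \<in> W \<Longrightarrow> y \<in> W \<Longrightarrow>
       u x + v y - m * (norm (x - y - c))\<^sup>2 - \<nu> * (norm (y - z0))\<^sup>2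
         \<le> u x0 + v y0 - m * (norm (x0 - y0 - c))\<^sup>2 - \<nu> * (norm (y0 - z0))\<^sup>2"
    and p1: "p1 = (2 * m) *\<^sub>R (x0 - y0 - c)" and p2: "p2 = - p1 + (2 * \<nu>) *\<^sub>R (y0 - z0)"
    and jets: "jet_cond W s u p1 x0 a1" "jet_cond W s v p2 y0 a2"
  shows "a1 + a2 \<le> 2 * m * energy (\<lambda>j. s x0 j - s y0 j) + 2 * \<nu> * energy (s y0)"
proof -
  define f1 where "f1 = (\<lambda>x. u x - p1 \<bullet> (x - x0))"
  define f2 where "f2 = (\<lambda>y. v y - p2 \<bullet> (y - y0))"
  have f1: "continuous_on W f1" and f2: "continuous_on W f2"
    unfolding f1_def f2_def by (intro continuous_intros u v)+
  have z: "f1 x0 = u x0" "f2 y0 = v y0" by (simp_all add: f1_def f2_def)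
  \<comment> \<open>Splitting the squares by \<open>sum_squares_split\<close> produces 4m from the
    first penalty and 2\<nu> from the second; this \<kappa> absorbs both.\<close>
  define \<kappa> where "\<kappa> = 4 * m + 2 * \<nu>"
  have \<kappa>: "\<kappa> > 0" using m \<nu> by (simp add: \<kappa>_def)
  define U1 where "U1 = sup_conv W \<kappa> x0 f1"
  define U2 where "U2 = sup_conv W \<kappa> y0 f2"
  have c1: "continuous_on UNIV U1" and c2: "continuous_on UNIV U2"
    unfolding U1_def U2_def
    using sup_conv_continuous[OF W x0 f1 \<kappa>] sup_conv_continuous[OF W y0 f2 \<kappa>] by auto
  have flat: "f1 x + f2 y \<le> u x0 + v y0 + m * (norm ((x - x0) - (y - y0)))\<^sup>2 + \<nu> * (norm (y - y0))\<^sup>2"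
    if "x \<in> W" "y \<in> W" for x y
  proof -
    define a b r q where "a = x - x0" and "b = y - y0" and "r = x0 - y0 - c" and "q = y0 - z0"
    have e: "x - y - c = r + (a - b)" "y - z0 = q + b" by (simp_all add: a_def b_def r_def q_def)
    have "m * (norm (r + (a - b)))\<^sup>2 + \<nu> * (norm (q + b))\<^sup>2
      = m * (norm r)\<^sup>2 + \<nu> * (norm q)\<^sup>2 + p1 \<bullet> a + p2 \<bullet> b + m * (norm (a - b))\<^sup>2 + \<nu> * (norm b)\<^sup>2"
      unfolding p1 p2 r_def[symmetric] q_def[symmetric] power2_norm_eq_inner
      by (simp add: inner_diff inner_add inner_commute algebra_simps)
    then show ?thesis
      using max[OF that] unfolding e f1_def f2_def a_def[symmetric] b_def[symmetric] r_def[symmetric] q_def[symmetric]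
      by linarith
  qed
  have sum: "U1 w1 + U2 w2 \<le> u x0 + v y0 + 2 * m * (norm (w1 - w2))\<^sup>2 + 2 * \<nu> * (norm w2)\<^sup>2" for w1 w2
  proof -
    obtain x where x: "x \<in> W" "U1 w1 = f1 x - \<kappa> * (norm (x - x0 - w1))\<^sup>2"
      using sup_conv_attained[OF W x0 f1 \<kappa>] unfolding U1_def by metis
    obtain y where y: "y \<in> W" "U2 w2 = f2 y - \<kappa> * (norm (y - y0 - w2))\<^sup>2"
      using sup_conv_attained[OF W y0 f2 \<kappa>] unfolding U2_def by metis
    define A B where "A = (norm (x - x0 - w1))\<^sup>2" and "B = (norm (y - y0 - w2))\<^sup>2"
    have AB: "0 \<le> A" "0 \<le> B" by (simp_all add: A_def B_def)
    have 1: "m * (norm ((x - x0) - (y - y0)))\<^sup>2 \<le> m * (2 * (norm (w1 - w2))\<^sup>2 + 4 * A + 4 * B)"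
      unfolding A_def B_def using m sum_squares_split(1) by (intro mult_left_mono) auto
    have 2: "\<nu> * (norm (y - y0))\<^sup>2 \<le> \<nu> * (2 * (norm w2)\<^sup>2 + 2 * B)"
      unfolding B_def using \<nu> sum_squares_split(2) by (intro mult_left_mono) auto
    have 3: "0 \<le> 2 * \<nu> * A" using \<nu> AB by simp
    show ?thesis
      using 1 2 3 flat[OF x(1) y(1)] unfolding x(2) y(2) A_def[symmetric] B_def[symmetric] \<kappa>_def
      by (simp add: algebra_simps)
  qed
  have ge: "u x0 \<le> U1 0" "v y0 \<le> U2 0"
    using sup_conv_ge[OF W x0 f1 \<kappa> x0, of 0] sup_conv_ge[OF W y0 f2 \<kappa> y0, of 0] z
    by (simp_all add: U1_def U2_def)
  have eq: "U1 0 = u x0" "U2 0 = v y0" using ge sum[of 0 0] by auto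
  have q1: "U1 w \<le> f1 x0 + (2 * m) * (norm w)\<^sup>2" for w
    using sum[of w 0] eq z by simp
  have q2: "U2 w \<le> f2 y0 + (2 * m + 2 * \<nu>) * (norm w)\<^sup>2" for w
    using sum[of 0 w] eq z by (simp add: algebra_simps)
  have j1: "jet_cond W s f1 0 x0 a1" and j2: "jet_cond W s f2 0 y0 a2"
    unfolding f1_def f2_def using jets jet_cond_shift by blast+
  define L where "L = \<kappa> * (energy (s x0) + CARD('d) + 1) + \<kappa> * (energy (s y0) + CARD('d) + 1)
     + 2 * m * energy (\<lambda>j. s x0 j - s y0 j) + 2 * \<nu> * (energy (s y0) + CARD('d))"
  have L: "L \<ge> 0"
    unfolding L_def using \<kappa> m \<nu> energy_nonneg[of "s x0"] energy_nonneg[of "s y0"]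
      energy_nonneg[of "\<lambda>j. s x0 j - s y0 j"] by (intro add_nonneg_nonneg mult_nonneg_nonneg) auto
  have main: "a1 + a2 \<le> 2 * m * energy (\<lambda>j. s x0 j - s y0 j) + 2 * \<nu> * energy (s y0) + \<delta> * L"
    if d: "0 < \<delta>" "\<delta> \<le> 1" for \<delta>
  proof -
    obtain R1 where R1: "R1 > 0" "\<And>R. 0 < R \<Longrightarrow> R \<le> R1 \<Longrightarrow>
      ball_subsol R (inflate \<delta> (s x0)) (a1 - \<kappa> * \<delta> * (energy (s x0) + CARD('d) + 1)) U1"
      unfolding U1_def
      by (rule sup_conv_ball_subsol[OF W x0 f1 \<kappa> q1[unfolded U1_def] _ j1 s d]) (use m in auto)
    obtain R2 where R2: "R2 > 0" "\<And>R. 0 < R \<Longrightarrow> R \<le> R2 \<Longrightarrow>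
      ball_subsol R (inflate \<delta> (s y0)) (a2 - \<kappa> * \<delta> * (energy (s y0) + CARD('d) + 1)) U2"
      unfolding U2_def
      by (rule sup_conv_ball_subsol[OF W y0 f2 \<kappa> q2[unfolded U2_def] _ j2 s d]) (use m \<nu> in auto)
    define R where "R = min 1 (min R1 R2)"
    have R: "0 < R" "R \<le> 1" "R \<le> R1" "R \<le> R2" using R1 R2 by (auto simp: R_def)
    have "(a1 - \<kappa> * \<delta> * (energy (s x0) + CARD('d) + 1)) + (a2 - \<kappa> * \<delta> * (energy (s y0) + CARD('d) + 1))
       \<le> (2 * m) * energy (\<lambda>j. inflate \<delta> (s x0) j - inflate \<delta> (s y0) j) + (2 * \<nu>) * energy (inflate \<delta> (s y0))"
      by (rule ball_subsol_sum[OF c1 R1(2)[OF R(1,3)] c2 R2(2)[OF R(1,4)] R(1,2)])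
        (use m \<nu> sum eq in auto)
    then show ?thesis
      using d by (simp add: energy_inflate energy_inflate_diff L_def algebra_simps)
  qed
  show ?thesis
  proof (rule field_le_epsilon)
    fix e :: real assume e: "e > 0"
    define \<delta> where "\<delta> = min 1 (e / (L + 1))"
    have d: "0 < \<delta>" "\<delta> \<le> 1" using e L by (auto simp: \<delta>_def)
    have "\<delta> \<le> e / (L + 1)" by (simp add: \<delta>_def)
    then have "\<delta> * L + \<delta> \<le> e" using L by (simp add: pos_le_divide_eq algebra_simps)
    then show "a1 + a2 \<le> 2 * m * energy (\<lambda>j. s x0 j - s y0 j) + 2 * \<nu> * energy (s y0) + e"
      using main[OF d] d by linarith
  qed
qed

text \<open>Testing the maximum with the pair \<open>(z0 + e / n, z0)\<close>, which has no penalty,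
  bounds it below. Uniform continuity of \<open>u\<close> and maximality of \<open>z0\<close> on the
  diagonal bound \<open>u x0 - v y0\<close> above; the difference controls both penalties.\<close>

lemma doubling_points:
  fixes W :: "(real^'d) set"
  assumes W: "compact W" and u: "continuous_on W u" and v: "continuous_on W v"
    and z0: "z0 \<in> W" and M: "\<And>x. x \<in> W \<Longrightarrow> u x - v x \<le> u z0 - v z0"
    and shift: "\<And>n. n \<ge> (1::nat) \<Longrightarrow> z0 + (1 / n) *\<^sub>R e \<in> W"
    and \<nu>: "\<nu> \<ge> 0" and \<epsilon>: "\<epsilon> > 0"
  shows "\<forall>\<^sub>F n::nat in sequentially. \<exists>x0\<in>W. \<exists>y0\<in>W.
     (\<forall>x\<in>W. \<forall>y\<in>W. u x - v y - (real n)\<^sup>2 * (norm (x - y - (1 / n) *\<^sub>R e))\<^sup>2 - \<nu> * (norm (y - z0))\<^sup>2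
        \<le> u x0 - v y0 - (real n)\<^sup>2 * (norm (x0 - y0 - (1 / n) *\<^sub>R e))\<^sup>2 - \<nu> * (norm (y0 - z0))\<^sup>2) \<and>
     (real n)\<^sup>2 * (norm (x0 - y0 - (1 / n) *\<^sub>R e))\<^sup>2 \<le> \<epsilon> \<and> \<nu> * (norm (y0 - z0))\<^sup>2 \<le> \<epsilon> \<and>
     u z0 - v z0 - \<epsilon> \<le> u x0 - v y0"
proof -
  obtain d where d: "d > 0" "\<And>x y. x \<in> W \<Longrightarrow> y \<in> W \<Longrightarrow> norm (x - y) < d \<Longrightarrow> \<bar>u x - u y\<bar> < \<epsilon> / 2"
  proof -
    have e2: "0 < \<epsilon> / 2" using \<epsilon> by simp
    obtain d where "d > 0" "\<And>x y. x \<in> W \<Longrightarrow> y \<in> W \<Longrightarrow> dist y x < d \<Longrightarrow> dist (u y) (u x) < \<epsilon> / 2"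
      using uniformly_continuous_onE[OF compact_uniformly_continuous[OF u W] e2] by metis
    then show ?thesis by (intro that[of d]) (auto simp: dist_norm)
  qed
  obtain B where B: "B > 0" "\<And>x. x \<in> W \<Longrightarrow> \<bar>u x\<bar> \<le> B" "\<And>x. x \<in> W \<Longrightarrow> \<bar>v x\<bar> \<le> B"
  proof -
    have "bounded (u ` W)" "bounded (v ` W)"
      using W u v by (auto intro!: compact_imp_bounded compact_continuous_image)
    then obtain B1 B2 where "\<And>x. x \<in> W \<Longrightarrow> \<bar>u x\<bar> \<le> B1" "\<And>x. x \<in> W \<Longrightarrow> \<bar>v x\<bar> \<le> B2"
      unfolding bounded_iff by (metis imageI real_norm_def)
    then show ?thesis by (intro that[of "\<bar>B1\<bar> + \<bar>B2\<bar> + 1"]) force+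
  qed
  have "(\<lambda>n::nat. (norm e + sqrt (4 * B + \<epsilon>)) / n) \<longlonglongrightarrow> 0"
    by (rule lim_const_over_n)
  then have "\<forall>\<^sub>F n::nat in sequentially. (norm e + sqrt (4 * B + \<epsilon>)) / n < d"
    using d(1) by (rule order_tendstoD)
  then show ?thesis
    using eventually_ge_at_top[of 1]
  proof eventually_elim
    case (elim n)
    have n: "0 < real n" using elim by simp
    define c where "c = (1 / n) *\<^sub>R e"
    define \<Phi> where "\<Phi> = (\<lambda>(x, y). u x - v y - (real n)\<^sup>2 * (norm (x - y - c))\<^sup>2 - \<nu> * (norm (y - z0))\<^sup>2)"
    have "continuous_on (W \<times> W) (\<lambda>p. u (fst p))" "continuous_on (W \<times> W) (\<lambda>p. v (snd p))"
      by (rule continuous_on_compose2[OF u] continuous_on_compose2[OF v]; auto intro!: continuous_intros)+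
    then have c\<Phi>: "continuous_on (W \<times> W) \<Phi>"
      unfolding \<Phi>_def case_prod_unfold by (intro continuous_intros)
    have WW: "compact (W \<times> W)" "W \<times> W \<noteq> {}" using W z0 by (auto intro: compact_Times)
    obtain p where p: "p \<in> W \<times> W" "\<And>q. q \<in> W \<times> W \<Longrightarrow> \<Phi> q \<le> \<Phi> p"
      using continuous_attains_sup[OF WW c\<Phi>] by blast
    obtain x0 y0 where xy: "p = (x0, y0)" by (cases p)
    have in_W: "x0 \<in> W" "y0 \<in> W" using p(1) xy by auto
    have max: "u x - v y - (real n)\<^sup>2 * (norm (x - y - c))\<^sup>2 - \<nu> * (norm (y - z0))\<^sup>2
        \<le> u x0 - v y0 - (real n)\<^sup>2 * (norm (x0 - y0 - c))\<^sup>2 - \<nu> * (norm (y0 - z0))\<^sup>2" if "x \<in> W" "y \<in> W" for x y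
      using p(2)[of "(x, y)"] that xy by (simp add: \<Phi>_def)
    define P1 P2 where "P1 = (real n)\<^sup>2 * (norm (x0 - y0 - c))\<^sup>2" and "P2 = \<nu> * (norm (y0 - z0))\<^sup>2"
    have P: "0 \<le> P1" "0 \<le> P2" using \<nu> by (simp_all add: P1_def P2_def)
    have zc: "z0 + c \<in> W" using shift[OF elim(2)] by (simp add: c_def)
    have "norm e / n \<le> (norm e + sqrt (4 * B + \<epsilon>)) / n"
      using B(1) \<epsilon> n by (intro divide_right_mono) auto
    then have "norm (z0 + c - z0) < d" using elim(1) n by (simp add: c_def)
    from d(2)[OF zc z0 this] have "u z0 - \<epsilon> / 2 < u (z0 + c)" by linarith
    then have low: "u z0 - v z0 - \<epsilon> / 2 \<le> u x0 - v y0 - P1 - P2"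
      using max[OF zc z0] by (simp add: P1_def P2_def)
    \<comment> \<open>A crude first bound, used only to bring \<open>x0\<close> close to
      \<open>y0\<close> so that uniform continuity can then improve it to \<epsilon>.\<close>
    then have "P1 \<le> 4 * B + \<epsilon>"
      using P B(2)[OF z0] B(3)[OF z0] B(2)[OF in_W(1)] B(3)[OF in_W(2)] \<epsilon> by linarith
    then have "(n * norm (x0 - y0 - c))\<^sup>2 \<le> 4 * B + \<epsilon>" by (simp add: P1_def power_mult_distrib)
    then have "n * norm (x0 - y0 - c) \<le> sqrt (4 * B + \<epsilon>)"
      by (rule real_le_rsqrt)
    then have "norm (x0 - y0 - c) \<le> sqrt (4 * B + \<epsilon>) / n" using n by (simp add: pos_le_divide_eq mult.commute)
    moreover have "norm (x0 - y0) \<le> norm (x0 - y0 - c) + norm c"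
      using norm_triangle_ineq[of "x0 - y0 - c" c] by simp
    moreover have "norm c = norm e / n" by (simp add: c_def)
    ultimately have "norm (x0 - y0) < d" using elim(1) by (simp add: add_divide_distrib)
    from d(2)[OF in_W this] have "u x0 - u y0 < \<epsilon> / 2" by linarith
    then have "u x0 - v y0 \<le> u z0 - v z0 + \<epsilon> / 2" using M[OF in_W(2)] by linarith
    then have "P1 + P2 \<le> \<epsilon>" "u z0 - v z0 - \<epsilon> \<le> u x0 - v y0" using low P \<epsilon> by linarith+
    with P have "P1 \<le> \<epsilon>" "P2 \<le> \<epsilon>" "u z0 - v z0 - \<epsilon> \<le> u x0 - v y0" by linarith+
    then show ?case
      using max in_W unfolding P1_def P2_def c_def by blast
  qed
qed

section \<open>The comparison principle\<close>

lemma trace_outer_product: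
  fixes S :: "real^'k^'d" and A :: "real^'d^'d"
  shows "(1/2) * trace ((S ** transpose S) ** A) = diff_op (\<lambda>j. column j S) A"
proof -
  have "trace ((S ** transpose S) ** A) = (\<Sum>i\<in>UNIV. \<Sum>l\<in>UNIV. (\<Sum>j\<in>UNIV. S $ i $ j * S $ l $ j) * A $ l $ i)"
    by (simp add: trace_def matrix_matrix_mult_def transpose_def)
  also have "\<dots> = (\<Sum>i\<in>UNIV. \<Sum>l\<in>UNIV. \<Sum>j\<in>UNIV. S $ i $ j * S $ l $ j * A $ l $ i)"
    by (simp add: sum_distrib_right)
  also have "\<dots> = (\<Sum>i\<in>UNIV. \<Sum>j\<in>UNIV. \<Sum>l\<in>UNIV. S $ i $ j * S $ l $ j * A $ l $ i)"
    by (intro sum.cong refl sum.swap)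
  also have "\<dots> = (\<Sum>j\<in>UNIV. \<Sum>i\<in>UNIV. \<Sum>l\<in>UNIV. S $ i $ j * S $ l $ j * A $ l $ i)"
    by (rule sum.swap)
  also have "\<dots> = (\<Sum>j\<in>UNIV. \<Sum>l\<in>UNIV. \<Sum>i\<in>UNIV. S $ i $ j * S $ l $ j * A $ l $ i)"
    by (intro sum.cong refl sum.swap)
  also have "\<dots> = (\<Sum>j\<in>UNIV. (A *v column j S) \<bullet> column j S)"
    by (simp add: inner_vec_def matrix_vector_mult_def column_def sum_distrib_left mult_ac)
  finally show ?thesis by (simp add: diff_op_def)
qed

lemma Fop_eq:
  "Fop \<alpha> \<theta> \<sigma> g x r q A = \<alpha> x * r - \<theta> x \<bullet> q - diff_op (\<lambda>j. column j (\<sigma> x)) A - g x"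
  unfolding Fop_def trace_outer_product ..

section \<open>Moduli of continuity and bounds on compact sets\<close>

lemma tendsto_at_right_bound:
  fixes \<omega> :: "real \<Rightarrow> real"
  assumes "(\<omega> \<longlongrightarrow> 0) (at_right 0)" "e > 0"
  obtains d where "d > 0" "\<And>t. 0 < t \<Longrightarrow> t < d \<Longrightarrow> \<omega> t < e"
proof -
  have "\<forall>\<^sub>F t in at_right 0. \<omega> t < e" using assms by (rule order_tendstoD)
  then show ?thesis using that unfolding eventually_at_right_field by blast
qed

lemma uniform_modulus:
  fixes g :: "real^'d \<Rightarrow> real" and H :: "real^'d \<Rightarrow> real^'d \<Rightarrow> real"
  assumes \<omega>: "(\<omega> \<longlongrightarrow> 0) (at_right 0)"
    and mod: "\<forall>x\<in>W. \<forall>y\<in>W. \<forall>q. \<bar>g x - g y\<bar> + \<bar>H x q - H y q\<bar> \<le> \<omega> (norm (x - y))"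
    and e: "e > 0"
  obtains d where "d > 0"
    "\<And>x y q. x \<in> W \<Longrightarrow> y \<in> W \<Longrightarrow> norm (x - y) < d \<Longrightarrow> \<bar>g x - g y\<bar> \<le> e \<and> \<bar>H x q - H y q\<bar> \<le> e"
proof -
  obtain d where d: "d > 0" "\<And>t. 0 < t \<Longrightarrow> t < d \<Longrightarrow> \<omega> t < e"
    using tendsto_at_right_bound[OF \<omega> e] by blast
  have "\<bar>g x - g y\<bar> \<le> e \<and> \<bar>H x q - H y q\<bar> \<le> e"
    if "x \<in> W" "y \<in> W" "norm (x - y) < d" for x y q
  \<comment> \<open>The limit at 0+ says nothing about \<omega> at 0 itself, so coinciding points
    are treated apart.\<close>
  proof (cases "x = y")
    case False
    have "\<bar>g x - g y\<bar> + \<bar>H x q - H y q\<bar> \<le> \<omega> (norm (x - y))" using mod that by blast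
    moreover have "\<omega> (norm (x - y)) < e" using d(2) that(3) False by simp
    ultimately show ?thesis by linarith
  qed (use e in simp)
  then show ?thesis using d(1) that by blast
qed

lemma uniform_modulus_continuous:
  fixes g :: "real^'d \<Rightarrow> real"
  assumes "\<And>e. e > 0 \<Longrightarrow> \<exists>d>0. \<forall>x\<in>W. \<forall>y\<in>W. norm (x - y) < d \<longrightarrow> \<bar>g x - g y\<bar> \<le> e"
  shows "continuous_on W g"
  unfolding continuous_on_iff
proof (intro ballI allI impI)
  fix x e assume x: "x \<in> W" and e: "(0::real) < e"
  obtain d where "d > 0" "\<forall>x\<in>W. \<forall>y\<in>W. norm (x - y) < d \<longrightarrow> \<bar>g x - g y\<bar> \<le> e / 2"
    using assms[of "e / 2"] e by auto
  then show "\<exists>d>0. \<forall>x'\<in>W. dist x' x < d \<longrightarrow> dist (g x') (g x) < e"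
    using x e by (intro exI[of _ d]) (fastforce simp: dist_norm)
qed

lemma lipschitz_bound_continuous:
  fixes f :: "'a::real_normed_vector \<Rightarrow> 'b::real_normed_vector"
  assumes "\<And>x y. x \<in> W \<Longrightarrow> y \<in> W \<Longrightarrow> norm (f x - f y) \<le> C * norm (x - y)" "C \<ge> 0"
  shows "continuous_on W f"
proof -
  have "C-lipschitz_on W f"
    using assms by (auto simp: lipschitz_on_def dist_norm)
  then show ?thesis by (rule lipschitz_on_continuous_on)
qed

lemma bounded_on_compact:
  fixes f :: "'a::topological_space \<Rightarrow> 'b::real_normed_vector"
  assumes "compact W" "continuous_on W f"
  obtains B where "B \<ge> 0" "\<And>x. x \<in> W \<Longrightarrow> norm (f x) \<le> B"
proof -
  have "bounded (f ` W)" using assms by (auto intro!: compact_imp_bounded compact_continuous_image)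
  then obtain B where "\<And>x. x \<in> W \<Longrightarrow> norm (f x) \<le> B" unfolding bounded_iff by blast
  then show ?thesis by (intro that[of "\<bar>B\<bar>"]) force+
qed

locale hjb =
  fixes W :: "(real^'d) set"
    and \<alpha> :: "real^'d \<Rightarrow> real" and \<theta> :: "real^'d \<Rightarrow> real^'d"
    and \<sigma> :: "real^'d \<Rightarrow> real^'k^'d" and g :: "real^'d \<Rightarrow> real"
    and H :: "real^'d \<Rightarrow> real^'d \<Rightarrow> real"
    and C \<alpha>\<^sub>0 :: real and \<omega> :: "real \<Rightarrow> real"
  assumes W_closed: "closed W" and W_bounded: "bounded W"
    and W_cone: "\<forall>\<xi>\<in>W. \<exists>\<eta> a. a > 0 \<and>
        (\<forall>w\<in>W \<inter> ball \<xi> a. \<forall>t\<in>{0<..1}. ball (w + t *\<^sub>R \<eta>) (t * a) \<subseteq> interior W)"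
    and C_ge: "C \<ge> 1" and alpha0_pos: "\<alpha>\<^sub>0 > 0"
    and omega_lim: "(\<omega> \<longlongrightarrow> 0) (at_right 0)"
    and lip: "\<forall>x\<in>W. \<forall>y\<in>W. \<bar>\<alpha> x - \<alpha> y\<bar> + norm (\<theta> x - \<theta> y) + opnorm (\<sigma> x - \<sigma> y)
                 \<le> C * norm (x - y)"
    and alpha_lb: "\<forall>x\<in>W. \<alpha> x \<ge> \<alpha>\<^sub>0"
    and modulus: "\<forall>x\<in>W. \<forall>y\<in>W. \<forall>q. \<bar>g x - g y\<bar> + \<bar>H x q - H y q\<bar> \<le> \<omega> (norm (x - y))"
    and H_lip: "\<forall>x\<in>W. \<forall>q1 q2. \<bar>H x q1 - H x q2\<bar> \<le> C * norm (q1 - q2)"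
begin

lemma W_compact: "compact W"
  using W_closed W_bounded by (simp add: compact_eq_bounded_closed)

lemma opnorm_nonneg: "0 \<le> opnorm (S :: real^'k^'d)"
  unfolding opnorm_def by (intro onorm_pos_le matrix_vector_mul_bounded_linear)

lemma lipschitz:
  assumes "x \<in> W" "y \<in> W"
  shows "\<bar>\<alpha> x - \<alpha> y\<bar> \<le> C * norm (x - y)" "norm (\<theta> x - \<theta> y) \<le> C * norm (x - y)"
    "norm (column j (\<sigma> x) - column j (\<sigma> y)) \<le> C * norm (x - y)"
proof -
  have l: "\<bar>\<alpha> x - \<alpha> y\<bar> + norm (\<theta> x - \<theta> y) + opnorm (\<sigma> x - \<sigma> y) \<le> C * norm (x - y)"
    using lip assms by blast
  then show "\<bar>\<alpha> x - \<alpha> y\<bar> \<le> C * norm (x - y)" "norm (\<theta> x - \<theta> y) \<le> C * norm (x - y)"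
    using opnorm_nonneg[of "\<sigma> x - \<sigma> y"] norm_ge_zero[of "\<theta> x - \<theta> y"] by linarith+
  have "column j (\<sigma> x) - column j (\<sigma> y) = column j (\<sigma> x - \<sigma> y)"
    by (simp add: column_def vec_eq_iff)
  then have "norm (column j (\<sigma> x) - column j (\<sigma> y)) \<le> opnorm (\<sigma> x - \<sigma> y)"
    using norm_column_le_onorm[of j "\<sigma> x - \<sigma> y"] by (simp add: opnorm_def)
  then show "norm (column j (\<sigma> x) - column j (\<sigma> y)) \<le> C * norm (x - y)"
    using l norm_ge_zero[of "\<theta> x - \<theta> y"] by linarith
qed

lemma coeff_continuous:
  "continuous_on W \<alpha>" "continuous_on W \<theta>" "continuous_on W (\<lambda>x. column j (\<sigma> x))" "continuous_on W g"
proof -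
  show "continuous_on W \<alpha>" "continuous_on W \<theta>" "continuous_on W (\<lambda>x. column j (\<sigma> x))"
    using lipschitz C_ge by (auto intro!: lipschitz_bound_continuous[where C = C])
  show "continuous_on W g"
  proof (rule uniform_modulus_continuous)
    fix e :: real assume "e > 0"
    then obtain d where "d > 0" "\<And>x y q. x \<in> W \<Longrightarrow> y \<in> W \<Longrightarrow> norm (x - y) < d \<Longrightarrow> \<bar>g x - g y\<bar> \<le> e \<and> \<bar>H x q - H y q\<bar> \<le> e"
      using uniform_modulus[OF omega_lim modulus] by blast
    then show "\<exists>d>0. \<forall>x\<in>W. \<forall>y\<in>W. norm (x - y) < d \<longrightarrow> \<bar>g x - g y\<bar> \<le> e" by blast
  qed
qed

abbreviation cols :: "real^'d \<Rightarrow> 'k \<Rightarrow> real^'d" where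
  "cols x \<equiv> \<lambda>j. column j (\<sigma> x)"

lemma energy_cols_diff_le:
  assumes "x \<in> W" "y \<in> W"
  shows "energy (\<lambda>j. cols x j - cols y j) \<le> CARD('k) * (C * norm (x - y))\<^sup>2"
proof -
  have "energy (\<lambda>j. cols x j - cols y j) \<le> (\<Sum>j\<in>(UNIV::'k set). (C * norm (x - y))\<^sup>2)"
    unfolding energy_def using lipschitz(3)[OF assms] by (intro sum_mono power_mono) auto
  then show ?thesis by simp
qed

text \<open>Continuity freezes the lower-order terms at the cost of \<open>e\<close>. The factor
  \<open>b\<close> serves both sides: 1 for the subsolution, -1 for the negated supersolution, where
  the source term changes sign.\<close>

lemma jet_cond_from_equation:
  assumes w: "continuous_on W w" and x0: "x0 \<in> W" and e: "e > 0"
    and r: "r > 0" and eq: "\<And>z \<psi> G Q. z \<in> W \<Longrightarrow> norm (z - x0) < r \<Longrightarrow> norm (G z - p) < r \<Longrightarrow> C2_with UNIV \<psi> G Q \<Longrightarrow>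
        (\<And>x. x \<in> W \<Longrightarrow> w x - \<psi> x \<le> w z - \<psi> z) \<Longrightarrow>
        \<alpha> z * w z - \<theta> z \<bullet> G z - b * g z \<le> diff_op (cols z) (Q z)"
  shows "jet_cond W cols w p x0 (\<alpha> x0 * w x0 - \<theta> x0 \<bullet> p - b * g x0 - e)"
proof -
  let ?f = "\<lambda>(z, q). \<alpha> z * w z - \<theta> z \<bullet> q - b * g z"
  have "continuous_on (W \<times> UNIV) ?f"
  proof -
    have "continuous_on (W \<times> (UNIV :: (real^'d) set)) (\<lambda>p. h (fst p))" if "continuous_on W h"
      for h :: "real^'d \<Rightarrow> 'b::real_normed_vector"
      by (rule continuous_on_compose2[OF that]) (auto intro!: continuous_intros)
    note this[OF coeff_continuous(1)] this[OF w] this[OF coeff_continuous(4)]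
    moreover have "continuous_on (W \<times> (UNIV :: (real^'d) set)) (\<lambda>p. \<theta> (fst p))"
      by (rule continuous_on_compose2[OF coeff_continuous(2)]) (auto intro!: continuous_intros)
    ultimately show ?thesis unfolding case_prod_unfold by (intro continuous_intros)
  qed
  moreover have "(x0, p) \<in> W \<times> UNIV" using x0 by simp
  ultimately obtain d where d: "d > 0"
      "\<And>y. y \<in> W \<times> UNIV \<Longrightarrow> dist y (x0, p) < d \<Longrightarrow> dist (?f y) (?f (x0, p)) < e"
    using e unfolding continuous_on_iff by meson
  define \<rho> where "\<rho> = min r (d / 2)"
  have \<rho>: "\<rho> > 0" "\<rho> \<le> r" "\<rho> \<le> d / 2" using r d(1) by (auto simp: \<rho>_def)
  have "\<alpha> x0 * w x0 - \<theta> x0 \<bullet> p - b * g x0 - e \<le> diff_op (cols z) (Q z)"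
    if z: "z \<in> W" and \<psi>: "C2_with UNIV \<psi> G Q" "\<forall>x\<in>W. w x - \<psi> x \<le> w z - \<psi> z"
      and n: "norm (z - x0) < \<rho>" "norm (G z - p) < \<rho>" for z \<psi> G Q
  proof -
    have "dist (z, G z) (x0, p) \<le> norm (z - x0) + norm (G z - p)"
      using norm_Pair_le[of "z - x0" "G z - p"] by (simp add: dist_norm)
    then have "dist (z, G z) (x0, p) < d" using n \<rho> by linarith
    from d(2)[OF _ this] z have "\<bar>?f (z, G z) - ?f (x0, p)\<bar> < e" by (simp add: dist_real_def)
    moreover have "\<alpha> z * w z - \<theta> z \<bullet> G z - b * g z \<le> diff_op (cols z) (Q z)"
      using eq[OF z _ _ \<psi>(1)] \<psi>(2) n \<rho> by auto
    ultimately show ?thesis by simp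
  qed
  then show ?thesis unfolding jet_cond_def using \<rho>(1) by blast
qed

end

section \<open>Comparison with a strict subsolution\<close>

context hjb
begin

lemma diff_op_uminus: "diff_op s (- A) = - diff_op s (A :: real^'d^'d)"
  using diff_op_scaleR[of s "-1" A] by simp

text \<open>The inequality for \<open>v\<close> is stated through \<open>- v\<close>, so both
  functions are touched from above. After \<open>H\<close> has been made negative at
  \<open>y0\<close>, the maximum in the supersolution inequality must come from
  \<open>F\<close>.\<close>

lemma comparison_strict:
  assumes u: "continuous_on W u" and v: "continuous_on W v" and \<kappa>: "\<kappa> > 0"
    and U: "\<And>z \<psi> G Q. z \<in> interior W \<Longrightarrow> C2_with UNIV \<psi> G Q \<Longrightarrow>
       (\<And>x. x \<in> W \<Longrightarrow> u x - \<psi> x \<le> u z - \<psi> z) \<Longrightarrow>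
       Fop \<alpha> \<theta> \<sigma> g z (u z) (G z) (Q z) \<le> 0 \<and> H z (G z) \<le> - \<kappa>"
    and V: "\<And>z \<psi> G Q. z \<in> W \<Longrightarrow> C2_with UNIV \<psi> G Q \<Longrightarrow>
       (\<And>x. x \<in> W \<Longrightarrow> - v x - \<psi> x \<le> - v z - \<psi> z) \<Longrightarrow>
       0 \<le> max (Fop \<alpha> \<theta> \<sigma> g z (v z) (- G z) (- Q z)) (H z (- G z))"
    and x: "x \<in> W"
  shows "u x \<le> v x"
proof (rule ccontr)
  assume "\<not> u x \<le> v x"
  obtain z0 where z0: "z0 \<in> W" and zmax: "\<And>y. y \<in> W \<Longrightarrow> u y - v y \<le> u z0 - v z0"
    using continuous_attains_sup[OF W_compact _ continuous_on_diff[OF u v]] x by blast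
  define M where "M = u z0 - v z0"
  have M: "M > 0" using zmax[OF x] \<open>\<not> u x \<le> v x\<close> by (simp add: M_def)
  obtain \<eta> a where a: "a > 0" and cone: "\<And>w t. w \<in> W \<Longrightarrow> norm (w - z0) < a \<Longrightarrow> 0 < t \<Longrightarrow> t \<le> 1 \<Longrightarrow>
      ball (w + t *\<^sub>R \<eta>) (t * a) \<subseteq> interior W"
  proof -
    obtain \<eta> a where "a > 0" "\<forall>w\<in>W \<inter> ball z0 a. \<forall>t\<in>{0<..1}. ball (w + t *\<^sub>R \<eta>) (t * a) \<subseteq> interior W"
      using W_cone z0 by blast
    then show ?thesis by (intro that[of a \<eta>]) (auto simp: dist_norm norm_minus_commute)
  qed
  obtain Bv where Bv: "Bv \<ge> 0" "\<And>x. x \<in> W \<Longrightarrow> norm (v x) \<le> Bv"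
    using bounded_on_compact[OF W_compact v] by blast
  obtain Bt where Bt: "Bt \<ge> 0" "\<And>x. x \<in> W \<Longrightarrow> norm (\<theta> x) \<le> Bt"
    using bounded_on_compact[OF W_compact coeff_continuous(2)] by blast
  have "continuous_on W (\<lambda>x. energy (cols x))"
    unfolding energy_def by (intro continuous_intros coeff_continuous)
  then obtain E where E: "E \<ge> 0" "\<And>x. x \<in> W \<Longrightarrow> norm (energy (cols x)) \<le> E"
    using bounded_on_compact[OF W_compact] by blast
  define k where "k = real CARD('k)"
  \<comment> \<open>The final balance has error at most \<open>T \<epsilon> + 5 * b < 6 * b\<close>,
    whereas the left side is \<open>8 * b\<close>.\<close>
  define b where "b = \<alpha>\<^sub>0 * M / 8"
  have b: "b > 0" using alpha0_pos M by (simp add: b_def)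
  \<comment> \<open>Fixes the length of the shift: the diffusion error it causes survives as n
    grows, so \<delta> must make \<open>4 * k * C\<^sup>2 * (norm e)\<^sup>2\<close> at most
    \<open>b\<close>.\<close>
  define A where "A = 4 * k * C\<^sup>2 * (norm \<eta>)\<^sup>2 + 1"
  have A: "A > 0" by (simp add: A_def k_def add_nonneg_pos)
  define \<delta> where "\<delta> = min 1 (b / A)"
  have \<delta>: "0 < \<delta>" "\<delta> \<le> 1" using A b by (auto simp: \<delta>_def)
  define e where "e = \<delta> *\<^sub>R \<eta>"
  have small_e: "4 * k * C\<^sup>2 * (norm e)\<^sup>2 \<le> b"
  proof -
    have "4 * k * C\<^sup>2 * (norm e)\<^sup>2 = 4 * k * C\<^sup>2 * (norm \<eta>)\<^sup>2 * (\<delta> * \<delta>)"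
      by (simp add: e_def power_mult_distrib power2_eq_square)
    also have "\<dots> \<le> A * \<delta>"
    proof (rule mult_mono)
      show "4 * k * C\<^sup>2 * (norm \<eta>)\<^sup>2 \<le> A" unfolding A_def by simp
      show "\<delta> * \<delta> \<le> \<delta>" using mult_left_le[of \<delta> \<delta>] \<delta> by simp
    qed (use A \<delta> in auto)
    also have "\<dots> \<le> b"
    proof -
      have "\<delta> \<le> b / A" by (simp add: \<delta>_def)
      then show ?thesis using A by (simp add: pos_le_divide_eq mult.commute)
    qed
    finally show ?thesis .
  qed
  define \<nu> where "\<nu> = b / (2 * (E + 1))"
  have \<nu>: "\<nu> > 0" using b E by (simp add: \<nu>_def)
  have small_\<nu>: "2 * \<nu> * E \<le> b" using b E by (simp add: \<nu>_def field_simps)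
  \<comment> \<open>All errors that vanish with \<epsilon> once \<open>e\<close> and \<nu> are
    fixed: the defect of the maximum, the two drift terms and part of the diffusion error.\<close>
  define T where "T = (\<lambda>\<epsilon>. \<alpha>\<^sub>0 * \<epsilon> + 2 * C * (norm e + sqrt \<epsilon>) * sqrt \<epsilon> + 2 * Bt * sqrt \<nu> * sqrt \<epsilon> + 4 * k * C\<^sup>2 * \<epsilon>)"
  have sq0: "(sqrt \<longlongrightarrow> 0) (at_right 0)"
    using tendsto_real_sqrt[of "\<lambda>x. x" 0 "at_right 0"] by simp
  have "(T \<longlongrightarrow> 0) (at_right 0)"
    unfolding T_def by (rule tendsto_eq_intros sq0 refl | simp)+
  then have "\<forall>\<^sub>F \<epsilon> in at_right 0. T \<epsilon> < b" using b by (rule order_tendstoD)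
  moreover have "\<forall>\<^sub>F \<epsilon> in at_right 0. sqrt \<epsilon> < \<delta> * a"
    using order_tendstoD(2)[OF sq0] \<delta> a by simp
  moreover have "((\<lambda>\<epsilon>. C * (2 * sqrt \<nu> * sqrt \<epsilon>)) \<longlongrightarrow> 0) (at_right 0)"
    by (rule tendsto_eq_intros sq0 refl | simp)+
  then have "\<forall>\<^sub>F \<epsilon> in at_right 0. C * (2 * sqrt \<nu> * sqrt \<epsilon>) < \<kappa> / 4"
    using \<kappa> by (intro order_tendstoD) auto
  moreover have id: "((\<lambda>\<epsilon>::real. \<epsilon>) \<longlongrightarrow> 0) (at_right 0)" by (rule tendsto_ident_at)
  then have "\<forall>\<^sub>F \<epsilon> in at_right 0. \<epsilon> < \<nu> * a\<^sup>2"
    using \<nu> a by (intro order_tendstoD(2)[OF id]) simp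
  moreover have "\<forall>\<^sub>F \<epsilon> in at_right 0. \<epsilon> < M"
    using M by (intro order_tendstoD(2)[OF id]) simp
  moreover have "\<forall>\<^sub>F \<epsilon> in at_right 0. (0::real) < \<epsilon>"
    by (rule eventually_at_right_less)
  ultimately have "\<forall>\<^sub>F \<epsilon> in at_right 0. T \<epsilon> < b \<and> sqrt \<epsilon> < \<delta> * a \<and> C * (2 * sqrt \<nu> * sqrt \<epsilon>) < \<kappa> / 4 \<and>
      \<epsilon> < \<nu> * a\<^sup>2 \<and> \<epsilon> < M \<and> 0 < \<epsilon>"
    by eventually_elim simp
  then obtain \<epsilon> where \<epsilon>: "T \<epsilon> < b" "sqrt \<epsilon> < \<delta> * a" "C * (2 * sqrt \<nu> * sqrt \<epsilon>) < \<kappa> / 4"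
      "\<epsilon> < \<nu> * a\<^sup>2" "\<epsilon> < M" "0 < \<epsilon>"
    using eventually_happens'[OF trivial_limit_at_right_real] by blast
  obtain d where d: "d > 0" "\<And>x y q. x \<in> W \<Longrightarrow> y \<in> W \<Longrightarrow> norm (x - y) < d \<Longrightarrow>
      \<bar>g x - g y\<bar> \<le> min b (\<kappa> / 4) \<and> \<bar>H x q - H y q\<bar> \<le> min b (\<kappa> / 4)"
    using uniform_modulus[OF omega_lim modulus, of "min b (\<kappa> / 4)"] b \<kappa> by auto
  have shift: "z0 + (1 / n) *\<^sub>R e \<in> W" if "n \<ge> 1" for n :: nat
  proof -
    have t: "0 < \<delta> / n" "\<delta> / n \<le> 1" using that \<delta> by (auto simp: divide_le_eq)
    have "z0 + (\<delta> / n) *\<^sub>R \<eta> \<in> ball (z0 + (\<delta> / n) *\<^sub>R \<eta>) (\<delta> / n * a)"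
      unfolding centre_in_ball using t(1) a by (rule mult_pos_pos)
    also have "\<dots> \<subseteq> interior W" using cone[OF z0 _ t] a by simp
    finally show ?thesis using interior_subset by (auto simp: e_def)
  qed
  have "\<forall>\<^sub>F n::nat in sequentially. C * (norm e + sqrt \<epsilon>) * Bv / n < b"
    using b by (intro order_tendstoD(2)[OF lim_const_over_n])
  moreover have "\<forall>\<^sub>F n::nat in sequentially. (norm e + sqrt \<epsilon>) / n < d"
    using d(1) by (intro order_tendstoD(2)[OF lim_const_over_n])
  moreover have "\<forall>\<^sub>F n::nat in sequentially.
    (\<exists>x0\<in>W. \<exists>y0\<in>W.
     (\<forall>x\<in>W. \<forall>y\<in>W. u x - v y - (real n)\<^sup>2 * (norm (x - y - (1 / n) *\<^sub>R e))\<^sup>2 - \<nu> * (norm (y - z0))\<^sup>2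
        \<le> u x0 - v y0 - (real n)\<^sup>2 * (norm (x0 - y0 - (1 / n) *\<^sub>R e))\<^sup>2 - \<nu> * (norm (y0 - z0))\<^sup>2) \<and>
     (real n)\<^sup>2 * (norm (x0 - y0 - (1 / n) *\<^sub>R e))\<^sup>2 \<le> \<epsilon> \<and> \<nu> * (norm (y0 - z0))\<^sup>2 \<le> \<epsilon> \<and>
     u z0 - v z0 - \<epsilon> \<le> u x0 - v y0)"
    by (rule doubling_points[OF W_compact u v z0 _ _ less_imp_le[OF \<nu>] \<epsilon>(6)]) (use zmax shift in auto)
  ultimately have "\<forall>\<^sub>F n::nat in sequentially. C * (norm e + sqrt \<epsilon>) * Bv / n < b \<and> (norm e + sqrt \<epsilon>) / n < d \<and> n \<ge> 1 \<and>
    (\<exists>x0\<in>W. \<exists>y0\<in>W.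
     (\<forall>x\<in>W. \<forall>y\<in>W. u x - v y - (real n)\<^sup>2 * (norm (x - y - (1 / n) *\<^sub>R e))\<^sup>2 - \<nu> * (norm (y - z0))\<^sup>2
        \<le> u x0 - v y0 - (real n)\<^sup>2 * (norm (x0 - y0 - (1 / n) *\<^sub>R e))\<^sup>2 - \<nu> * (norm (y0 - z0))\<^sup>2) \<and>
     (real n)\<^sup>2 * (norm (x0 - y0 - (1 / n) *\<^sub>R e))\<^sup>2 \<le> \<epsilon> \<and> \<nu> * (norm (y0 - z0))\<^sup>2 \<le> \<epsilon> \<and>
     u z0 - v z0 - \<epsilon> \<le> u x0 - v y0)"
    using eventually_ge_at_top[of 1]
    by eventually_elim simp
  from eventually_happens'[OF sequentially_bot this] obtain n :: nat and x0 y0 where n: "C * (norm e + sqrt \<epsilon>) * Bv / n < b" "(norm e + sqrt \<epsilon>) / n < d" "n \<ge> 1"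
    and x0: "x0 \<in> W" and y0: "y0 \<in> W"
    and max: "\<And>x y. x \<in> W \<Longrightarrow> y \<in> W \<Longrightarrow> u x - v y - (real n)\<^sup>2 * (norm (x - y - (1 / n) *\<^sub>R e))\<^sup>2 - \<nu> * (norm (y - z0))\<^sup>2
        \<le> u x0 - v y0 - (real n)\<^sup>2 * (norm (x0 - y0 - (1 / n) *\<^sub>R e))\<^sup>2 - \<nu> * (norm (y0 - z0))\<^sup>2"
    and pen: "(real n)\<^sup>2 * (norm (x0 - y0 - (1 / n) *\<^sub>R e))\<^sup>2 \<le> \<epsilon>" "\<nu> * (norm (y0 - z0))\<^sup>2 \<le> \<epsilon>"
    and uv: "M - \<epsilon> \<le> u x0 - v y0"
    unfolding M_def by blast
  have npos: "real n > 0" using n by simp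
  define r0 where "r0 = x0 - y0 - (1 / n) *\<^sub>R e"
  have r0: "n * norm r0 \<le> sqrt \<epsilon>"
    using pen(1) by (intro real_le_rsqrt) (simp add: r0_def power_mult_distrib)
  define D where "D = norm e + sqrt \<epsilon>"
  have D0: "D \<ge> 0" using \<epsilon> by (simp add: D_def)
  have D: "norm (x0 - y0) \<le> D / n"
  proof -
    have "norm (x0 - y0) \<le> norm r0 + norm ((1 / n) *\<^sub>R e)"
      using norm_triangle_ineq[of r0 "(1 / n) *\<^sub>R e"] by (simp add: r0_def)
    also have "\<dots> \<le> sqrt \<epsilon> / n + norm e / n"
      using r0 npos by (intro add_mono) (auto simp: pos_le_divide_eq mult.commute)
    finally show ?thesis by (simp add: D_def add_divide_distrib)
  qed
  have xyd: "norm (x0 - y0) < d" using D n(2) by (simp add: D_def)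
  define p1 where "p1 = (2 * (real n)\<^sup>2) *\<^sub>R (x0 - y0 - (1 / n) *\<^sub>R e)"
  define p2 where "p2 = - p1 + (2 * \<nu>) *\<^sub>R (y0 - z0)"
  have p1: "norm p1 \<le> 2 * n * sqrt \<epsilon>"
  proof -
    have "norm p1 = 2 * n * (n * norm r0)" by (simp add: p1_def r0_def power2_eq_square)
    also have "\<dots> \<le> 2 * n * sqrt \<epsilon>" using r0 by (intro mult_left_mono) auto
    finally show ?thesis .
  qed
  have yz: "sqrt \<nu> * norm (y0 - z0) \<le> sqrt \<epsilon>"
    using pen(2) \<nu> by (intro real_le_rsqrt) (simp add: power_mult_distrib)
  have q: "norm ((2 * \<nu>) *\<^sub>R (y0 - z0)) \<le> 2 * sqrt \<nu> * sqrt \<epsilon>"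
  proof -
    have "norm ((2 * \<nu>) *\<^sub>R (y0 - z0)) = 2 * (sqrt \<nu> * sqrt \<nu>) * norm (y0 - z0)" using \<nu> by simp
    also have "\<dots> = 2 * sqrt \<nu> * (sqrt \<nu> * norm (y0 - z0))" by (simp only: mult.assoc)
    also have "\<dots> \<le> 2 * sqrt \<nu> * sqrt \<epsilon>" using yz \<nu> by (intro mult_left_mono) auto
    finally show ?thesis .
  qed
  \<comment> \<open>Since \<epsilon> < \<nu> a^2, the cone property applies at \<open>y0\<close>;
    since sqrt \<epsilon> < \<delta> a, the deviation \<open>r0\<close> keeps \<open>x0\<close> in
    the cone ball for parameter \<delta> / n.\<close>
  have x0_int: "x0 \<in> interior W"
  proof -
    define t where "t = \<delta> / n"
    have t: "0 < t" "t \<le> 1" using \<delta> n npos by (auto simp: t_def divide_le_eq)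
    have "\<nu> * (norm (y0 - z0))\<^sup>2 < \<nu> * a\<^sup>2" using pen(2) \<epsilon>(4) by linarith
    then have "(norm (y0 - z0))\<^sup>2 < a\<^sup>2" using \<nu> by simp
    then have ya: "norm (y0 - z0) < a" using a by (simp add: power2_less_imp_less)
    have "norm r0 < t * a"
    proof -
      have "n * norm r0 < \<delta> * a" using r0 \<epsilon>(2) by linarith
      then show ?thesis using npos by (simp add: t_def pos_less_divide_eq mult.commute)
    qed
    moreover have "x0 = y0 + t *\<^sub>R \<eta> + r0" by (simp add: r0_def t_def e_def)
    ultimately have "x0 \<in> ball (y0 + t *\<^sub>R \<eta>) (t * a)" by (simp add: dist_norm)
    then show ?thesis using cone[OF y0 ya t] by blast
  qed
  \<comment> \<open>With \<open>y\<close> frozen at \<open>y0\<close>, the quadratic penalty is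
    itself a smooth test function for \<open>u\<close> at the interior point
    \<open>x0\<close>.\<close>
  have Hx: "H x0 p1 \<le> - \<kappa>"
  proof -
    define c where "c = - (y0 + (1 / n) *\<^sub>R e)"
    have "C2_with UNIV (\<lambda>x. (real n)\<^sup>2 * ((x + c) \<bullet> (x + c))) (\<lambda>x. (real n)\<^sup>2 *\<^sub>R (2 *\<^sub>R (x + c))) (\<lambda>x. (real n)\<^sup>2 *\<^sub>R (2 *\<^sub>R mat 1))"
      by (intro C2_with_cmult C2_with_translate[where f = "\<lambda>x. x \<bullet> x"] C2_with_square)
    moreover have "u x - (real n)\<^sup>2 * ((x + c) \<bullet> (x + c)) \<le> u x0 - (real n)\<^sup>2 * ((x0 + c) \<bullet> (x0 + c))" if "x \<in> W" for x
    proof -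
      have "y + c = y - y0 - (1 / n) *\<^sub>R e" for y by (simp add: c_def)
      then show ?thesis using max[OF that y0] unfolding power2_norm_eq_inner by (simp only:)
    qed
    ultimately have "H x0 ((real n)\<^sup>2 *\<^sub>R (2 *\<^sub>R (x0 + c))) \<le> - \<kappa>"
      using U[OF x0_int] by blast
    moreover have "(real n)\<^sup>2 *\<^sub>R (2 *\<^sub>R (x0 + c)) = p1"
      by (simp add: p1_def c_def algebra_simps)
    ultimately show ?thesis by simp
  qed
  \<comment> \<open>Changing the gradient from \<open>p1\<close> to \<open>- p2\<close> costs at
    most \<kappa>/4 by the Lipschitz bound, and moving from \<open>x0\<close> to \<open>y0\<close>
    costs at most \<kappa>/4.\<close>
  have Hy: "H y0 (- p2) \<le> - (\<kappa> / 2)"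
  proof -
    have "\<bar>H x0 (- p2) - H x0 p1\<bar> \<le> C * norm (- p2 - p1)" using H_lip x0 by blast
    also have "norm (- p2 - p1) = norm ((2 * \<nu>) *\<^sub>R (y0 - z0))" by (simp add: p2_def norm_minus_commute)
    also have "C * \<dots> \<le> C * (2 * sqrt \<nu> * sqrt \<epsilon>)" using q C_ge by (intro mult_left_mono) auto
    finally have "\<bar>H x0 (- p2) - H x0 p1\<bar> \<le> \<kappa> / 4" using \<epsilon>(3) by linarith
    moreover have "\<bar>H x0 (- p2) - H y0 (- p2)\<bar> \<le> \<kappa> / 4" using d(2)[OF x0 y0 xyd] by simp
    ultimately show ?thesis using Hx by linarith
  qed
  have jet1: "jet_cond W cols u p1 x0 (\<alpha> x0 * u x0 - \<theta> x0 \<bullet> p1 - 1 * g x0 - b / 2)"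
  proof -
    obtain r where r: "r > 0" "ball x0 r \<subseteq> interior W"
      using x0_int open_contains_ball[of "interior W"] by auto
    show ?thesis
    proof (rule jet_cond_from_equation[OF u x0 _ r(1)])
      fix z \<psi> G Q
      assume z: "z \<in> W" "norm (z - x0) < r" and \<psi>: "C2_with UNIV \<psi> G Q"
        "\<And>x. x \<in> W \<Longrightarrow> u x - \<psi> x \<le> u z - \<psi> z"
      have "z \<in> interior W" using z(2) r(2) by (auto simp: dist_norm norm_minus_commute)
      from U[OF this \<psi>] show "\<alpha> z * u z - \<theta> z \<bullet> G z - 1 * g z \<le> diff_op (cols z) (Q z)"
        by (simp add: Fop_eq)
    qed (use b in simp)
  qed
  have jet2: "jet_cond W cols (\<lambda>x. - v x) p2 y0 (\<alpha> y0 * - v y0 - \<theta> y0 \<bullet> p2 - (- 1) * g y0 - b / 2)"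
  proof -
    obtain d' where d': "d' > 0" "\<And>x y q. x \<in> W \<Longrightarrow> y \<in> W \<Longrightarrow> norm (x - y) < d' \<Longrightarrow>
        \<bar>g x - g y\<bar> \<le> \<kappa> / 8 \<and> \<bar>H x q - H y q\<bar> \<le> \<kappa> / 8"
      using uniform_modulus[OF omega_lim modulus, of "\<kappa> / 8"] \<kappa> by auto
    define r where "r = min d' (\<kappa> / (8 * C))"
    have r: "r > 0" "r \<le> d'" "r \<le> \<kappa> / (8 * C)" using d' \<kappa> C_ge by (auto simp: r_def)
    show ?thesis
    proof (rule jet_cond_from_equation[OF continuous_on_minus[OF v] y0 _ r(1)])
      fix z \<psi> G Q
      assume z: "z \<in> W" "norm (z - y0) < r" and Gz: "norm (G z - p2) < r" and \<psi>: "C2_with UNIV \<psi> G Q"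
        "\<And>x. x \<in> W \<Longrightarrow> - v x - \<psi> x \<le> - v z - \<psi> z"
      have "\<bar>H z (- G z) - H y0 (- G z)\<bar> \<le> \<kappa> / 8" using d'(2)[OF z(1) y0] z(2) r by auto
      moreover have "\<bar>H y0 (- G z) - H y0 (- p2)\<bar> \<le> \<kappa> / 8"
      proof -
        have "\<bar>H y0 (- G z) - H y0 (- p2)\<bar> \<le> C * norm (- G z - - p2)" using H_lip y0 by blast
        also have "norm (- G z - - p2) = norm (G z - p2)" by (simp add: norm_minus_commute)
        also have "C * \<dots> \<le> C * (\<kappa> / (8 * C))" using Gz r C_ge by (intro mult_left_mono) auto
        also have "\<dots> = \<kappa> / 8" using C_ge by simp
        finally show ?thesis .
      qed
      ultimately have "H z (- G z) < 0" using Hy \<kappa> by linarith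
      moreover have "0 \<le> max (Fop \<alpha> \<theta> \<sigma> g z (v z) (- G z) (- Q z)) (H z (- G z))"
        by (rule V[OF z(1) \<psi>])
      ultimately have "0 \<le> Fop \<alpha> \<theta> \<sigma> g z (v z) (- G z) (- Q z)" by linarith
      then show "\<alpha> z * - v z - \<theta> z \<bullet> G z - (- 1) * g z \<le> diff_op (cols z) (Q z)"
        by (simp add: Fop_eq diff_op_uminus)
    qed (use b in simp)
  qed
  have "(\<alpha> x0 * u x0 - \<theta> x0 \<bullet> p1 - 1 * g x0 - b / 2) + (\<alpha> y0 * - v y0 - \<theta> y0 \<bullet> p2 - (- 1) * g y0 - b / 2)
      \<le> 2 * (real n)\<^sup>2 * energy (\<lambda>j. cols x0 j - cols y0 j) + 2 * \<nu> * energy (cols y0)"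
  proof (rule doubling_sums[OF W_compact x0 y0 u continuous_on_minus[OF v] coeff_continuous(3) _ less_imp_le[OF \<nu>] _ p1_def p2_def jet1 jet2])
    show "0 < (real n)\<^sup>2" using npos by simp
  qed (use max in simp)
  \<comment> \<open>As \<open>p2\<close> contains \<open>- p1\<close>, the large gradient survives
    only against \<theta> x0 - \<theta> y0, whose size O(1/n) compensates its growth in n.\<close>
  then have key: "\<alpha> x0 * (u x0 - v y0) \<le> (\<alpha> y0 - \<alpha> x0) * v y0 + (\<theta> x0 - \<theta> y0) \<bullet> p1 + \<theta> y0 \<bullet> ((2 * \<nu>) *\<^sub>R (y0 - z0))
      + (g x0 - g y0) + b + 2 * ((real n)\<^sup>2 * energy (\<lambda>j. cols x0 j - cols y0 j)) + 2 * \<nu> * energy (cols y0)"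
    unfolding p2_def by (simp add: algebra_simps inner_add_right inner_diff_left)
  have t1: "\<alpha>\<^sub>0 * (M - \<epsilon>) \<le> \<alpha> x0 * (u x0 - v y0)"
    using alpha_lb x0 uv alpha0_pos \<epsilon>(5) by (intro mult_mono) auto
  have t2: "(\<alpha> y0 - \<alpha> x0) * v y0 \<le> b"
  proof -
    have "(\<alpha> y0 - \<alpha> x0) * v y0 \<le> \<bar>\<alpha> y0 - \<alpha> x0\<bar> * \<bar>v y0\<bar>" by (simp flip: abs_mult)
    also have "\<dots> \<le> (C * (D / n)) * Bv"
    proof (intro mult_mono)
      have "\<bar>\<alpha> y0 - \<alpha> x0\<bar> \<le> C * norm (x0 - y0)"
        using lipschitz(1)[OF x0 y0] by (simp add: abs_minus_commute)
      also have "\<dots> \<le> C * (D / n)" using D C_ge by (intro mult_left_mono) auto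
      finally show "\<bar>\<alpha> y0 - \<alpha> x0\<bar> \<le> C * (D / n)" .
    qed (use Bv(2)[OF y0] Bv(1) C_ge D0 in auto)
    also have "\<dots> \<le> b" using n(1) by (simp add: D_def)
    finally show ?thesis .
  qed
  have t3: "(\<theta> x0 - \<theta> y0) \<bullet> p1 \<le> 2 * C * D * sqrt \<epsilon>"
  proof -
    have "(\<theta> x0 - \<theta> y0) \<bullet> p1 \<le> norm (\<theta> x0 - \<theta> y0) * norm p1" by (rule norm_cauchy_schwarz)
    also have "\<dots> \<le> (C * (D / n)) * (2 * n * sqrt \<epsilon>)"
    proof (intro mult_mono p1)
      show "norm (\<theta> x0 - \<theta> y0) \<le> C * (D / n)"
        using lipschitz(2)[OF x0 y0] D C_ge by (meson mult_left_mono order_trans zero_le_one)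
    qed (use C_ge D0 in auto)
    also have "\<dots> = 2 * C * D * sqrt \<epsilon>" using npos by simp
    finally show ?thesis .
  qed
  have t4: "\<theta> y0 \<bullet> ((2 * \<nu>) *\<^sub>R (y0 - z0)) \<le> 2 * Bt * sqrt \<nu> * sqrt \<epsilon>"
  proof -
    have "\<theta> y0 \<bullet> ((2 * \<nu>) *\<^sub>R (y0 - z0)) \<le> norm (\<theta> y0) * norm ((2 * \<nu>) *\<^sub>R (y0 - z0))"
      by (rule norm_cauchy_schwarz)
    also have "\<dots> \<le> Bt * (2 * sqrt \<nu> * sqrt \<epsilon>)" by (intro mult_mono q Bt(2)[OF y0] Bt(1)) auto
    finally show ?thesis by (simp add: mult_ac)
  qed
  have t5: "g x0 - g y0 \<le> b" using d(2)[OF x0 y0 xyd, of 0] by linarith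
  have t6: "2 * ((real n)\<^sup>2 * energy (\<lambda>j. cols x0 j - cols y0 j)) \<le> b + 4 * k * C\<^sup>2 * \<epsilon>"
  proof -
    have "(real n)\<^sup>2 * energy (\<lambda>j. cols x0 j - cols y0 j) \<le> (real n)\<^sup>2 * (k * (C * norm (x0 - y0))\<^sup>2)"
      using energy_cols_diff_le[OF x0 y0] by (intro mult_left_mono) (auto simp: k_def)
    also have "\<dots> \<le> (real n)\<^sup>2 * (k * (C * (D / n))\<^sup>2)"
      using D C_ge by (intro mult_left_mono power_mono) (auto simp: k_def)
    also have "\<dots> = k * C\<^sup>2 * D\<^sup>2" using npos by (simp add: power_mult_distrib power_divide)
    also have "\<dots> \<le> k * C\<^sup>2 * (2 * (norm e)\<^sup>2 + 2 * \<epsilon>)"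
    proof (rule mult_left_mono)
      have "0 \<le> (norm e - sqrt \<epsilon>)\<^sup>2" by simp
      then show "D\<^sup>2 \<le> 2 * (norm e)\<^sup>2 + 2 * \<epsilon>"
        using \<epsilon>(6) unfolding D_def by (simp add: power2_sum power2_diff)
    qed (simp add: k_def)
    finally show ?thesis using small_e by (simp add: algebra_simps)
  qed
  have t7: "2 * \<nu> * energy (cols y0) \<le> b"
  proof -
    have "2 * \<nu> * energy (cols y0) \<le> 2 * \<nu> * E" using E(2)[OF y0] \<nu> by (intro mult_left_mono) (auto simp: abs_le_iff)
    then show ?thesis using small_\<nu> by linarith
  qed
  have "\<alpha>\<^sub>0 * M \<le> T \<epsilon> + 5 * b"
    using key t1 t2 t3 t4 t5 t6 t7 unfolding T_def D_def[symmetric] right_diff_distrib by linarith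
  moreover have "\<alpha>\<^sub>0 * M = 8 * b" by (simp add: b_def)
  ultimately show False using b \<epsilon>(1) by linarith
qed

end

section \<open>Preparations for making the subsolution strict\<close>

context hjb
begin

text \<open>Short steps along the cone enter the interior. Hence the subsolution, given as
  continuous on the closure of the interior, is continuous on all of \<open>W\<close>.\<close>

lemma closure_interior_W: "closure (interior W) = W"
proof
  show "closure (interior W) \<subseteq> W"
    using W_closed interior_subset by (rule closure_minimal[rotated])
  show "W \<subseteq> closure (interior W)"
  proof
    fix w assume w: "w \<in> W"
    then obtain \<eta> a where a: "a > 0"
        "\<forall>w'\<in>W \<inter> ball w a. \<forall>t\<in>{0<..1}. ball (w' + t *\<^sub>R \<eta>) (t * a) \<subseteq> interior W"
      using W_cone by blast
    have "\<exists>y\<in>interior W. dist y w < e" if e: "e > 0" for e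
    proof
      define t where "t = min 1 (e / (norm \<eta> + 1))"
      have t: "0 < t" "t \<le> 1" using e by (auto simp: t_def add_nonneg_pos)
      have "w + t *\<^sub>R \<eta> \<in> ball (w + t *\<^sub>R \<eta>) (t * a)"
        unfolding centre_in_ball using t(1) a(1) by (rule mult_pos_pos)
      then show "w + t *\<^sub>R \<eta> \<in> interior W" using a w t by fastforce
      have "t \<le> e / (norm \<eta> + 1)" by (simp add: t_def)
      moreover have "0 < norm \<eta> + 1" by (simp add: add_nonneg_pos)
      ultimately have "t * (norm \<eta> + 1) \<le> e" by (simp only: pos_le_divide_eq)
      then have "t * norm \<eta> + t \<le> e" by (simp add: distrib_left)
      then show "dist (w + t *\<^sub>R \<eta>) w < e" using t by (simp add: dist_norm)
    qed
    then show "w \<in> closure (interior W)" by (simp add: closure_approachable)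
  qed
qed

lemma Fop_classical_bounded:
  assumes "C2_on W \<psi>"
  obtains B where "B \<ge> 0" "\<And>x. x \<in> W \<Longrightarrow> Fop \<alpha> \<theta> \<sigma> g x (\<psi> x) (grad \<psi> x) (hess \<psi> x) \<le> B"
proof -
  obtain U where U: "open U" "W \<subseteq> U" "C2_with U \<psi> (grad \<psi>) (hess \<psi>)"
    using C2_on_imp_C2_with[OF assms] by blast
  have c: "continuous_on W \<psi>" "continuous_on W (hess \<psi>)"
    using U C2_with_continuous continuous_on_subset unfolding C2_with_def by blast+
  have d: "continuous_on W (grad \<psi>)"
    using U unfolding C2_with_def
    by (meson continuous_on_eq_continuous_within has_derivative_at_withinI has_derivative_continuous subsetD)
  have e: "continuous_on W (\<lambda>x. diff_op (cols x) (hess \<psi> x))"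
  proof -
    have "continuous_on W (\<lambda>x. hess \<psi> x *v column j (\<sigma> x))" for j
      unfolding matrix_vector_mult_def using coeff_continuous(3)
      by (intro continuous_intros c)
    then show ?thesis unfolding diff_op_def by (intro continuous_intros coeff_continuous) auto
  qed
  have "continuous_on W (\<lambda>x. Fop \<alpha> \<theta> \<sigma> g x (\<psi> x) (grad \<psi> x) (hess \<psi> x))"
    unfolding Fop_eq by (intro continuous_intros coeff_continuous c d e)
  then obtain B where "B \<ge> 0" "\<And>x. x \<in> W \<Longrightarrow> norm (Fop \<alpha> \<theta> \<sigma> g x (\<psi> x) (grad \<psi> x) (hess \<psi> x)) \<le> B"
    using bounded_on_compact[OF W_compact] by blast
  then show ?thesis using that by (auto simp: abs_le_iff)
qed

end

theorem theorem5p1: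
  fixes W :: "(real^'d) set"
    and \<alpha> :: "real^'d \<Rightarrow> real" and \<theta> :: "real^'d \<Rightarrow> real^'d"
    and \<sigma> :: "real^'d \<Rightarrow> real^'k^'d" and g :: "real^'d \<Rightarrow> real"
    and H :: "real^'d \<Rightarrow> real^'d \<Rightarrow> real"
    and C \<alpha>\<^sub>0 :: real and \<omega> :: "real \<Rightarrow> real"
    and \<gamma> :: real and \<psi>\<^sub>0 :: "real^'d \<Rightarrow> real"
    and vc v :: "real^'d \<Rightarrow> real"
  assumes W_closed: "closed W" and W_bounded: "bounded W"
    and W_cone: "\<forall>\<xi>\<in>W. \<exists>\<eta> a. a > 0 \<and>
        (\<forall>w\<in>W \<inter> ball \<xi> a. \<forall>t\<in>{0<..1}. ball (w + t *\<^sub>R \<eta>) (t * a) \<subseteq> interior W)"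
    and C_ge: "C \<ge> 1" and alpha0_pos: "\<alpha>\<^sub>0 > 0"
    and omega_nonneg: "\<forall>t\<ge>0. \<omega> t \<ge> 0"
    and omega_lim: "(\<omega> \<longlongrightarrow> 0) (at_right 0)"
    and lip: "\<forall>x\<in>W. \<forall>y\<in>W. \<bar>\<alpha> x - \<alpha> y\<bar> + norm (\<theta> x - \<theta> y) + opnorm (\<sigma> x - \<sigma> y)
                 \<le> C * norm (x - y)"
    and alpha_lb: "\<forall>x\<in>W. \<alpha> x \<ge> \<alpha>\<^sub>0"
    and modulus: "\<forall>x\<in>W. \<forall>y\<in>W. \<forall>q. \<bar>g x - g y\<bar> + \<bar>H x q - H y q\<bar> \<le> \<omega> (norm (x - y))"
    and H_lip: "\<forall>x\<in>W. \<forall>q1 q2. \<bar>H x q1 - H x q2\<bar> \<le> C * norm (q1 - q2)"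
    and H_convex: "\<forall>x\<in>W. convex_on UNIV (\<lambda>q. H x q)"
    and gamma_pos: "\<gamma> > 0" and psi0_C2: "C2_on W \<psi>\<^sub>0"
    and psi0_strict: "\<forall>x\<in>interior W. H x (grad \<psi>\<^sub>0 x) \<le> - \<gamma>"
    and sub: "visc_sub \<alpha> \<theta> \<sigma> g H (interior W) vc"
    and super: "visc_super \<alpha> \<theta> \<sigma> g H W v"
  shows "\<forall>x\<in>W. vc x \<le> v x"
proof
  fix x assume x: "x \<in> W"
  interpret hjb W \<alpha> \<theta> \<sigma> g H C \<alpha>\<^sub>0 \<omega>
    by unfold_locales (fact assms)+
  obtain B where B: "B \<ge> 0" "\<And>x. x \<in> W \<Longrightarrow> Fop \<alpha> \<theta> \<sigma> g x (\<psi>\<^sub>0 x) (grad \<psi>\<^sub>0 x) (hess \<psi>\<^sub>0 x) \<le> B"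
    using Fop_classical_bounded[OF psi0_C2] by blast
  \<comment> \<open>Lowering \<psi> by \<open>K\<close> reduces the zeroth-order term by at least
    \<open>B\<close>, so \<open>\<psi>\<^sub>0 - K\<close> satisfies the inequality for
    \<open>F\<close> classically.\<close>
  define K where "K = B / \<alpha>\<^sub>0"
  have K: "K \<ge> 0" "\<alpha>\<^sub>0 * K = B" using B alpha0_pos by (auto simp: K_def)
  obtain U where U: "open U" "W \<subseteq> U" "C2_with U \<psi>\<^sub>0 (grad \<psi>\<^sub>0) (hess \<psi>\<^sub>0)"
    using C2_on_imp_C2_with[OF psi0_C2] by blast
  have \<psi>0: "C2_with (interior W) \<psi>\<^sub>0 (grad \<psi>\<^sub>0) (hess \<psi>\<^sub>0)"
    using C2_with_subset[OF U(3)] U(2) interior_subset by blast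
  have v: "continuous_on W v"
    using super W_closed by (simp add: visc_super_def)
  have vc: "continuous_on W vc"
    using sub closure_interior_W by (simp add: visc_sub_def)
  have \<psi>0c: "continuous_on W \<psi>\<^sub>0"
    using C2_with_continuous[OF U(3)] U(2) continuous_on_subset by blast
  have le: "(1 - \<mu>) * vc x + \<mu> * (\<psi>\<^sub>0 x - K) \<le> v x" if \<mu>: "0 < \<mu>" "\<mu> < 1" for \<mu>
  proof (rule comparison_strict[where \<kappa> = "\<mu> * \<gamma>", OF _ v _ _ _ x])
    show "continuous_on W (\<lambda>x. (1 - \<mu>) * vc x + \<mu> * (\<psi>\<^sub>0 x - K))"
      by (intro continuous_intros vc \<psi>0c)
    show "0 < \<mu> * \<gamma>" using \<mu> gamma_pos by simp
  next
    fix z \<psi> G Q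
    assume z: "z \<in> W" and \<psi>: "C2_with UNIV \<psi> G Q" "\<And>x. x \<in> W \<Longrightarrow> - v x - \<psi> x \<le> - v z - \<psi> z"
    define \<phi> where "\<phi> = (\<lambda>x. - 1 * \<psi> x)"
    have \<phi>: "C2_with UNIV \<phi> (\<lambda>x. - 1 *\<^sub>R G x) (\<lambda>x. - 1 *\<^sub>R Q x)"
      unfolding \<phi>_def by (rule C2_with_cmult[OF \<psi>(1)])
    have "C2_on W \<phi>" using C2_with_imp_C2_on[OF \<phi>] by simp
    moreover have "v z - \<phi> z \<le> v x - \<phi> x" if "x \<in> W" for x using \<psi>(2)[OF that] by (simp add: \<phi>_def)
    ultimately show "0 \<le> max (Fop \<alpha> \<theta> \<sigma> g z (v z) (- G z) (- Q z)) (H z (- G z))"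
      using super z C2_with_grad[OF \<phi>, of z] C2_with_hess[OF \<phi>, of z] unfolding visc_super_def by fastforce
  next
    fix z \<psi> G Q
    assume z: "z \<in> interior W" and \<psi>: "C2_with UNIV \<psi> G Q"
      and max: "\<And>x. x \<in> W \<Longrightarrow> (1 - \<mu>) * vc x + \<mu> * (\<psi>\<^sub>0 x - K) - \<psi> x \<le> (1 - \<mu>) * vc z + \<mu> * (\<psi>\<^sub>0 z - K) - \<psi> z"
    have zW: "z \<in> W" using z interior_subset by blast
    \<comment> \<open>The test function for the mixture, solved for a test function of
      \<open>vc\<close>: \<open>vc - \<phi>\<close> is the mixture minus \<psi>, divided by the
      positive number 1 - \<mu>.\<close>
    define \<phi> where "\<phi> = (\<lambda>x. (1 / (1 - \<mu>)) * (\<psi> x + - \<mu> * (\<psi>\<^sub>0 x + - K)))"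
    define p where "p = (1 / (1 - \<mu>)) *\<^sub>R (G z + - \<mu> *\<^sub>R (grad \<psi>\<^sub>0 z + 0))"
    define X where "X = (1 / (1 - \<mu>)) *\<^sub>R (Q z + - \<mu> *\<^sub>R (hess \<psi>\<^sub>0 z + 0))"
    have \<phi>: "C2_with (interior W) \<phi> (\<lambda>x. (1 / (1 - \<mu>)) *\<^sub>R (G x + - \<mu> *\<^sub>R (grad \<psi>\<^sub>0 x + 0)))
        (\<lambda>x. (1 / (1 - \<mu>)) *\<^sub>R (Q x + - \<mu> *\<^sub>R (hess \<psi>\<^sub>0 x + 0)))"
      unfolding \<phi>_def
      by (intro C2_with_cmult C2_with_add C2_with_subset[OF \<psi>] \<psi>0 C2_with_const) auto
    have gh: "grad \<phi> z = p" "hess \<phi> z = X"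
      using C2_with_grad[OF \<phi> z] C2_with_hess[OF \<phi> open_interior z] by (simp_all add: p_def X_def)
    have "C2_on (interior W) \<phi>" using C2_with_imp_C2_on[OF \<phi>] by simp
    moreover have "vc x - \<phi> x \<le> vc z - \<phi> z" if "x \<in> interior W" for x
    proof -
      have "vc y - \<phi> y = (1 / (1 - \<mu>)) * ((1 - \<mu>) * vc y + \<mu> * (\<psi>\<^sub>0 y - K) - \<psi> y)" for y
        using \<mu> by (simp add: \<phi>_def field_simps)
      then show ?thesis
        using max[of x] that interior_subset \<mu> by (auto intro!: divide_right_mono)
    qed
    ultimately have "max (Fop \<alpha> \<theta> \<sigma> g z (vc z) p X) (H z p) \<le> 0"
      using sub z unfolding visc_sub_def gh[symmetric] by blast
    then have F: "Fop \<alpha> \<theta> \<sigma> g z (vc z) p X \<le> 0" and Hp: "H z p \<le> 0" by auto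
    have G: "G z = (1 - \<mu>) *\<^sub>R p + \<mu> *\<^sub>R grad \<psi>\<^sub>0 z" and Q: "Q z = (1 - \<mu>) *\<^sub>R X + \<mu> *\<^sub>R hess \<psi>\<^sub>0 z"
      using \<mu> by (simp_all add: p_def X_def)
    \<comment> \<open>Convexity transfers the strict negativity at the gradient of
      \<open>\<psi>\<^sub>0\<close> to the mixture with gap \<mu> \<gamma>; \<open>F\<close>, being
      affine in the jet, passes to the mixture exactly.\<close>
    have "H z (G z) \<le> (1 - \<mu>) * H z p + \<mu> * H z (grad \<psi>\<^sub>0 z)"
      unfolding G using H_convex zW \<mu> by (intro convex_onD) auto
    also have "\<dots> \<le> 0 + \<mu> * - \<gamma>"
      using Hp psi0_strict z \<mu> by (intro add_mono mult_left_mono mult_nonneg_nonpos) auto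
    finally have HG: "H z (G z) \<le> - (\<mu> * \<gamma>)" by simp
    have "Fop \<alpha> \<theta> \<sigma> g z ((1 - \<mu>) * vc z + \<mu> * (\<psi>\<^sub>0 z - K)) (G z) (Q z)
        = (1 - \<mu>) * Fop \<alpha> \<theta> \<sigma> g z (vc z) p X
          + \<mu> * (Fop \<alpha> \<theta> \<sigma> g z (\<psi>\<^sub>0 z) (grad \<psi>\<^sub>0 z) (hess \<psi>\<^sub>0 z) - \<alpha> z * K)"
      unfolding G Q Fop_eq diff_op_add diff_op_scaleR by (simp add: inner_add_right algebra_simps)
    also have "\<dots> \<le> 0"
    proof -
      have "\<alpha>\<^sub>0 * K \<le> \<alpha> z * K" using alpha_lb zW K(1) by (intro mult_right_mono) auto
      then have "Fop \<alpha> \<theta> \<sigma> g z (\<psi>\<^sub>0 z) (grad \<psi>\<^sub>0 z) (hess \<psi>\<^sub>0 z) - \<alpha> z * K \<le> 0"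
        using B(2)[OF zW] K(2) by linarith
      then show ?thesis using F \<mu> by (intro add_nonpos_nonpos mult_nonneg_nonpos) auto
    qed
    finally show "Fop \<alpha> \<theta> \<sigma> g z ((1 - \<mu>) * vc z + \<mu> * (\<psi>\<^sub>0 z - K)) (G z) (Q z) \<le> 0 \<and> H z (G z) \<le> - (\<mu> * \<gamma>)"
      using HG by simp
  qed
  have "((\<lambda>\<mu>. (1 - \<mu>) * vc x + \<mu> * (\<psi>\<^sub>0 x - K)) \<longlongrightarrow> vc x) (at_right 0)"
    by (rule tendsto_eq_intros refl | simp)+
  moreover have "\<forall>\<^sub>F \<mu> in at_right 0. (1 - \<mu>) * vc x + \<mu> * (\<psi>\<^sub>0 x - K) \<le> v x"
    by (rule eventually_mono[OF eventually_at_right_real[of 0 1]]) (auto intro: le)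
  ultimately show "vc x \<le> v x"
    by (rule tendsto_upperbound) simp
qed

end
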